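(* Let $\hat{x}_\epsilon=(\hat\alpha_\epsilon,\hat\omega_\epsilon,\hat c_\epsilon)$, $0<\epsilon\le 0.1$, be the solution branch of $F_\epsilon(\alpha,\omega,c)=0$ described in the context. For $0<\epsilon\le 0.1$ we have $\frac{d}{d\epsilon}\hat\alpha_\epsilon>0$. For $\tfrac{\pi}{2}<\alpha\le\tfrac{\pi}{2}+6.830\times10^{-3}$ there are no bifurcations in the branch of slowly oscillating periodic solutions of Wright's equation $y'(t)=-\alpha y(t-1)[1+y(t)]$ that originates from the Hopf bifurcation (at $\alpha=\tfrac{\pi}{2}$).
   Context: $\ell^1$ is the space of complex sequences $a=\{a_k\}_{k\ge1}$ with norm $\|a\|:=2\sum_{k\ge1}|a_k|<\infty$; such $a$ is identified with a bi-infinite sequence via $a_0=0$, $a_{-k}=\overline{a_k}$. $\ell^1_0:=\{a\in\ell^1:a_1=0\}$. Operators on $\ell^1$: $[Ka]_k=k^{-1}a_k$, $[U_\omega a]_k=e^{-ik\omega}a_k$, $[\sigma^-a]_k=a_{k+1}$, $[\sigma^+a]_k=a_{k-1}$ (with $a_0=0$), $L_\omega=\sigma^+(e^{-i\omega}I+U_\omega)+\sigma^-(e^{i\omega}I+U_\omega)$. $\ell^K_0:=\{a\in\ell^1_0:K^{-1}a\in\ell^1\}$. Convolution: $[a*b]_k=\sum_{k_1+k_2=k,\,k_1,k_2\in\mathbb{Z}}a_{k_1}b_{k_2}$ for $k\ge1$. $\mathrm{e}_j$ is the sequence with $1$ in position $j$ and $0$ elsewhere. For $\epsilon\ge0$,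 $(\alpha,\omega,c)\in\mathbb{R}^2\times\ell^K_0$, $$F_\epsilon(\alpha,\omega,c):=[i\omega+\alpha e^{-i\omega}]\mathrm{e}_1+(i\omega K^{-1}+\alpha U_\omega)c+\epsilon\alpha e^{-i\omega}\mathrm{e}_2+\alpha\epsilon L_\omega c+\alpha\epsilon[U_\omega c]*c\in\ell^1.$$ For $\epsilon>0$ and $\alpha,\omega>0$, $F_\epsilon(\alpha,\omega,c)=0$ if and only if $y(t)=\epsilon(e^{i\omega t}+e^{-i\omega t})+\epsilon\sum_{k\ge2}(c_ke^{i\omega kt}+\overline{c_k}e^{-i\omega kt})$ solves Wright's equation. Put $\bar\alpha_\epsilon=\tfrac{\pi}{2}+\tfrac{\epsilon^2}{5}(\tfrac{3\pi}{2}-1)$, $\bar\omega_\epsilon=\tfrac{\pi}{2}-\tfrac{\epsilon^2}{5}$, $\bar c_\epsilon=\tfrac{2-i}{5}\epsilon\,\mathrm{e}_2$. For each $0<\epsilon\le0.1$ there is a unique zero $\hat x_\epsilon=(\hat\alpha_\epsilon,\hat\omega_\epsilon,\hat c_\epsilon)\in\mathbb{R}^2\times\ell^K_0$ of $F_\epsilon$ with $|\hat\alpha_\epsilon-\bar\alpha_\epsilon|<0.0594\,\epsilon^2$, $|\hat\omega_\epsilon-\bar\omega_\epsilon|<0.0260\,\epsilon^2$, $\|\hat c_\epsilon-\bar c_\epsilon\|<0.4929\,\epsilon^2$, $\|K^{-1}\hat c_\epsilon\|<0.3191$, and it depends smoothly on $\epsilon$. The family $\{\hat x_\epsilon\}_{0<\epsilon\le0.1}$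 (equivalently, the corresponding periodic solutions of Wright's equation) lies on the branch originating from the Hopf bifurcation at $\alpha=\tfrac{\pi}{2}$. A slowly oscillating periodic solution is a periodic solution $y$ which, up to a time translation, satisfies: there are $t_-,t_+>1$ with $y<0$ on $(-t_-,0)$, $y>0$ on $(0,t_+)$, and $y(t+L)=y(t)$ for all $t$, where $L=t_-+t_+$, so that $L$ is the minimal period of $y$. *)

theory Defs
  imports "HOL-Analysis.Analysis"
begin

(* A sequence {a_k}, k >= 1, is a function nat => complex whose entry at the dummy index 0 is 0;
   this agrees with the convention a_0 = 0 of the bi-infinite extension. *)

type_synonym cseq = "nat \<Rightarrow> complex"

definition l1 :: "cseq set" where
  "l1 = {a. a 0 = 0 \<and> summable (\<lambda>k. cmod (a k))}"

definition l1_norm :: "cseq \<Rightarrow> real" where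
  "l1_norm a = 2 * (\<Sum>k. cmod (a k))"

definition l1_0 :: "cseq set" where
  "l1_0 = {a \<in> l1. a 1 = 0}"

definition K_inv :: "cseq \<Rightarrow> cseq" where
  "K_inv a k = of_nat k * a k"

definition lK_0 :: "cseq set" where
  "lK_0 = {a \<in> l1_0. K_inv a \<in> l1}"

definition bi_ext :: "cseq \<Rightarrow> int \<Rightarrow> complex" where
  "bi_ext a k = (if k = 0 then 0 else if k > 0 then a (nat k) else cnj (a (nat (- k))))"

definition U_op :: "real \<Rightarrow> cseq \<Rightarrow> cseq" where
  "U_op \<omega> a k = exp (- \<i> * of_nat k * of_real \<omega>) * a k"

definition shift_minus :: "cseq \<Rightarrow> cseq" where
  "shift_minus a k = (if k = 0 then 0 else a (k + 1))"

definition shift_plus :: "cseq \<Rightarrow> cseq" where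
  "shift_plus a k = (if k = 0 then 0 else a (k - 1))"

definition L_op :: "real \<Rightarrow> cseq \<Rightarrow> cseq" where
  "L_op \<omega> a k =
     shift_plus (\<lambda>j. exp (- \<i> * of_real \<omega>) * a j + U_op \<omega> a j) k
   + shift_minus (\<lambda>j. exp (\<i> * of_real \<omega>) * a j + U_op \<omega> a j) k"

definition conv :: "cseq \<Rightarrow> cseq \<Rightarrow> cseq" where
  "conv a b k = (if k = 0 then 0
     else (\<Sum>\<^sub>\<infinity>j\<in>(UNIV :: int set). bi_ext a j * bi_ext b (int k - j)))"

definition unit_seq :: "nat \<Rightarrow> cseq" where
  "unit_seq j k = (if k = j then 1 else 0)"

definition F_map :: "real \<Rightarrow> real \<Rightarrow> real \<Rightarrow> cseq \<Rightarrow> cseq" where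
  "F_map \<epsilon> \<alpha> \<omega> c k =
     (\<i> * of_real \<omega> + of_real \<alpha> * exp (- \<i> * of_real \<omega>)) * unit_seq 1 k
   + (\<i> * of_real \<omega> * K_inv c k + of_real \<alpha> * U_op \<omega> c k)
   + of_real \<epsilon> * of_real \<alpha> * exp (- \<i> * of_real \<omega>) * unit_seq 2 k
   + of_real \<alpha> * of_real \<epsilon> * L_op \<omega> c k
   + of_real \<alpha> * of_real \<epsilon> * conv (U_op \<omega> c) c k"

definition alpha_bar :: "real \<Rightarrow> real" where
  "alpha_bar \<epsilon> = pi / 2 + \<epsilon>\<^sup>2 / 5 * (3 * pi / 2 - 1)"

definition omega_bar :: "real \<Rightarrow> real" where
  "omega_bar \<epsilon> = pi / 2 - \<epsilon>\<^sup>2 / 5"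

definition c_bar :: "real \<Rightarrow> cseq" where
  "c_bar \<epsilon> k = (2 - \<i>) / 5 * of_real \<epsilon> * unit_seq 2 k"

definition is_local_zero :: "real \<Rightarrow> real \<Rightarrow> real \<Rightarrow> cseq \<Rightarrow> bool" where
  "is_local_zero \<epsilon> \<alpha> \<omega> c \<longleftrightarrow>
     c \<in> lK_0 \<and> (\<forall>k. F_map \<epsilon> \<alpha> \<omega> c k = 0) \<and>
     \<bar>\<alpha> - alpha_bar \<epsilon>\<bar> < 0.0594 * \<epsilon>\<^sup>2 \<and>
     \<bar>\<omega> - omega_bar \<epsilon>\<bar> < 0.0260 * \<epsilon>\<^sup>2 \<and>
     l1_norm (\<lambda>k. c k - c_bar \<epsilon> k) < 0.4929 * \<epsilon>\<^sup>2 \<and>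
     l1_norm (K_inv c) < 0.3191"

(* Derivatives are taken in the norm of R x R x lK_0, with norm ||K^{-1} c|| on lK_0;
   D n is the n-th derivative. At end points of I they are one-sided. *)

definition smooth_family_on ::
    "real set \<Rightarrow> (real \<Rightarrow> real) \<Rightarrow> (real \<Rightarrow> real) \<Rightarrow> (real \<Rightarrow> cseq) \<Rightarrow> bool" where
  "smooth_family_on I \<alpha> \<omega> c \<longleftrightarrow>
     (\<exists>D\<alpha> D\<omega> Dc.
        (\<forall>\<epsilon>\<in>I. D\<alpha> (0::nat) \<epsilon> = \<alpha> \<epsilon> \<and> D\<omega> (0::nat) \<epsilon> = \<omega> \<epsilon> \<and> Dc (0::nat) \<epsilon> = c \<epsilon>) \<and>
        (\<forall>n. \<forall>\<epsilon>\<in>I.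
           Dc n \<epsilon> \<in> lK_0 \<and>
           (D\<alpha> n has_real_derivative D\<alpha> (Suc n) \<epsilon>) (at \<epsilon> within I) \<and>
           (D\<omega> n has_real_derivative D\<omega> (Suc n) \<epsilon>) (at \<epsilon> within I) \<and>
           ((\<lambda>\<eta>. l1_norm (K_inv (\<lambda>k. (Dc n \<eta> k - Dc n \<epsilon> k) / of_real (\<eta> - \<epsilon>) - Dc (Suc n) \<epsilon> k)))
              \<longlongrightarrow> 0) (at \<epsilon> within I)))"

definition wright_solution :: "real \<Rightarrow> (real \<Rightarrow> real) \<Rightarrow> bool" where
  "wright_solution \<alpha> y \<longleftrightarrow>
     (\<forall>t. (y has_real_derivative (- \<alpha> * y (t - 1) * (1 + y t))) (at t))"

(* y is already translated so that its upward zero crossing is at 0. Each slowly oscillating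
   periodic solution has exactly one translate of this form (up to multiples of its period),
   so these y represent the solutions up to time translation. The sign conditions make L the
   minimal period. *)

definition sops :: "real \<Rightarrow> real \<Rightarrow> (real \<Rightarrow> real) \<Rightarrow> bool" where
  "sops \<alpha> L y \<longleftrightarrow> wright_solution \<alpha> y \<and>
     (\<exists>tm tp. tm > 1 \<and> tp > 1 \<and> L = tm + tp \<and>
        (\<forall>t. - tm < t \<and> t < 0 \<longrightarrow> y t < 0) \<and>
        (\<forall>t. 0 < t \<and> t < tp \<longrightarrow> y t > 0) \<and>
        (\<forall>t. y (t + L) = y t))"

(* The solution y of period L at parameter alpha is recorded as (alpha, L, z) with the 1-periodic
   profile z s = y (L s), in the topology of R x R x (bounded continuous functions, sup norm).
   Solutions of different periods never get close in the sup norm on R without this rescaling. *)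

type_synonym orbit = "real \<times> real \<times> (real \<Rightarrow>\<^sub>C real)"

definition sops_set :: "orbit set" where
  "sops_set = {(\<alpha>, L, z). sops \<alpha> L (\<lambda>t. apply_bcontfun z (t / L))}"

(* The linearization y' = -(pi/2) y(t-1) at the Hopf bifurcation oscillates with frequency pi/2,
   that is, with period 4. *)

definition hopf_point :: orbit where
  "hopf_point = (pi / 2, 4, 0)"

(* The branch is followed from the Hopf point as long as pi/2 < alpha <= A; continuations that
   leave this parameter range and re-enter it are not included. *)

definition hopf_branch :: "real \<Rightarrow> orbit set" where
  "hopf_branch A =
     connected_component_set
       (insert hopf_point {p \<in> sops_set. pi / 2 < fst p \<and> fst p \<le> A}) hopf_point - {hopf_point}"

(* A slowly oscillating periodic solution is not a bifurcation point if near it the set of all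
   slowly oscillating periodic solutions is a single curve that is a continuous graph over alpha.
   This excludes folds as well as branching. *)

definition bifurcation_point :: "orbit \<Rightarrow> bool" where
  "bifurcation_point p \<longleftrightarrow> p \<in> sops_set \<and>
     \<not> (\<exists>N \<delta> g. open N \<and> p \<in> N \<and> \<delta> > 0 \<and>
          continuous_on {fst p - \<delta> <..< fst p + \<delta>} g \<and>
          sops_set \<inter> N = (\<lambda>\<alpha>. (\<alpha>, g \<alpha>)) ` {fst p - \<delta> <..< fst p + \<delta>})"

end

theory Submission imports Defs begin

text \<open>
  For the sign of \<open>d\<alpha>/d\<epsilon>\<close>, divide \<open>F\<^sub>\<epsilon> = 0\<close> by \<open>\<alpha>\<close> and differentiate in \<open>\<epsilon>\<close>. With \<open>\<rho> = \<omega> / \<alpha>\<close>,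
  the modes \<open>k \<ge> 2\<close> bound \<open>\<epsilon> \<parallel>c'\<parallel>\<close> linearly in \<open>\<bar>\<rho>'\<bar> + \<bar>\<omega>'\<bar>\<close> and \<open>\<epsilon>\<close>, because
  \<open>\<bar>i k \<rho> + e\<^bsup>-ik\<omega>\<^esup>\<bar>\<close> is bounded below; mode one, whose coefficients are close to \<open>i\<close> and \<open>-1\<close> as
  \<open>\<omega> \<approx> \<pi>/2\<close>, then determines \<open>\<rho>'\<close> and \<open>\<omega>'\<close> up to a small multiple of \<open>\<epsilon>\<close>, and \<open>\<alpha>'\<close> comes out positive.

  For the absence of bifurcations, consider the slowly oscillating solutions produced by the zeros
  with \<open>0 < \<epsilon> < 0.1\<close>. They are relatively open among all slowly oscillating solutions: a nearby
  solution has nearby Fourier coefficients, with summable decay supplied by the equation itself, so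
  after normalization it lies in the neighbourhood where the zero is unique. Near the Hopf point the
  same holds because small solutions obey the asymptotics of \<open>(\<alpha>, \<omega>, c)\<close> to order \<open>\<epsilon>\<^sup>2\<close> there.
  They are also relatively closed for \<open>\<pi>/2 < \<alpha> \<le> \<pi>/2 + 0.00683\<close>, since this bound is below the value of
  \<open>\<alpha>\<close> at \<open>\<epsilon> = 0.1\<close>. By connectedness they contain the whole Hopf branch, and strict monotonicity
  of \<open>\<alpha>\<close> makes them a graph over \<open>\<alpha>\<close>.
\<close>

text \<open>Two normalizations of the time translation meet. A zero of \<open>F_map\<close> has a
  positive first Fourier coefficient \<epsilon>; a slowly oscillating solution has its upward zero
  at 0. Hence \<open>curve\<close> admits any translate of a branch profile, and
  \<open>sign_pattern_shift_unique\<close> shows that at most one translate qualifies. That a zero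
  yields a slowly oscillating solution is demanded in \<open>curve\<close> and passed on to
  neighbours by \<open>sops_persist\<close>, which is all that a local graph requires. Dividing by
  \<alpha> turns mode one into i \<rho>' - \<omega>' plus small terms, so that real and imaginary
  part separate the two unknowns, and \<omega> \<alpha>' = \<alpha> (\<omega>' - \<alpha> \<rho>')
  returns to \<alpha>. The quadratic term is differentiated only through difference quotients: its
  Lipschitz bound controls the sum over all modes at once. Positivity of \<alpha>' has a margin of
  about \<epsilon> / 10 in these estimates, so c'_2 has to be located near (2 - i) / 5 and not
  merely bounded.\<close>

lemma has_sum_int_split:
  fixes f :: "int \<Rightarrow> 'a :: {topological_comm_monoid_add, t3_space}"
  assumes "((\<lambda>n. f (int n)) has_sum P) UNIV" "((\<lambda>n. f (- int n - 1)) has_sum N) UNIV"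
  shows "(f has_sum P + N) UNIV"
proof -
  have "(f has_sum P) {0..}"
    using assms(1) by (subst has_sum_reindex_bij_witness[where i = int and j = nat and T = UNIV
      and h = "\<lambda>n. f (int n)" and s' = P]) auto
  moreover have "(f has_sum N) {..<0}"
    using assms(2) by (subst has_sum_reindex_bij_witness[where i = "\<lambda>n. - int n - 1"
      and j = "\<lambda>i. nat (- i - 1)" and T = UNIV and h = "\<lambda>n. f (- int n - 1)" and s' = N]) auto
  moreover have "{0..} \<union> {..<0} = (UNIV :: int set)" by auto
  ultimately show ?thesis
    by (metis has_sum_Un_disjoint disjoint_iff atLeast_iff lessThan_iff not_less)
qed

section \<open>Bi-infinite extensions and the space l1\<close>

lemma bi_ext_0 [simp]: "bi_ext a 0 = 0"
  by (simp add: bi_ext_def)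

lemma bi_ext_int [simp]: "a 0 = 0 \<Longrightarrow> bi_ext a (int n) = a n"
  by (simp add: bi_ext_def)

lemma bi_ext_uminus: "bi_ext a (- k) = cnj (bi_ext a k)"
  by (simp add: bi_ext_def)

lemma bi_ext_neg: "bi_ext a (- int n - 1) = cnj (a (Suc n))"
proof -
  have "nat (int n + 1) = Suc n" by simp
  then show ?thesis by (simp add: bi_ext_def add.commute)
qed

lemma l1_summable: "a \<in> l1 \<Longrightarrow> summable (\<lambda>k. cmod (a k))"
  by (auto simp: l1_def)

lemma l1_summable_norm_ignore: "a \<in> l1 \<Longrightarrow> summable (\<lambda>n. cmod (a (Suc n)))"
  using summable_Suc_iff[of "\<lambda>k. cmod (a k)"] by (simp add: l1_def)

lemma l1_suminf_Suc: "a \<in> l1 \<Longrightarrow> (\<Sum>n. cmod (a (Suc n))) = (\<Sum>n. cmod (a n))"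
  using suminf_split_head[of "\<lambda>k. cmod (a k)"] by (simp add: l1_def)

text \<open>The factor 2 in \<open>l1_norm\<close> counts k and -k, so it is the full norm over the
  integers; convolution is then submultiplicative without a constant.\<close>

lemma bi_ext_norm_has_sum:
  assumes "a \<in> l1"
  shows "((\<lambda>j. cmod (bi_ext a j)) has_sum l1_norm a) UNIV"
proof -
  have "((\<lambda>n. cmod (a n)) has_sum (\<Sum>n. cmod (a n))) UNIV"
    by (rule norm_summable_imp_has_sum) (use assms in \<open>auto simp: l1_def summable_sums\<close>)
  moreover have "((\<lambda>n. cmod (a (Suc n))) has_sum (\<Sum>n. cmod (a (Suc n)))) UNIV"
    by (rule norm_summable_imp_has_sum)
       (use l1_summable_norm_ignore[OF assms] in \<open>auto simp: summable_sums\<close>)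
  ultimately have "((\<lambda>j. cmod (bi_ext a j)) has_sum ((\<Sum>n. cmod (a n)) + (\<Sum>n. cmod (a (Suc n))))) UNIV"
    by (intro has_sum_int_split) (use assms in \<open>auto simp: bi_ext_neg l1_def\<close>)
  then show ?thesis using l1_suminf_Suc[OF assms] by (simp add: l1_norm_def)
qed

lemma bi_ext_summable: "a \<in> l1 \<Longrightarrow> (\<lambda>j. cmod (bi_ext a j)) summable_on UNIV"
  using bi_ext_norm_has_sum summable_on_def by blast

section \<open>Convolutions and trigonometric sums\<close>

text \<open>The real function with Fourier coefficient a_k at k and cnj a_k at -k; for
  \<open>a \<in> l1\<close> its mean is 0 because a 0 = 0.\<close>

definition tsum :: "cseq \<Rightarrow> real \<Rightarrow> real" where
  "tsum a x = (\<Sum>k. 2 * Re (a k * cis (of_nat k * x)))"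

text \<open>Rewriting the real series as an absolutely convergent sum over the integers is what
  allows series to be multiplied.\<close>

lemma tsum_has_sum:
  assumes "a \<in> l1"
  shows "((\<lambda>j. bi_ext a j * cis (of_int j * x)) has_sum of_real (tsum a x)) UNIV"
proof -
  let ?t = "\<lambda>n. a n * cis (of_nat n * x)"
  have s: "summable (\<lambda>n. cmod (?t n))" using assms by (simp add: norm_mult l1_def)
  then have s1: "summable (\<lambda>n. cmod (?t (Suc n)))"
    using summable_Suc_iff[of "\<lambda>n. cmod (?t n)"] by simp
  have t0: "?t 0 = 0" using assms by (simp add: l1_def)
  have "((\<lambda>n. bi_ext a (int n) * cis (of_int (int n) * x)) has_sum (\<Sum>n. ?t n)) UNIV"
    using norm_summable_imp_has_sum[OF s summable_sums[OF summable_norm_cancel[OF s]]] assms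
    by (simp add: l1_def)
  moreover have eq: "cnj (?t (Suc n)) = bi_ext a (- int n - 1) * cis (of_int (- int n - 1) * x)" for n
  proof -
    have "cnj (cis (of_nat (Suc n) * x)) = cis (of_int (- int n - 1) * x)"
      by (auto simp: cis_cnj ring_distribs intro!: arg_cong[of _ _ cis])
    then show ?thesis by (simp add: bi_ext_neg del: of_nat_Suc)
  qed
  have sm: "summable ?t" using s by (rule summable_norm_cancel)
  have "(\<lambda>n. cnj (?t (Suc n))) sums cnj (\<Sum>n. ?t n)"
    using sums_Suc_iff[of ?t "\<Sum>n. ?t n"] summable_sums[OF sm] t0 by (intro iffD2[OF sums_cnj]) simp
  then have "((\<lambda>n. cnj (?t (Suc n))) has_sum cnj (\<Sum>n. ?t n)) UNIV"
    by (intro norm_summable_imp_has_sum) (use s1 in \<open>auto simp: norm_mult\<close>)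
  then have "((\<lambda>n. bi_ext a (- int n - 1) * cis (of_int (- int n - 1) * x)) has_sum cnj (\<Sum>n. ?t n)) UNIV"
    unfolding eq .
  ultimately have "((\<lambda>j. bi_ext a j * cis (of_int j * x)) has_sum ((\<Sum>n. ?t n) + cnj (\<Sum>n. ?t n))) UNIV"
    by (rule has_sum_int_split)
  moreover have "(\<Sum>n. ?t n) + cnj (\<Sum>n. ?t n) = of_real (tsum a x)"
    unfolding tsum_def complex_add_cnj Re_suminf[OF sm] 
    using summable_Re[OF sm] by (subst suminf_mult[symmetric]) simp_all
  ultimately show ?thesis by simp
qed

text \<open>Convolution over the integers including index 0, which \<open>conv\<close> discards;
  that entry is the constant mode of a product of series.\<close>

definition iconv :: "(int \<Rightarrow> complex) \<Rightarrow> (int \<Rightarrow> complex) \<Rightarrow> int \<Rightarrow> complex" where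
  "iconv A B k = (\<Sum>\<^sub>\<infinity>j. A j * B (k - j))"

lemma conv_iconv: "0 < k \<Longrightarrow> conv a b k = iconv (bi_ext a) (bi_ext b) (int k)"
  by (simp add: conv_def iconv_def)

lemma norm_product_summable:
  fixes A B :: "int \<Rightarrow> complex"
  assumes "(\<lambda>j. cmod (A j)) summable_on UNIV" "(\<lambda>j. cmod (B j)) summable_on UNIV"
  shows "(\<lambda>(k, j). cmod (A j * B (k - j))) summable_on UNIV \<times> UNIV"
proof -
  have "(\<lambda>(j, m). cmod (A j) * cmod (B m)) summable_on UNIV \<times> UNIV"
    using assms by (intro summable_on_SigmaI[where g = "\<lambda>j. cmod (A j) * infsum (\<lambda>m. cmod (B m)) UNIV"])
      (auto intro!: has_sum_cmult_right summable_on_cmult_left)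
  then show ?thesis
    by (subst summable_on_reindex_bij_witness[where j = "\<lambda>(k, j). (j, k - j)" and i = "\<lambda>(j, m). (j + m, j)"
       and h = "\<lambda>(j, m). cmod (A j) * cmod (B m)" and T = "UNIV \<times> UNIV"]) (auto simp: norm_mult)
qed

text \<open>The shear (k, j) \<mapsto> (j, k - j) is a bijection of the pairs of integers, so the
  absolutely convergent double series of the product may be summed along the diagonals.\<close>

lemma product_has_sum:
  fixes A B :: "int \<Rightarrow> complex"
  assumes "(\<lambda>j. cmod (A j)) summable_on UNIV" "(\<lambda>j. cmod (B j)) summable_on UNIV"
    and "(A has_sum SA) UNIV" "(B has_sum SB) UNIV"
  shows "((\<lambda>(k, j). A j * B (k - j)) has_sum SA * SB) (UNIV \<times> UNIV)"
proof -
  have sm: "(\<lambda>(j, m). A j * B m) summable_on UNIV \<times> UNIV"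
  proof -
    have "(\<lambda>(j, m). cmod (A j * B m)) summable_on UNIV \<times> UNIV"
      using assms(1,2) unfolding norm_mult
      by (intro summable_on_SigmaI[where g = "\<lambda>j. cmod (A j) * infsum (\<lambda>m. cmod (B m)) UNIV"])
         (auto intro!: has_sum_cmult_right summable_on_cmult_left)
    then show ?thesis
      by - (rule abs_summable_summable, simp add: case_prod_unfold)
  qed
  have "((\<lambda>(j, m). A j * B m) has_sum SA * SB) (UNIV \<times> UNIV)"
    by (rule has_sum_SigmaI[where g = "\<lambda>j. A j * SB"])
       (use assms sm in \<open>auto intro!: has_sum_cmult_right has_sum_cmult_left\<close>)
  then show ?thesis
    by (subst has_sum_reindex_bij_witness[where j = "\<lambda>(k, j). (j, k - j)" and i = "\<lambda>(j, m). (j + m, j)"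
       and h = "\<lambda>(j, m). A j * B m" and T = "UNIV \<times> UNIV" and s' = "SA * SB"]) auto
qed

lemma iconv_summable:
  fixes A B :: "int \<Rightarrow> complex"
  assumes "(\<lambda>j. cmod (A j)) summable_on UNIV" "(\<lambda>j. cmod (B j)) summable_on UNIV"
  shows "(\<lambda>j. cmod (A j * B (k - j))) summable_on UNIV"
  using summable_on_SigmaD1[OF norm_product_summable[OF assms]] by simp

lemma iconv_has_sum_term:
  fixes A B :: "int \<Rightarrow> complex"
  assumes "(\<lambda>j. cmod (A j)) summable_on UNIV" "(\<lambda>j. cmod (B j)) summable_on UNIV"
  shows "((\<lambda>j. A j * B (k - j)) has_sum iconv A B k) UNIV"
  unfolding iconv_def by (rule has_sum_infsum, rule abs_summable_summable) (rule iconv_summable[OF assms])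

lemma iconv_has_sum:
  fixes A B :: "int \<Rightarrow> complex"
  assumes "(\<lambda>j. cmod (A j)) summable_on UNIV" "(\<lambda>j. cmod (B j)) summable_on UNIV"
    and "(A has_sum SA) UNIV" "(B has_sum SB) UNIV"
  shows "(iconv A B has_sum SA * SB) UNIV"
  using has_sum_SigmaD[OF product_has_sum[OF assms], of "iconv A B"] iconv_has_sum_term[OF assms(1,2)]
  by simp

text \<open>Young's inequality by comparison: the convolution of the moduli dominates, and
  \<open>iconv_has_sum\<close> evaluates its total exactly as SA * SB.\<close>

lemma iconv_norm:
  fixes A B :: "int \<Rightarrow> complex"
  assumes "((\<lambda>j. cmod (A j)) has_sum SA) UNIV" "((\<lambda>j. cmod (B j)) has_sum SB) UNIV"
  shows "(\<lambda>k. cmod (iconv A B k)) summable_on UNIV" 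
    and "finite F \<Longrightarrow> (\<Sum>k\<in>F. cmod (iconv A B k)) \<le> SA * SB"
proof -
  have sA: "(\<lambda>j. cmod (A j)) summable_on UNIV" and sB: "(\<lambda>j. cmod (B j)) summable_on UNIV"
    using assms by (auto simp: summable_on_def)
  let ?A = "\<lambda>j. complex_of_real (cmod (A j))" and ?B = "\<lambda>j. complex_of_real (cmod (B j))"
  have "(iconv ?A ?B has_sum complex_of_real SA * complex_of_real SB) UNIV"
    by (rule iconv_has_sum) (use sA sB assms in \<open>auto intro: has_sum_of_real\<close>)
  then have re: "((\<lambda>k. Re (iconv ?A ?B k)) has_sum SA * SB) UNIV"
    using has_sum_Re by fastforce
  have le: "cmod (iconv A B k) \<le> Re (iconv ?A ?B k)" for k
  proof -
    have "((\<lambda>j. ?A j * ?B (k - j)) has_sum iconv ?A ?B k) UNIV"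
      by (rule iconv_has_sum_term) (use sA sB in auto)
    then have *: "((\<lambda>j. cmod (A j * B (k - j))) has_sum Re (iconv ?A ?B k)) UNIV"
      using has_sum_Re by (fastforce simp: norm_mult)
    show ?thesis
      by (rule norm_has_sum_bound[OF * iconv_has_sum_term[OF sA sB]])
  qed
  show "(\<lambda>k. cmod (iconv A B k)) summable_on UNIV"
    by (rule summable_on_comparison_test[of "\<lambda>k. Re (iconv ?A ?B k)"]) 
       (use re le in \<open>auto simp: summable_on_def\<close>)
  assume F: "finite F"
  have "(\<Sum>k\<in>F. cmod (iconv A B k)) \<le> (\<Sum>k\<in>F. Re (iconv ?A ?B k))"
    by (intro sum_mono le)
  also have "\<dots> \<le> SA * SB"
    by (rule has_sum_mono2[OF has_sum_finite[OF F] re]) (use le norm_ge_zero order_trans in blast)+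
  finally show "(\<Sum>k\<in>F. cmod (iconv A B k)) \<le> SA * SB" .
qed

lemma iconv_uminus:
  fixes A B :: "int \<Rightarrow> complex"
  assumes "\<And>j. A (- j) = cnj (A j)" "\<And>j. B (- j) = cnj (B j)"
  shows "iconv A B (- k) = cnj (iconv A B k)"
proof -
  have "iconv A B (- k) = (\<Sum>\<^sub>\<infinity>j. A (- j) * B (- k + j))"
    unfolding iconv_def
    by (rule infsum_reindex_bij_witness[where i = uminus and j = uminus]) auto
  also have "\<dots> = (\<Sum>\<^sub>\<infinity>j. cnj (A j * B (k - j)))"
    using assms(2)[of "k - _"] by (intro infsum_cong) (simp add: assms(1) algebra_simps)
  finally show ?thesis by (simp add: iconv_def flip: infsum_cnj)
qed

text \<open>Conjugation symmetry makes the indices 1..n and -n..-1 contribute equally to the bound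
  over the integers, whence the factor 1/2.\<close>

lemma conv_norm:
  assumes "a \<in> l1" "b \<in> l1"
  shows "(\<Sum>k=1..n. cmod (conv a b k)) \<le> l1_norm a * l1_norm b / 2"
proof -
  let ?c = "iconv (bi_ext a) (bi_ext b)"
  have "(\<Sum>k\<in>int ` {1..n} \<union> (\<lambda>m. - int m) ` {1..n}. cmod (?c k)) \<le> l1_norm a * l1_norm b"
    by (rule iconv_norm) (use assms in \<open>auto intro: bi_ext_norm_has_sum\<close>)
  also have "(\<Sum>k\<in>int ` {1..n} \<union> (\<lambda>m. - int m) ` {1..n}. cmod (?c k))
    = (\<Sum>k\<in>int ` {1..n}. cmod (?c k)) + (\<Sum>k\<in>(\<lambda>m. - int m) ` {1..n}. cmod (?c k))"
    by (rule sum.union_disjoint) auto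
  also have "(\<Sum>k\<in>(\<lambda>m. - int m) ` {1..n}. cmod (?c k)) = (\<Sum>k\<in>{1..n}. cmod (?c (int k)))"
    by (subst sum.reindex) (auto simp: inj_on_def iconv_uminus bi_ext_uminus)
  also have "(\<Sum>k\<in>int ` {1..n}. cmod (?c k)) = (\<Sum>k\<in>{1..n}. cmod (?c (int k)))"
    by (subst sum.reindex) (auto simp: inj_on_def)
  also have "(\<Sum>k\<in>{1..n}. cmod (?c (int k))) = (\<Sum>k=1..n. cmod (conv a b k))"
    by (intro sum.cong) (auto simp: conv_iconv)
  finally show ?thesis by simp
qed

lemma conv_summable:
  assumes "a \<in> l1" "b \<in> l1"
  shows "conv a b \<in> l1"
proof -
  have "summable (\<lambda>k. cmod (conv a b (Suc k)))"
  proof (rule summableI_nonneg_bounded)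
    fix n show "(\<Sum>i<n. cmod (conv a b (Suc i))) \<le> l1_norm a * l1_norm b / 2"
      using conv_norm[OF assms, of n] by (simp add: sum.atLeast1_atMost_eq)
  qed auto
  then show ?thesis using summable_Suc_iff[of "\<lambda>k. cmod (conv a b k)"]
    by (simp add: l1_def) (simp add: conv_def)
qed

section \<open>Bilinearity and Lipschitz dependence of the convolution\<close>

lemma bi_ext_add: "bi_ext (\<lambda>k. a k + b k) j = bi_ext a j + bi_ext b j"
  by (simp add: bi_ext_def)

lemma bi_ext_cmult: "bi_ext (\<lambda>k. of_real r * a k) j = of_real r * bi_ext a j"
  by (simp add: bi_ext_def)

lemma l1_add: "a \<in> l1 \<Longrightarrow> b \<in> l1 \<Longrightarrow> (\<lambda>k. a k + b k) \<in> l1"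
  unfolding l1_def
  by (auto intro!: summable_comparison_test'[where g = "\<lambda>k. cmod (a k) + cmod (b k)"] summable_add
    simp: norm_triangle_ineq)

lemma l1_cmult: "a \<in> l1 \<Longrightarrow> (\<lambda>k. r * a k) \<in> l1"
  unfolding l1_def by (auto simp: norm_mult)

lemma l1_diff: "a \<in> l1 \<Longrightarrow> b \<in> l1 \<Longrightarrow> (\<lambda>k. a k - b k) \<in> l1"
  using l1_add[of a "\<lambda>k. -1 * b k"] l1_cmult[of b "-1"] by simp

lemma conv_add_left:
  assumes "a \<in> l1" "b \<in> l1" "c \<in> l1"
  shows "conv (\<lambda>k. a k + b k) c k = conv a c k + conv b c k"
proof (cases "k = 0")
  case False
  have "((\<lambda>j. bi_ext a j * bi_ext c (int k - j) + bi_ext b j * bi_ext c (int k - j)) has_sum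
     conv a c k + conv b c k) UNIV"
    using False assms by (auto intro!: has_sum_add iconv_has_sum_term bi_ext_summable simp: conv_iconv)
  then show ?thesis
    using False by (simp add: conv_def[of _ c] bi_ext_add ring_distribs infsumI)
qed (simp add: conv_def)

lemma conv_commute: "conv a b k = conv b a k"
proof (cases "k = 0")
  case False
  then show ?thesis unfolding conv_def
    by (simp, intro infsum_reindex_bij_witness[where i = "\<lambda>j. int k - j" and j = "\<lambda>j. int k - j"]) auto
qed (simp add: conv_def)

lemma conv_add_right:
  assumes "a \<in> l1" "b \<in> l1" "c \<in> l1"
  shows "conv c (\<lambda>k. a k + b k) k = conv c a k + conv c b k"
  by (simp add: conv_commute[of c] conv_add_left assms)

lemma conv_cmult_left: "conv (\<lambda>k. of_real r * a k) b k = of_real r * conv a b k"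
  by (simp add: conv_def bi_ext_cmult mult.assoc infsum_cmult_right')

lemma conv_cmult_right: "conv a (\<lambda>k. of_real r * b k) k = of_real r * conv a b k"
  by (simp add: conv_commute[of a] conv_cmult_left)

lemma conv_diff_left:
  assumes "a \<in> l1" "b \<in> l1" "c \<in> l1"
  shows "conv (\<lambda>k. a k - b k) c k = conv a c k - conv b c k"
  using conv_add_left[OF assms(1) l1_cmult[OF assms(2), of "of_real (-1)"] assms(3), of k]
  by (simp only: conv_cmult_left) simp

lemma conv_diff_right:
  assumes "a \<in> l1" "b \<in> l1" "c \<in> l1"
  shows "conv c (\<lambda>k. a k - b k) k = conv c a k - conv c b k"
  by (simp add: conv_commute[of c] conv_diff_left assms)

lemma U_op_cis: "U_op \<omega> a k = cis (- of_nat k * \<omega>) * a k"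
  by (simp add: U_op_def cis_conv_exp mult.commute mult.left_commute)

lemma cmod_U_op [simp]: "cmod (U_op \<omega> a k) = cmod (a k)"
  by (simp add: U_op_cis norm_mult)

lemma U_op_l1 [simp]: "U_op \<omega> a \<in> l1 \<longleftrightarrow> a \<in> l1"
  by (simp add: l1_def U_op_cis[of _ _ 0] norm_mult)

lemma l1_norm_U_op [simp]: "l1_norm (U_op \<omega> a) = l1_norm a"
  by (simp add: l1_norm_def)

lemma K_inv_l1: "a 0 = 0 \<Longrightarrow> K_inv a \<in> l1 \<Longrightarrow> a \<in> l1"
proof -
  assume a: "a 0 = 0" and K: "K_inv a \<in> l1"
  have "cmod (a k) \<le> cmod (K_inv a k)" for k
    using a mult_right_mono[of 1 "real k" "cmod (a k)"]
    by (cases k) (auto simp: K_inv_def norm_mult simp del: of_nat_Suc)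
  then show "a \<in> l1" using a K unfolding l1_def
    by (auto intro: summable_comparison_test')
qed

lemma l1_norm_nonneg: "a \<in> l1 \<Longrightarrow> 0 \<le> l1_norm a"
  by (simp add: l1_norm_def suminf_nonneg l1_def)

lemma l1_norm_triangle:
  assumes "a \<in> l1" "b \<in> l1"
  shows "l1_norm (\<lambda>k. a k + b k) \<le> l1_norm a + l1_norm b"
proof -
  have "(\<Sum>k. cmod (a k + b k)) \<le> (\<Sum>k. cmod (a k) + cmod (b k))"
    using assms l1_add[OF assms] by (intro suminf_le norm_triangle_ineq) (auto simp: l1_def intro: summable_add)
  then show ?thesis using assms by (simp add: l1_norm_def l1_def suminf_add[symmetric])
qed

lemma l1_norm_cmult: "a \<in> l1 \<Longrightarrow> l1_norm (\<lambda>k. r * a k) = cmod r * l1_norm a"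
  by (simp add: l1_norm_def norm_mult suminf_mult l1_def)

lemma l1_norm_diff_swap: "l1_norm (\<lambda>k. a k - b k) = l1_norm (\<lambda>k. b k - a k)"
  by (simp add: l1_norm_def norm_minus_commute)

lemma l1_norm_le:
  assumes "\<And>k. cmod (a k) \<le> M * cmod (b k)" "a 0 = 0" "b \<in> l1"
  shows "a \<in> l1" "l1_norm a \<le> M * l1_norm b"
proof -
  have s: "summable (\<lambda>k. M * cmod (b k))" using assms(3) by (auto simp: l1_def)
  have "summable (\<lambda>k. cmod (a k))"
    by (rule summable_comparison_test'[OF s]) (use assms(1) in auto)
  then show a: "a \<in> l1" using assms(2) by (simp add: l1_def)
  have "(\<Sum>k. cmod (a k)) \<le> (\<Sum>k. M * cmod (b k))"
    using a s assms(1) by (intro suminf_le) (auto simp: l1_def)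
  then show "l1_norm a \<le> M * l1_norm b"
    using assms(3) by (simp add: l1_norm_def l1_def suminf_mult)
qed

lemma cis_lipschitz: "cmod (cis x - cis y) \<le> \<bar>x - y\<bar>"
proof -
  have "cis x - cis y = cis y * (cis (x - y) - 1)"
    by (simp add: right_diff_distrib cis_mult)
  also have "cmod \<dots> = cmod (cis (x - y) - 1)" by (simp add: norm_mult)
  also have "\<dots> \<le> \<bar>x - y\<bar>"
  proof -
    have "(cmod (cis (x - y) - 1))\<^sup>2 = 2 - 2 * cos (x - y)"
      using sin_cos_squared_add[of "x - y"] by (simp add: cmod_power2 power2_diff)
    also have "\<dots> = (2 * sin ((x - y) / 2))\<^sup>2"
      using cos_double_sin[of "(x-y)/2"] by (simp only: power_mult_distrib field_sum_of_halves mult_2) (simp flip: mult_2)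
    finally have "(cmod (cis (x - y) - 1))\<^sup>2 = (2 * sin ((x - y) / 2))\<^sup>2" .
    then have "cmod (cis (x - y) - 1) = \<bar>2 * sin ((x - y) / 2)\<bar>"
      by (metis power2_eq_iff_nonneg norm_ge_zero abs_ge_zero power2_abs)
    also have "\<dots> \<le> \<bar>x - y\<bar>" using abs_sin_x_le_abs_x[of "(x - y) / 2"] by simp
    finally show ?thesis .
  qed
  finally show ?thesis .
qed

text \<open>Telescoping into the convolutions of (U_\<omega> - U_\<omega>') a with a, of U_\<omega>'
  (a - b) with a, and of U_\<omega>' b with a - b. Changing the delay costs one derivative, and this
  splitting charges it to \<open>a\<close> alone; \<open>b\<close> enters only through unweighted
  norms.\<close>

lemma conv_lipschitz:
  assumes "a 0 = 0" "K_inv a \<in> l1" "b \<in> l1"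
  shows "(\<Sum>k=1..n. cmod (conv (U_op \<omega> a) a k - conv (U_op \<omega>' b) b k))
    \<le> (\<bar>\<omega> - \<omega>'\<bar> * l1_norm (K_inv a) * l1_norm a
       + l1_norm (\<lambda>k. a k - b k) * (l1_norm a + l1_norm b)) / 2"
proof -
  have a: "a \<in> l1" using assms K_inv_l1 by blast
  let ?V = "\<lambda>k. U_op \<omega> a k - U_op \<omega>' a k" and ?d = "\<lambda>k. a k - b k"
  have d: "?d \<in> l1" using l1_diff a assms by blast
  have "cmod (?V k) \<le> \<bar>\<omega> - \<omega>'\<bar> * cmod (K_inv a k)" for k
  proof -
    have "cmod (?V k) \<le> \<bar>- of_nat k * \<omega> - - of_nat k * \<omega>'\<bar> * cmod (a k)"
      unfolding U_op_cis left_diff_distrib[symmetric] norm_mult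
      by (intro mult_right_mono cis_lipschitz) auto
    also have "- of_nat k * \<omega> - - of_nat k * \<omega>' = - (of_nat k * (\<omega> - \<omega>'))"
      by (simp add: algebra_simps)
    finally show ?thesis by (simp add: K_inv_def norm_mult abs_mult mult_ac)
  qed
  note V = l1_norm_le[OF this _ assms(2)]
  have V0: "?V 0 = 0" by (simp add: U_op_def assms(1))
  have eq: "conv (U_op \<omega> a) a k - conv (U_op \<omega>' b) b k
    = conv ?V a k + conv (U_op \<omega>' ?d) a k + conv (U_op \<omega>' b) ?d k" for k
  proof -
    have "U_op \<omega>' ?d = (\<lambda>k. U_op \<omega>' a k - U_op \<omega>' b k)"
      by (simp add: U_op_def fun_eq_iff right_diff_distrib)
    then show ?thesis using a assms(3) by (simp add: conv_diff_left conv_diff_right)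
  qed
  have "(\<Sum>k=1..n. cmod (conv (U_op \<omega> a) a k - conv (U_op \<omega>' b) b k))
    \<le> (\<Sum>k=1..n. cmod (conv ?V a k) + cmod (conv (U_op \<omega>' ?d) a k) + cmod (conv (U_op \<omega>' b) ?d k))"
    unfolding eq by (intro sum_mono order_trans[OF norm_triangle_ineq] add_mono norm_triangle_ineq) auto
  also have "\<dots> = (\<Sum>k=1..n. cmod (conv ?V a k)) + (\<Sum>k=1..n. cmod (conv (U_op \<omega>' ?d) a k))
      + (\<Sum>k=1..n. cmod (conv (U_op \<omega>' b) ?d k))"
    by (simp add: sum.distrib)
  also have "\<dots> \<le> l1_norm ?V * l1_norm a / 2 + l1_norm ?d * l1_norm a / 2 + l1_norm b * l1_norm ?d / 2"
    using conv_norm[OF V(1)[OF V0] a, of n] conv_norm[of "U_op \<omega>' ?d" a n] 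
       conv_norm[of "U_op \<omega>' b" ?d n] a d assms(3) by simp
  also have "l1_norm ?V * l1_norm a \<le> \<bar>\<omega> - \<omega>'\<bar> * l1_norm (K_inv a) * l1_norm a"
    using V(2)[OF V0] l1_norm_nonneg[OF a] by (intro mult_right_mono) auto
  finally show ?thesis by (simp add: field_simps)
qed

section \<open>Fourier coefficients\<close>

definition fc :: "(real \<Rightarrow> complex) \<Rightarrow> int \<Rightarrow> complex" where
  "fc f k = integral {0..1} (\<lambda>s. f s * cis (- (2 * pi * of_int k * s)))"

abbreviation rfc :: "(real \<Rightarrow> real) \<Rightarrow> int \<Rightarrow> complex" where
  "rfc f \<equiv> fc (\<lambda>s. of_real (f s))"

lemma continuous_on_cis_lin [continuous_intros]:
  "continuous_on S g \<Longrightarrow> continuous_on S (\<lambda>s. cis (g s))"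
  by (rule continuous_on_cis)

lemma fc_integrable:
  "continuous_on {0..1} f \<Longrightarrow> (\<lambda>s. f s * cis (- (2 * pi * of_int k * s))) integrable_on {0..1}"
  by (intro integrable_continuous_interval continuous_intros)

lemma fc_add:
  assumes "continuous_on {0..1} f" "continuous_on {0..1} g"
  shows "fc (\<lambda>s. f s + g s) k = fc f k + fc g k"
  unfolding fc_def ring_distribs by (intro integral_add fc_integrable assms)

lemma fc_diff:
  assumes "continuous_on {0..1} f" "continuous_on {0..1} g"
  shows "fc (\<lambda>s. f s - g s) k = fc f k - fc g k"
  unfolding fc_def ring_distribs by (intro integral_diff fc_integrable assms)

lemma fc_cmult: "fc (\<lambda>s. c * f s) k = c * fc f k"
  by (simp add: fc_def mult.assoc)

lemma fc_shift: "fc (\<lambda>s. f s * cis (2 * pi * of_int m * s)) k = fc f (k - m)"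
proof -
  have "cis (2 * pi * of_int m * s) * cis (- (2 * pi * of_int k * s)) = cis (- (2 * pi * of_int (k - m) * s))" for s
    by (simp add: cis_mult algebra_simps)
  then show ?thesis by (simp add: fc_def mult.assoc)
qed

lemma fc_uminus: "rfc f (- k) = cnj (rfc f k)"
proof -
  have "cnj (rfc f k) = integral {0..1} (\<lambda>s. cnj (of_real (f s) * cis (- (2 * pi * of_int k * s))))"
    unfolding fc_def by (rule integral_cnj)
  also have "\<dots> = rfc f (- k)" unfolding fc_def by (intro integral_cong) (simp add: cis_cnj)
  finally show ?thesis ..
qed

lemma fc_bound:
  assumes "continuous_on {0..1} f" "\<And>s. s \<in> {0..1} \<Longrightarrow> cmod (f s) \<le> M"
  shows "cmod (fc f k) \<le> M"
proof -
  have "continuous_on {0..1} (\<lambda>s. f s * cis (- (2 * pi * of_int k * s)))"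
    by (intro continuous_intros assms)
  from integral_bound[OF _ this, of M] show ?thesis
    unfolding fc_def using assms(2) by (simp add: norm_mult)
qed

lemma cis_has_vector_derivative:
  "((\<lambda>s. cis (c * s)) has_vector_derivative \<i> * of_real c * cis (c * s)) (at s within S)"
proof -
  have "((\<lambda>z. exp (\<i> * of_real c * z)) has_field_derivative \<i> * of_real c * exp (\<i> * of_real c * of_real s))
     (at (of_real s))"
    by (auto intro!: derivative_eq_intros)
  from has_vector_derivative_real_field[OF this, of S] show ?thesis
    by (simp add: cis_conv_exp mult.assoc)
qed

lemma fc_deriv:
  assumes "\<And>s. (f has_vector_derivative f' s) (at s)" "continuous_on {0..1} f'" "f 1 = f 0"
  shows "fc f' k = 2 * pi * \<i> * of_int k * fc f k"
proof -
  let ?c = "- (2 * pi * of_int k) :: real"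
  have cf: "continuous_on {0..1} f"
    using assms(1) by (meson continuous_at_imp_continuous_on has_vector_derivative_continuous)
  have "((\<lambda>s. f' s * cis (?c * s) + f s * (\<i> * of_real ?c * cis (?c * s))) has_integral
     (f 1 * cis (?c * 1) - f 0 * cis (?c * 0))) {0..1}"
  proof (rule fundamental_theorem_of_calculus)
    fix s :: real
    show "((\<lambda>s. f s * cis (?c * s)) has_vector_derivative
       f' s * cis (?c * s) + f s * (\<i> * of_real ?c * cis (?c * s))) (at s within {0..1})"
      using has_vector_derivative_mult[OF has_vector_derivative_at_within[OF assms(1)]
        cis_has_vector_derivative[of ?c s "{0..1}"]]
      by (simp add: add.commute)
  qed simp
  moreover have "cis (?c * 1) = 1"
    using cis_multiple_2pi[of "- of_int k"] by simp
  ultimately have "((\<lambda>s. f' s * cis (?c * s) + f s * (\<i> * of_real ?c * cis (?c * s))) has_integral 0) {0..1}"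
    using assms(3) by simp
  then have "integral {0..1} (\<lambda>s. f' s * cis (?c * s) + f s * (\<i> * of_real ?c * cis (?c * s))) = 0"
    by (rule integral_unique)
  also have "integral {0..1} (\<lambda>s. f' s * cis (?c * s) + f s * (\<i> * of_real ?c * cis (?c * s)))
     = fc f' k + fc (\<lambda>s. \<i> * of_real ?c * f s) k"
    using fc_add[OF assms(2), of "\<lambda>s. \<i> * of_real ?c * f s" k] cf
    by (simp add: fc_def continuous_intros mult_ac ring_distribs)
  finally show ?thesis unfolding fc_cmult by (simp add: mult_ac)
qed

section \<open>Uniqueness of Fourier coefficients\<close>

text \<open>Transports a loop on [0,1] to the unit circle, a compact set of the plane on which
  Stone-Weierstrass applies.\<close>

lemma continuous_on_circle:
  fixes f :: "real \<Rightarrow> real"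
  assumes "continuous_on {0..1} f" "f 1 = f 0"
  obtains F where "continuous_on (sphere 0 1) F" "\<And>s. s \<in> {0..1} \<Longrightarrow> F (cis (2 * pi * s)) = f s"
proof
  let ?F = "f \<circ> (\<lambda>z. Arg2pi z / (2 * pi))"
  have "homotopic_loops UNIV f f"
    using assms by (simp add: homotopic_loops_refl path_def pathfinish_def pathstart_def)
  from homotopic_loops_imp_homotopic_circlemaps[OF this] show "continuous_on (sphere 0 1) ?F"
    using homotopic_with_imp_continuous by blast
  fix s :: real assume s: "s \<in> {0..1}"
  show "?F (cis (2 * pi * s)) = f s"
  proof (cases "s = 1")
    case True
    then show ?thesis using assms(2) Arg2pi_unique[of 1 0 1] by simp
  next
    case False
    then have "Arg2pi (cis (2 * pi * s)) = 2 * pi * s"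
      using s by (intro Arg2pi_unique[of 1]) (auto simp: cis_conv_exp)
    then show ?thesis by simp
  qed
qed

text \<open>Induction over polynomials in the real coordinates. A real linear form on the complex
  plane is b z + cnj b cnj z, and on the circle multiplication by z or cnj z merely shifts the
  Fourier index by one. Continuity is carried along because additivity of \<open>fc\<close> requires
  it.\<close>

lemma zero_coeffs_mult_polynomial:
  assumes "real_polynomial_function g"
    and "continuous_on {0..1} f" "\<And>k. fc f k = 0"
  shows "continuous_on {0..1} (\<lambda>s. f s * of_real (g (cis (2 * pi * s))))
    \<and> (\<forall>k. fc (\<lambda>s. f s * of_real (g (cis (2 * pi * s)))) k = 0)"
  using assms
proof (induction arbitrary: f)
  case (linear g)
  interpret g: bounded_linear g by fact
  define b where "b = (of_real (g 1) - \<i> * of_real (g \<i>)) / 2"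
  have gz: "complex_of_real (g z) = b * z + cnj b * cnj z" for z
  proof -
    have "z = Re z *\<^sub>R 1 + Im z *\<^sub>R \<i>" by (simp add: complex_eq_iff)
    then have "g z = Re z * g 1 + Im z * g \<i>" by (metis g.add g.scaleR real_scaleR_def)
    then show ?thesis by (simp add: b_def complex_eq_iff field_simps)
  qed
  have e: "f s * of_real (g (cis (2 * pi * s)))
     = b * (f s * cis (2 * pi * of_int 1 * s)) + cnj b * (f s * cis (2 * pi * of_int (-1) * s))" for s
    unfolding gz by (simp add: cis_cnj ring_distribs)
  have c: "continuous_on {0..1} (\<lambda>s. d * (f s * cis (2 * pi * of_int m * s)))" for m d
    by (intro continuous_intros linear.prems)
  have "fc (\<lambda>s. b * (f s * cis (2 * pi * of_int 1 * s)) + cnj b * (f s * cis (2 * pi * of_int (-1) * s))) k = 0" for k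
    unfolding fc_add[OF c c] fc_cmult fc_shift by (simp add: linear.prems)
  moreover have "continuous_on {0..1} (\<lambda>s. b * (f s * cis (2 * pi * of_int 1 * s)) + cnj b * (f s * cis (2 * pi * of_int (-1) * s)))"
    by (intro continuous_on_add c)
  ultimately show ?case unfolding e by blast
next
  case (const c)
  then show ?case
    by (auto intro!: continuous_intros simp: fc_cmult mult.commute[of _ "complex_of_real c"])
next
  case (add g h)
  from add.IH(1)[OF add.prems] add.IH(2)[OF add.prems] show ?case
    by (simp add: fc_add ring_distribs continuous_on_add)
next
  case (mult g h)
  then show ?case by (simp add: mult.assoc[symmetric])
qed

text \<open>With all coefficients zero, f is orthogonal to every polynomial g on the circle, so the
  integral of f^2 equals that of f (f - g), which Stone-Weierstrass makes arbitrarily small.\<close>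

lemma fourier_unique:
  fixes f :: "real \<Rightarrow> real"
  assumes f: "continuous_on {0..1} f" "f 1 = f 0" and z: "\<And>n. rfc f (int n) = 0" and s: "s \<in> {0..1}"
  shows "f s = 0"
proof -
  have z': "rfc f k = 0" for k
    using z[of "nat k"] z[of "nat (- k)"] fc_uminus[of f "-k"] by (cases "k \<ge> 0") auto
  obtain F where F: "continuous_on (sphere 0 1) F" "\<And>s. s \<in> {0..1} \<Longrightarrow> F (cis (2 * pi * s)) = f s"
    using continuous_on_circle[OF f] by blast
  have cf2: "continuous_on {0..1} (\<lambda>s. f s * f s)" by (intro continuous_intros f)
  have "integral {0..1} (\<lambda>s. f s * f s) \<le> e" if e: "e > 0" for e
  proof -
    obtain M where M: "\<forall>s\<in>{0..1}. \<bar>f s\<bar> \<le> M" "M > 0"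
      using compact_imp_bounded[OF compact_continuous_image[OF f(1)]] by (auto simp: bounded_pos)
    obtain g where g: "real_polynomial_function g" 
        "\<And>x. x \<in> sphere 0 1 \<Longrightarrow> \<bar>F x - g x\<bar> < e / M"
      using Stone_Weierstrass_real_polynomial_function[OF compact_sphere F(1), of "e / M"] e M(2) by auto
    let ?g = "\<lambda>s. g (cis (2 * pi * s))"
    have cg: "continuous_on {0..1} ?g"
      by (intro continuous_on_compose2[OF continuous_on_polymonial_function[of g UNIV]] continuous_intros)
         (use g(1) real_polynomial_function_eq in auto)
    have "fc (\<lambda>s. of_real (f s) * of_real (?g s)) 0 = 0"
      using zero_coeffs_mult_polynomial[OF g(1), of "\<lambda>s. of_real (f s)"] z' f(1)
      by (auto intro!: continuous_intros)
    then have i0: "integral {0..1} (\<lambda>s. complex_of_real (f s * ?g s)) = 0" by (simp add: fc_def)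
    have i: "((\<lambda>s. f s * ?g s) has_integral integral {0..1} (\<lambda>s. f s * ?g s)) {0..1}"
      by (intro integrable_integral integrable_continuous_interval continuous_intros f cg)
    then have "((\<lambda>s. complex_of_real (f s * ?g s)) has_integral
        of_real (integral {0..1} (\<lambda>s. f s * ?g s))) {0..1}"
      by (rule has_integral_of_real)
    from integral_unique[OF this] have 0: "integral {0..1} (\<lambda>s. f s * ?g s) = 0"
      unfolding i0 by simp
    have "integral {0..1} (\<lambda>s. f s * f s) = integral {0..1} (\<lambda>s. f s * f s) - integral {0..1} (\<lambda>s. f s * ?g s)"
      using 0 by simp
    also have "\<dots> = integral {0..1} (\<lambda>s. f s * f s - f s * ?g s)"
      by (rule integral_diff[symmetric]) (intro integrable_continuous_interval continuous_intros f cg)+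
    also have "\<dots> \<le> norm (integral {0..1} (\<lambda>s. f s * f s - f s * ?g s))" by simp
    also have "\<dots> \<le> e * (1 - 0)"
    proof (rule integral_bound)
      show "continuous_on {0..1} (\<lambda>s. f s * f s - f s * ?g s)" by (intro continuous_intros f cg)
      fix s :: real assume s: "s \<in> {0..1}"
      have "norm (f s * f s - f s * ?g s) = \<bar>f s\<bar> * \<bar>F (cis (2 * pi * s)) - ?g s\<bar>"
        using F(2)[OF s] by (simp add: abs_mult[symmetric] right_diff_distrib)
      also have "\<dots> \<le> M * (e / M)"
        using M s g(2)[of "cis (2 * pi * s)"] by (intro mult_mono) auto
      finally show "norm (f s * f s - f s * ?g s) \<le> e" using M by simp
    qed simp
    finally show ?thesis by simp
  qed
  then have "integral {0..1} (\<lambda>s. f s * f s) \<le> 0" by (meson field_le_epsilon add_0 dense_ge)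
  moreover have "integral {0..1} (\<lambda>s. f s * f s) \<ge> 0"
    by (intro integral_nonneg integrable_continuous_interval cf2) auto
  ultimately have "integral {0..1} (\<lambda>s. f s * f s) = 0" by simp
  then show ?thesis using integral_eq_0_iff[OF cf2] s by auto
qed

section \<open>Calculus of absolutely convergent trigonometric series\<close>

lemma tsum_terms_bound: "\<bar>2 * Re (a k * cis x)\<bar> \<le> 2 * cmod (a k)"
  using abs_Re_le_cmod[of "a k * cis x"] by (simp add: norm_mult)

lemma tsum_uniform_limit:
  assumes "a \<in> l1"
  shows "uniform_limit X (\<lambda>n x. \<Sum>k<n. 2 * Re (a k * cis (of_nat k * x))) (tsum a) sequentially"
  unfolding tsum_def
  by (rule Weierstrass_m_test[where M = "\<lambda>k. 2 * cmod (a k)"])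
     (use assms in \<open>auto simp: l1_def tsum_terms_bound simp del: times_complex.sel intro: summable_mult\<close>)

lemma tsum_continuous: "a \<in> l1 \<Longrightarrow> continuous_on X (tsum a)"
  by (rule uniform_limit_theorem[OF _ tsum_uniform_limit]) (auto intro!: always_eventually continuous_intros)

lemma tsum_summable: "a \<in> l1 \<Longrightarrow> summable (\<lambda>k. 2 * Re (a k * cis (of_nat k * x)))"
  by (rule summable_comparison_test'[where g = "\<lambda>k. 2 * cmod (a k)"])
     (auto simp: l1_def tsum_terms_bound simp del: times_complex.sel intro: summable_mult)

lemma tsum_bound: assumes "a \<in> l1" shows "\<bar>tsum a x\<bar> \<le> l1_norm a"
proof -
  have "norm (\<Sum>k. 2 * Re (a k * cis (of_nat k * x))) \<le> (\<Sum>k. 2 * cmod (a k))"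
    by (rule norm_suminf_le)
       (use assms in \<open>auto simp: l1_def tsum_terms_bound simp del: times_complex.sel intro: summable_mult\<close>)
  then show ?thesis using assms by (simp add: tsum_def l1_norm_def l1_def suminf_mult del: times_complex.sel)
qed

lemma tsum_diff: "a \<in> l1 \<Longrightarrow> b \<in> l1 \<Longrightarrow> tsum a x - tsum b x = tsum (\<lambda>k. a k - b k) x"
  unfolding tsum_def using tsum_summable
  by (subst suminf_diff) (auto simp: algebra_simps intro!: suminf_cong)

lemma tsum_deriv:
  assumes "a \<in> l1" "K_inv a \<in> l1"
  shows "(tsum a has_real_derivative tsum (\<lambda>k. \<i> * K_inv a k) x) (at x)"
proof -
  have K: "(\<lambda>k. \<i> * K_inv a k) \<in> l1" using assms(2) by (rule l1_cmult)
  have "((\<lambda>x. \<Sum>n. 2 * Re (a n * cis (of_nat n * x))) has_field_derivative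
     (\<Sum>n. 2 * Re (\<i> * K_inv a n * cis (of_nat n * x)))) (at x)"
  proof (rule has_field_derivative_series'(2)[where S = UNIV and ?x0.0 = 0])
    show "uniformly_convergent_on UNIV (\<lambda>n x. \<Sum>i<n. 2 * Re (\<i> * K_inv a i * cis (of_nat i * x)))"
      using tsum_uniform_limit[OF K] unfolding uniformly_convergent_on_def by blast
    show "summable (\<lambda>n. 2 * Re (a n * cis (real n * 0)))" by (rule tsum_summable[OF assms(1)])
    fix n and x :: real
    have "((\<lambda>x. 2 * (Re (a n) * cos (real n * x) - Im (a n) * sin (real n * x))) has_field_derivative
      2 * Re (\<i> * K_inv a n * cis (of_nat n * x))) (at x)"
      by (auto intro!: derivative_eq_intros simp: K_inv_def algebra_simps)
    then show "((\<lambda>x. 2 * Re (a n * cis (real n * x))) has_field_derivative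
      2 * Re (\<i> * K_inv a n * cis (of_nat n * x))) (at x within UNIV)" by simp
  qed auto
  then show ?thesis by (simp add: tsum_def[abs_def])
qed

lemma cis_has_integral:
  "((\<lambda>s. cis (2 * pi * of_int m * s)) has_integral (if m = 0 then 1 else 0)) {0..1}"
proof (cases "m = 0")
  case True
  then show ?thesis using has_integral_const_real[of "1::complex" 0 1] by simp
next
  case False
  let ?c = "2 * pi * of_int m :: real"
  have c: "?c \<noteq> 0" using False by simp
  have "((\<lambda>s. cis (?c * s)) has_integral (cis (?c * 1) / (\<i> * of_real ?c) - cis (?c * 0) / (\<i> * of_real ?c))) {0..1}"
  proof (rule fundamental_theorem_of_calculus)
    fix s :: real
    show "((\<lambda>s. cis (?c * s) / (\<i> * of_real ?c)) has_vector_derivative cis (?c * s)) (at s within {0..1})"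
      using has_vector_derivative_divide[OF cis_has_vector_derivative[of ?c s "{0..1}"], of "\<i> * of_real ?c"]
        False by simp
  qed simp
  moreover have "cis (?c * 1) = 1"
    using cis_multiple_2pi[of "of_int m"] by (simp add: mult.commute)
  ultimately show ?thesis using False by simp
qed

text \<open>Uniform convergence permits termwise integration. The conjugate part of the n-th term
  contributes only for n = k = 0, where a 0 = 0.\<close>

lemma fc_tsum:
  assumes "a \<in> l1"
  shows "rfc (\<lambda>s. tsum a (2 * pi * s)) (int k) = a k"
proof -
  let ?t = "\<lambda>n s. complex_of_real (2 * Re (a n * cis (of_nat n * (2 * pi * s)))) * cis (- (2 * pi * of_int (int k) * s))"
  have sm: "summable (\<lambda>k. 2 * cmod (a k))" using assms by (auto simp: l1_def)
  have u: "uniform_limit {0..1} (\<lambda>n s. \<Sum>i<n. ?t i s) (\<lambda>s. \<Sum>i. ?t i s) sequentially"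
    by (rule Weierstrass_m_test[OF _ sm]) (simp only: norm_mult norm_of_real tsum_terms_bound norm_cis mult_1_right)
  have eq: "(\<Sum>i. ?t i s) = of_real (tsum a (2 * pi * s)) * cis (- (2 * pi * of_int (int k) * s))" for s
    unfolding tsum_def
    by (subst suminf_mult2[symmetric]) (use tsum_summable[OF assms] in \<open>auto intro!: summable_of_real suminf_of_real[symmetric] simp del: times_complex.sel of_real_mult\<close>)
  obtain I J where I: "\<And>n. ((\<lambda>s. \<Sum>i<n. ?t i s) has_integral I n) {0..1}"
     and J: "((\<lambda>s. \<Sum>i. ?t i s) has_integral J) {0..1}" and IJ: "(I \<longlongrightarrow> J) sequentially"
    by (rule uniform_limit_integral[OF u]) (auto intro!: continuous_intros)
  have t: "(?t n has_integral (if n = k then a k else 0)) {0..1}" for n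
  proof -
    have eq: "?t n s = a n * cis (2 * pi * of_int (int n - int k) * s) + cnj (a n) * cis (2 * pi * of_int (- int n - int k) * s)" for s :: real
    proof -
      have "complex_of_real (2 * Re (a n * cis (of_nat n * (2 * pi * s))))
         = a n * cis (of_nat n * (2 * pi * s)) + cnj (a n) * cis (- (of_nat n * (2 * pi * s)))"
        unfolding complex_add_cnj[symmetric] by (simp add: cis_cnj)
      then show ?thesis
        by (simp add: ring_distribs mult.assoc cis_mult) (simp add: algebra_simps)
    qed
    have "((\<lambda>s. a n * cis (2 * pi * of_int (int n - int k) * s) + cnj (a n) * cis (2 * pi * of_int (- int n - int k) * s))
      has_integral (a n * (if int n - int k = 0 then 1 else 0) + cnj (a n) * (if - int n - int k = 0 then 1 else 0))) {0..1}"
      by (intro has_integral_add has_integral_mult_right cis_has_integral)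
    moreover have "a n * (if int n - int k = 0 then 1 else 0) + cnj (a n) * (if - int n - int k = 0 then 1 else 0)
      = (if n = k then a k else 0)"
      using assms by (auto simp: l1_def)
    ultimately show ?thesis unfolding eq by simp
  qed
  have "I n = (\<Sum>i<n. if i = k then a k else 0)" for n
    by (rule has_integral_unique[OF I]) (intro has_integral_sum t finite_lessThan)
  then have "eventually (\<lambda>n. I n = a k) sequentially"
    by (intro eventually_sequentiallyI[of "Suc k"]) auto
  then have "I \<longlonglongrightarrow> a k" by (rule tendsto_eventually)
  then have "J = a k" using IJ LIMSEQ_unique by blast
  then show ?thesis using integral_unique[OF J] unfolding eq fc_def by simp
qed

section \<open>Periodic solutions as zeros of the Fourier map\<close>

text \<open>Without the normalization of the first coefficient: on \<open>\<epsilon> (e\<^sub>1 + c)\<close> it is \<open>\<epsilon>\<close> times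
  \<open>F_map\<close>.\<close>

definition G_map :: "real \<Rightarrow> real \<Rightarrow> cseq \<Rightarrow> cseq" where
  "G_map \<alpha> \<omega> a k = \<i> * of_real \<omega> * K_inv a k + of_real \<alpha> * U_op \<omega> a k + of_real \<alpha> * conv (U_op \<omega> a) a k"

lemma tsum_add: "a \<in> l1 \<Longrightarrow> b \<in> l1 \<Longrightarrow> tsum (\<lambda>k. a k + b k) x = tsum a x + tsum b x"
  unfolding tsum_def using tsum_summable
  by (subst suminf_add) (auto simp: algebra_simps intro!: suminf_cong)

lemma tsum_cmult: "a \<in> l1 \<Longrightarrow> tsum (\<lambda>k. of_real r * a k) x = r * tsum a x"
  unfolding tsum_def using tsum_summable[of a x]
  by (subst suminf_mult[symmetric]) (auto simp: algebra_simps intro!: suminf_cong)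

lemma tsum_shift: "tsum a (x + y) = tsum (\<lambda>k. cis (of_nat k * y) * a k) x"
proof -
  have "a k * cis (of_nat k * (x + y)) = cis (of_nat k * y) * a k * cis (of_nat k * x)" for k
    by (simp add: ring_distribs cis_mult[symmetric] mult_ac)
  then show ?thesis by (simp only: tsum_def)
qed

lemma tsum_delay: "tsum a (x - \<omega>) = tsum (U_op \<omega> a) x"
  using tsum_shift[of a x "- \<omega>"] by (simp add: U_op_cis[abs_def])

lemma tsum_periodic: "tsum a (x + 2 * pi) = tsum a x"
proof -
  have "cis (of_nat k * (2 * pi)) = 1" for k using cis_multiple_2pi[of "of_nat k"] by (simp add: mult_ac)
  then show ?thesis by (simp add: tsum_shift)
qed

text \<open>A product of two mean-zero series has a constant mode, which \<open>conv\<close> cannot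
  store, so it appears as a separate summand. The identity is obtained over the complex numbers and
  its real part taken.\<close>

lemma tsum_mult:
  assumes "a \<in> l1" "b \<in> l1"
  shows "tsum a x * tsum b x = Re (iconv (bi_ext a) (bi_ext b) 0) + tsum (conv a b) x"
proof -
  let ?A = "\<lambda>j. bi_ext a j * cis (of_int j * x)" and ?B = "\<lambda>j. bi_ext b j * cis (of_int j * x)"
  let ?c = "iconv (bi_ext a) (bi_ext b)"
  have "iconv ?A ?B = (\<lambda>k. ?c k * cis (of_int k * x))"
  proof
    fix k
    have "?A j * ?B (k - j) = bi_ext a j * bi_ext b (k - j) * cis (of_int k * x)" for j
    proof -
      have "cis (of_int j * x) * cis (of_int (k - j) * x) = cis (of_int k * x)"
        by (simp add: cis_mult algebra_simps)
      then show ?thesis by (metis (no_types) mult.assoc mult.left_commute)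
    qed
    then show "iconv ?A ?B k = ?c k * cis (of_int k * x)"
      unfolding iconv_def by (simp only: infsum_cmult_left')
  qed
  then have "((\<lambda>k. ?c k * cis (of_int k * x)) has_sum of_real (tsum a x) * of_real (tsum b x)) UNIV"
    using iconv_has_sum[of ?A ?B "of_real (tsum a x)" "of_real (tsum b x)"] assms
    by (simp add: norm_mult bi_ext_summable tsum_has_sum)
  moreover have "((\<lambda>k. bi_ext (conv a b) k * cis (of_int k * x) + (if k = 0 then ?c 0 else 0))
      has_sum of_real (tsum (conv a b) x) + ?c 0) UNIV"
  proof (intro has_sum_add tsum_has_sum conv_summable assms)
    show "((\<lambda>k. if k = 0 then ?c 0 else 0) has_sum ?c 0) UNIV"
      by (rule has_sum_finite_neutralI[of "{0}"]) auto
  qed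
  moreover have "bi_ext (conv a b) k * cis (of_int k * x) + (if k = 0 then ?c 0 else 0) = ?c k * cis (of_int k * x)" for k
  proof -
    have "bi_ext (conv a b) k = ?c k" if "k \<noteq> 0"
    proof (cases "k > 0")
      case True then show ?thesis by (simp add: bi_ext_def conv_iconv)
    next
      case False
      then have "bi_ext (conv a b) k = cnj (?c (- k))" using that by (simp add: bi_ext_def conv_iconv)
      also have "\<dots> = ?c k" by (subst iconv_uminus) (auto simp: bi_ext_uminus)
      finally show ?thesis .
    qed
    then show ?thesis by auto
  qed
  ultimately have "of_real (tsum a x) * of_real (tsum b x) = of_real (tsum (conv a b) x) + ?c 0"
    using has_sum_unique by (metis (no_types, lifting) has_sum_cong)
  from arg_cong[OF this, of Re] show ?thesis by simp
qed

lemma G_map_l1: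
  assumes "a 0 = 0" "K_inv a \<in> l1"
  shows "G_map \<alpha> \<omega> a \<in> l1"
  using K_inv_l1[OF assms] assms(2) unfolding G_map_def[abs_def]
  by (intro l1_add l1_cmult conv_summable) auto

text \<open>Substituting a Fourier series with vanishing mean into the delay equation leaves the
  constant mode of the product as the only term not controlled by \<open>G_map\<close>.\<close>

lemma wright_residual:
  assumes "a 0 = 0" "K_inv a \<in> l1"
  shows "\<omega> * tsum (\<lambda>k. \<i> * K_inv a k) x + \<alpha> * tsum a (x - \<omega>) * (1 + tsum a x)
    = \<alpha> * Re (iconv (bi_ext (U_op \<omega> a)) (bi_ext a) 0) + tsum (G_map \<alpha> \<omega> a) x"
proof -
  have a: "a \<in> l1" using K_inv_l1[OF assms] .
  have "tsum (G_map \<alpha> \<omega> a) x = tsum (\<lambda>k. of_real \<omega> * (\<i> * K_inv a k)) x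
     + tsum (\<lambda>k. of_real \<alpha> * U_op \<omega> a k) x + tsum (\<lambda>k. of_real \<alpha> * conv (U_op \<omega> a) a k) x"
    using a assms(2) unfolding G_map_def[abs_def]
    by (simp add: tsum_add[symmetric] l1_add l1_cmult conv_summable mult_ac)
  also have "\<dots> = \<omega> * tsum (\<lambda>k. \<i> * K_inv a k) x + \<alpha> * tsum (U_op \<omega> a) x + \<alpha> * tsum (conv (U_op \<omega> a) a) x"
    using a assms(2) by (simp add: tsum_cmult l1_cmult conv_summable)
  finally show ?thesis
    using tsum_mult[of "U_op \<omega> a" a x] a by (simp add: tsum_delay algebra_simps)
qed

text \<open>Period-one rescaling \<open>z(s) = y(s L)\<close> with \<open>L = 2\<pi>/\<omega>\<close>.\<close>

definition wright_profile :: "real \<Rightarrow> real \<Rightarrow> (real \<Rightarrow> real) \<Rightarrow> bool" where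
  "wright_profile \<alpha> \<omega> z \<longleftrightarrow> (\<forall>s. z (s + 1) = z s) \<and> (\<forall>s. 1 + z s > 0) \<and>
     (\<forall>s. (z has_real_derivative (- \<alpha> * (2 * pi / \<omega>) * z (s - \<omega> / (2 * pi)) * (1 + z s))) (at s))"

text \<open>The missing zero mode vanishes by itself: dividing the equation by \<open>1 + y\<close> makes every term
  but \<open>r / (1 + y)\<close> the derivative of a periodic function.\<close>

lemma G_zero_imp_profile:
  assumes a: "a 0 = 0" "K_inv a \<in> l1" and G: "\<And>k. G_map \<alpha> \<omega> a k = 0"
    and small: "l1_norm a < 1" and \<omega>: "\<omega> > 0"
  shows "wright_profile \<alpha> \<omega> (\<lambda>s. tsum a (2 * pi * s))"
proof -
  have al: "a \<in> l1" using K_inv_l1[OF a] .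
  define r where "r = \<alpha> * Re (iconv (bi_ext (U_op \<omega> a)) (bi_ext a) 0)"
  let ?y = "tsum a" and ?y' = "tsum (\<lambda>k. \<i> * K_inv a k)"
  have eq: "\<omega> * ?y' x + \<alpha> * ?y (x - \<omega>) * (1 + ?y x) = r" for x
  proof -
    have "tsum (G_map \<alpha> \<omega> a) x = 0" by (simp add: tsum_def G)
    then show ?thesis using wright_residual[OF a, of \<omega> x \<alpha>] by (simp add: r_def)
  qed
  have pos: "1 + ?y x > 0" for x using tsum_bound[OF al, of x] small by linarith
  \<comment> \<open>Coefficients of the periodic primitive of the series; division by zero gives b 0
    = 0, as required.\<close>
  define b where "b k = a k / (\<i> * of_nat k)" for k
  have iKb: "\<i> * K_inv b k = a k" for k using a(1) by (cases k) (auto simp: b_def K_inv_def simp del: of_nat_Suc)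
  have "K_inv b k = - \<i> * a k" for k using iKb[of k] by (metis i_squared mult.assoc mult_minus_left mult_1 minus_minus)
  then have "K_inv b = (\<lambda>k. - \<i> * a k)" by (rule ext)
  then have "K_inv b \<in> l1" using l1_cmult[OF al] by metis
  then have b: "b \<in> l1" "K_inv b \<in> l1" using K_inv_l1[of b] by (auto simp: b_def)
  have db: "(tsum b has_real_derivative ?y x) (at x)" for x
    using tsum_deriv[OF b, of x] by (simp add: iKb)
  \<comment> \<open>A primitive of the equation divided by 1 + y: its derivative r / (1 + y) has one
    sign, which contradicts periodicity unless r = 0.\<close>
  define \<Phi> where "\<Phi> x = \<omega> * ln (1 + ?y x) + \<alpha> * tsum b (x - \<omega>)" for x
  have d\<Phi>: "(\<Phi> has_real_derivative r / (1 + ?y x)) (at x)" for x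
  proof -
    have "((\<lambda>x. tsum b (x - \<omega>)) has_real_derivative ?y (x - \<omega>)) (at x)"
      using DERIV_shift[of "tsum b" "?y (x - \<omega>)" x "- \<omega>"] db[of "x - \<omega>"] by simp
    then have "(\<Phi> has_real_derivative \<omega> * (?y' x / (1 + ?y x)) + \<alpha> * ?y (x - \<omega>)) (at x)"
      unfolding \<Phi>_def[abs_def] using pos[of x]
      by (auto intro!: derivative_eq_intros tsum_deriv al a)
    moreover have "\<omega> * (?y' x / (1 + ?y x)) + \<alpha> * ?y (x - \<omega>) = r / (1 + ?y x)"
      using pos[of x] by (subst eq[symmetric, of x]) (simp add: field_simps)
    ultimately show ?thesis by simp
  qed
  have per: "\<Phi> (2 * pi) = \<Phi> 0"
    using tsum_periodic[of a 0] tsum_periodic[of b "- \<omega>"] by (simp add: \<Phi>_def algebra_simps)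
  have r: "r = 0"
  proof (rule ccontr)
    assume "r \<noteq> 0"
    then consider "r > 0" | "r < 0" by linarith
    then show False
    proof cases
      case 1
      have "\<Phi> 0 < \<Phi> (2 * pi)"
        by (rule DERIV_pos_imp_increasing) (use d\<Phi> 1 pos in \<open>auto intro: divide_pos_pos\<close>)
      then show False using per by simp
    next
      case 2
      have "\<Phi> (2 * pi) < \<Phi> 0"
        by (rule DERIV_neg_imp_decreasing) (use d\<Phi> 2 pos in \<open>auto intro: divide_neg_pos\<close>)
      then show False using per by simp
    qed
  qed
  show ?thesis unfolding wright_profile_def
  proof (intro conjI allI)
    fix s
    show "?y (2 * pi * (s + 1)) = ?y (2 * pi * s)"
      using tsum_periodic[of a "2 * pi * s"] by (simp add: algebra_simps)
    show "1 + ?y (2 * pi * s) > 0" by (rule pos)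
    have "((\<lambda>s. ?y (2 * pi * s)) has_real_derivative ?y' (2 * pi * s) * (2 * pi)) (at s)"
      by (rule DERIV_chain2[OF tsum_deriv[OF al a(2)]]) (auto intro!: derivative_eq_intros)
    moreover have "?y' (2 * pi * s) = - \<alpha> * ?y (2 * pi * s - \<omega>) * (1 + ?y (2 * pi * s)) / \<omega>"
      using eq[of "2 * pi * s"] \<omega> r by (simp add: field_simps)
    moreover have "2 * pi * (s - \<omega> / (2 * pi)) = 2 * pi * s - \<omega>" by (simp add: right_diff_distrib)
    ultimately show "((\<lambda>s. ?y (2 * pi * s)) has_real_derivative
       - \<alpha> * (2 * pi / \<omega>) * ?y (2 * pi * (s - \<omega> / (2 * pi))) * (1 + ?y (2 * pi * s))) (at s)"
      by (simp add: mult_ac)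
  qed
qed

lemma periodic_int:
  fixes z :: "real \<Rightarrow> 'a"
  assumes "\<And>s. z (s + 1) = z s"
  shows "z (s + of_int n) = z s"
proof -
  have nat: "z (s + of_nat n) = z s" for n s
    by (induction n) (use assms[of "s + of_nat _"] in \<open>auto simp: add_ac\<close>)
  show ?thesis
  proof (cases "n \<ge> 0")
    case True then show ?thesis using nat[of s "nat n"] by simp
  next
    case False then show ?thesis using nat[of "s + of_int n" "nat (- n)"] by simp
  qed
qed

lemma periodic_frac: "(\<And>s. z (s + 1) = z s) \<Longrightarrow> z (frac s) = z (s::real)"
  using periodic_int[of z s "- \<lfloor>s\<rfloor>"] by (simp add: frac_def)

lemma tsum_coeff_eq:
  assumes a: "a \<in> l1" and z: "continuous_on {0..1} z" "\<And>s. z (s + 1) = z s"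
    and eq: "\<And>k. rfc z (int k) = a k"
  shows "z s = tsum a (2 * pi * s)"
proof -
  let ?w = "\<lambda>s. tsum a (2 * pi * s)"
  have per: "?w (s + 1) = ?w s" for s
    using tsum_periodic[of a "2 * pi * s"] by (simp add: algebra_simps)
  have cw: "continuous_on X ?w" for X
    by (rule continuous_on_compose2[OF tsum_continuous[OF a, of UNIV]]) (auto intro: continuous_intros)
  have "z (frac s) - ?w (frac s) = 0"
  proof (rule fourier_unique[where f = "\<lambda>s. z s - ?w s" and s = "frac s"])
    show "continuous_on {0..1} (\<lambda>s. z s - ?w s)" by (intro continuous_intros z cw)
    show "z 1 - ?w 1 = z 0 - ?w 0" using z(2)[of 0] per[of 0] by simp
    show "rfc (\<lambda>s. z s - ?w s) (int n) = 0" for n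
      using fc_diff[of "\<lambda>s. of_real (z s)" "\<lambda>s. of_real (?w s)" "int n"] eq[of n] fc_tsum[OF a, of n] z cw
      by (simp add: continuous_on_of_real)
    show "frac s \<in> {0..1}" using frac_lt_1[of s] by (simp add: less_imp_le)
  qed
  then show ?thesis using periodic_frac[of z s] periodic_frac[of ?w s] z(2) per by simp
qed

lemma profile_continuous: "wright_profile \<alpha> \<omega> z \<Longrightarrow> continuous_on X z"
  unfolding wright_profile_def by (meson DERIV_isCont continuous_at_imp_continuous_on)

text \<open>Dividing by 1 + z makes the left side the derivative of the periodic function ln (1 +
  z), so the delayed z has integral 0 over a period. Shifting by the delay turns this into the
  integral of z over [0,1].\<close>

lemma profile_mean:
  assumes w: "wright_profile \<alpha> \<omega> z" and "\<alpha> \<noteq> 0" "\<omega> > 0"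
  shows "rfc z 0 = 0"
proof -
  let ?t = "\<omega> / (2 * pi)" and ?k = "- \<alpha> * (2 * pi / \<omega>)"
  have "((\<lambda>s. ?k * z s) has_integral ln (1 + z (1 + ?t)) - ln (1 + z (0 + ?t))) {0..1}"
  proof (rule fundamental_theorem_of_calculus)
    fix s :: real
    have "(z has_real_derivative (?k * z (s + ?t - ?t) * (1 + z (s + ?t)))) (at (s + ?t))"
      using w unfolding wright_profile_def by blast
    then have "((\<lambda>s. z (s + ?t)) has_real_derivative ?k * z s * (1 + z (s + ?t))) (at s)"
      by (subst DERIV_shift[symmetric]) simp
    moreover have "1 + z (s + ?t) > 0" using w by (simp add: wright_profile_def)
    ultimately have "((\<lambda>s. ln (1 + z (s + ?t))) has_real_derivative ?k * z s) (at s)"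
      by (auto intro!: derivative_eq_intros)
    then show "((\<lambda>s. ln (1 + z (s + ?t))) has_vector_derivative ?k * z s) (at s within {0..1})"
      using has_field_derivative_at_within has_real_derivative_iff_has_vector_derivative by blast
  qed simp
  moreover have "z (1 + ?t) = z (0 + ?t)"
    using w unfolding wright_profile_def by (metis add.commute add_0)
  ultimately have "((\<lambda>s. ?k * z s) has_integral 0) {0..1}" by simp
  from has_integral_mult_right[OF this, of "1 / ?k"] have "(z has_integral 0) {0..1}"
    using assms by simp
  then have "((\<lambda>s. complex_of_real (z s)) has_integral of_real 0) {0..1}"
    by (rule has_integral_of_real)
  from integral_unique[OF this] show ?thesis by (simp add: fc_def)
qed

lemma rfc_deriv:
  assumes "\<And>s. (f has_real_derivative f' s) (at s)" "continuous_on {0..1} f'" "f 1 = f 0"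
  shows "rfc f' k = 2 * pi * \<i> * of_int k * rfc f k"
proof (rule fc_deriv)
  show "((\<lambda>s. complex_of_real (f s)) has_vector_derivative complex_of_real (f' s)) (at s)" for s
    using assms(1)[of s] by (intro has_vector_derivative_of_real)
      (simp add: has_real_derivative_iff_has_vector_derivative)
qed (use assms in \<open>auto intro!: continuous_intros\<close>)

text \<open>The delay equation bounds each of the first three derivatives of a periodic solution by a
  multiple of its supremum norm, so three integrations by parts give cubic decay.\<close>

lemma profile_coeff_decay:
  assumes w: "wright_profile \<alpha> \<omega> z" and M: "\<And>s. \<bar>z s\<bar> \<le> M" "M \<le> 1"
    and B: "\<bar>\<alpha> * (2 * pi / \<omega>)\<bar> \<le> B" "1 \<le> B" and k: "0 < k"
  shows "cmod (rfc z (int k)) \<le> B ^ 3 * M / real k ^ 3"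
proof -
  define \<kappa> where "\<kappa> = - \<alpha> * (2 * pi / \<omega>)"
  define \<tau> where "\<tau> = \<omega> / (2 * pi)"
  define z1 where "z1 s = \<kappa> * z (s - \<tau>) * (1 + z s)" for s
  define z2 where "z2 s = \<kappa> * (z1 (s - \<tau>) * (1 + z s) + z (s - \<tau>) * z1 s)" for s
  define z3 where "z3 s = \<kappa> * (z2 (s - \<tau>) * (1 + z s) + 2 * (z1 (s - \<tau>) * z1 s) + z (s - \<tau>) * z2 s)" for s
  have shift: "((\<lambda>s. f (s - \<tau>)) has_real_derivative f' (s - \<tau>)) (at s)"
    if "\<And>s. (f has_real_derivative f' s) (at s)" for f f' s
    using DERIV_shift[of f "f' (s - \<tau>)" s "- \<tau>"] that[of "s - \<tau>"] by simp
  have d0: "(z has_real_derivative z1 s) (at s)" for s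
    using w by (simp add: wright_profile_def z1_def \<kappa>_def \<tau>_def)
  have d1: "(z1 has_real_derivative z2 s) (at s)" for s
    unfolding z1_def[abs_def]
    by (auto intro!: derivative_eq_intros d0 shift[OF d0] simp: z2_def z1_def algebra_simps)
  have d2: "(z2 has_real_derivative z3 s) (at s)" for s
    unfolding z2_def[abs_def]
    by (auto intro!: derivative_eq_intros d0 d1 shift[OF d0] shift[OF d1] simp: z3_def z2_def algebra_simps)
  have cont: "continuous_on X f" if "\<And>s. (f has_real_derivative f' s) (at s)" for f f' :: "real \<Rightarrow> real" and X
    using that by (meson DERIV_isCont continuous_at_imp_continuous_on)
  have c: "continuous_on X (\<lambda>s. f (s - \<tau>))" if "continuous_on UNIV f" for f :: "real \<Rightarrow> real" and X
    by (rule continuous_on_compose2[OF that]) (auto intro: continuous_intros)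
  have c3: "continuous_on X z3" for X
    unfolding z3_def[abs_def] by (intro continuous_intros c cont[OF d0] cont[OF d1] cont[OF d2])
  have p0: "z (s + 1) = z s" for s using w by (simp add: wright_profile_def)
  have p0': "z (s + 1 - \<tau>) = z (s - \<tau>)" for s using p0[of "s - \<tau>"] by (simp add: algebra_simps)
  have p1: "z1 (s + 1) = z1 s" for s by (simp only: z1_def p0 p0')
  have p1': "z1 (s + 1 - \<tau>) = z1 (s - \<tau>)" for s using p1[of "s - \<tau>"] by (simp add: algebra_simps)
  have p2: "z2 (s + 1) = z2 s" for s by (simp only: z2_def p0 p0' p1 p1')
  have M0: "0 \<le> M" using M(1)[of 0] by linarith
  have \<kappa>: "\<bar>\<kappa>\<bar> \<le> B" using B(1) by (simp add: \<kappa>_def)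
  have B0: "0 \<le> B" using B by linarith
  have z1p: "\<bar>1 + z s\<bar> \<le> 2" for s using M(1)[of s] M(2) by linarith
  have b1: "\<bar>z1 s\<bar> \<le> 2 * B * M" for s
  proof -
    have "\<bar>z1 s\<bar> \<le> B * M * 2"
      unfolding z1_def abs_mult using M0 B0 by (intro mult_mono \<kappa> M z1p) auto
    then show ?thesis by (simp add: mult_ac)
  qed
  \<comment> \<open>M \<le> 1 absorbs the quadratic terms, so every derivative stays linear in
    M.\<close>
  have M2: "M * M \<le> M" using M M0 mult_left_mono[of M 1 M] by simp
  have b2: "\<bar>z2 s\<bar> \<le> 6 * B\<^sup>2 * M" for s
  proof -
    have "\<bar>z1 (s - \<tau>) * (1 + z s)\<bar> \<le> 2 * B * M * 2"
      unfolding abs_mult using M0 B0 by (intro mult_mono b1 z1p) auto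
    moreover have "\<bar>z (s - \<tau>) * z1 s\<bar> \<le> M * (2 * B * M)"
      unfolding abs_mult using M0 B0 by (intro mult_mono b1 M) auto
    moreover have "M * (2 * B * M) \<le> 2 * B * M" using mult_left_mono[OF M2, of "2 * B"] B0 by (simp add: mult_ac)
    ultimately have "\<bar>z1 (s - \<tau>) * (1 + z s) + z (s - \<tau>) * z1 s\<bar> \<le> 6 * B * M" by linarith
    then have "\<bar>z2 s\<bar> \<le> B * (6 * B * M)"
      unfolding z2_def abs_mult using B0 by (intro mult_mono \<kappa>) auto
    then show ?thesis by (simp add: power2_eq_square mult_ac)
  qed
  \<comment> \<open>The three summands contribute 12 + 8 + 6 = 26.\<close>
  have b3: "\<bar>z3 s\<bar> \<le> 26 * B ^ 3 * M" for s
  proof -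
    have "\<bar>z2 (s - \<tau>) * (1 + z s)\<bar> \<le> 6 * B\<^sup>2 * M * 2"
      unfolding abs_mult using M0 B0 by (intro mult_mono b2 z1p) auto
    moreover have "\<bar>z1 (s - \<tau>) * z1 s\<bar> \<le> (2 * B * M) * (2 * B * M)"
      unfolding abs_mult using M0 B0 by (intro mult_mono b1) auto
    moreover have "(2 * B * M) * (2 * B * M) \<le> 4 * B\<^sup>2 * M"
      using mult_left_mono[OF M2, of "4 * B\<^sup>2"] by (simp add: power2_eq_square mult_ac)
    moreover have "\<bar>z (s - \<tau>) * z2 s\<bar> \<le> M * (6 * B\<^sup>2 * M)"
      unfolding abs_mult using M0 B0 by (intro mult_mono b2 M) auto
    moreover have "M * (6 * B\<^sup>2 * M) \<le> 6 * B\<^sup>2 * M"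
      using mult_left_mono[OF M2, of "6 * B\<^sup>2"] by (simp add: mult_ac)
    ultimately have "\<bar>z2 (s - \<tau>) * (1 + z s) + 2 * (z1 (s - \<tau>) * z1 s) + z (s - \<tau>) * z2 s\<bar> \<le> 26 * B\<^sup>2 * M"
      by linarith
    then have "\<bar>z3 s\<bar> \<le> B * (26 * B\<^sup>2 * M)"
      unfolding z3_def abs_mult using B0 by (intro mult_mono \<kappa>) auto
    then show ?thesis by (simp add: power2_eq_square power3_eq_cube mult_ac)
  qed
  have r1: "rfc z1 m = 2 * pi * \<i> * of_int m * rfc z m" for m
    by (rule rfc_deriv) (use d0 cont[OF d1] p0[of 0] in auto)
  have r2: "rfc z2 m = 2 * pi * \<i> * of_int m * rfc z1 m" for m
    by (rule rfc_deriv) (use d1 cont[OF d2] p1[of 0] in auto)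
  have r3: "rfc z3 m = 2 * pi * \<i> * of_int m * rfc z2 m" for m
    by (rule rfc_deriv) (use d2 c3 p2[of 0] in auto)
  have "cmod (rfc z3 (int k)) \<le> 26 * B ^ 3 * M"
    by (rule fc_bound) (use b3 c3 in \<open>auto intro!: continuous_intros\<close>)
  moreover have "cmod (rfc z3 (int k)) = (2 * pi * real k) ^ 3 * cmod (rfc z (int k))"
    unfolding r3 r2 r1 by (simp add: norm_mult power3_eq_cube)
  \<comment> \<open>The constant 26 is swallowed by the (2 pi)^3 that three integrations by parts
    produce.\<close>
  moreover have "(26::real) \<le> (2 * pi) ^ 3"
    using power_mono[of 3 "2 * pi" 3] pi_gt3 by simp
  then have "26 * (real k ^ 3 * cmod (rfc z (int k))) \<le> (2 * pi) ^ 3 * (real k ^ 3 * cmod (rfc z (int k)))"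
    by (intro mult_right_mono) auto
  ultimately have "26 * (real k ^ 3 * cmod (rfc z (int k))) \<le> 26 * (B ^ 3 * M)"
    by (simp add: power_mult_distrib mult_ac)
  then show ?thesis using k by (simp add: field_simps)
qed

lemma summable_inverse_squares: "summable (\<lambda>k. C / real k ^ 2)"
  using summable_mult[OF inverse_power_summable[of 2, where 'a = real], of C] by (simp add: field_simps)

text \<open>The weight k lowers cubic decay to the summable 1 / k^2; at k = 0 both sides are 0
  because division by 0 gives 0.\<close>

lemma K_inv_l1_of_decay:
  assumes "\<And>k. 0 < k \<Longrightarrow> cmod (a k) \<le> C / real k ^ 3"
  shows "K_inv a \<in> l1"
proof -
  have "cmod (K_inv a k) \<le> C / real k ^ 2" for k
    using assms[of k] by (cases "k = 0") (auto simp: K_inv_def norm_mult field_simps power2_eq_square power3_eq_cube)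
  then show ?thesis unfolding l1_def
    using summable_comparison_test'[OF summable_inverse_squares, of 0 "\<lambda>k. cmod (K_inv a k)" C] by (simp add: K_inv_def)
qed

lemma fc_const: "k \<noteq> 0 \<Longrightarrow> fc (\<lambda>s. c) k = 0"
proof -
  assume "k \<noteq> 0"
  then have "((\<lambda>s. c * cis (2 * pi * of_int (- k) * s)) has_integral c * 0) {0..1}"
    using cis_has_integral[of "- k"] by (intro has_integral_mult_right) simp
  from integral_unique[OF this] show ?thesis by (simp add: fc_def)
qed

text \<open>Converse to \<open>G_zero_imp_profile\<close>: for a solution,
  \<open>wright_residual\<close> leaves the series of \<open>G_map\<close> equal to a constant, and
  a constant has no Fourier coefficient at k > 0. The entry at k = 0 vanishes by convention.\<close>

lemma profile_series:
  assumes w: "wright_profile \<alpha> \<omega> z" and M: "\<And>s. \<bar>z s\<bar> \<le> M" "M \<le> 1" and "\<alpha> \<noteq> 0" "\<omega> > 0"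
  defines "a \<equiv> \<lambda>k. rfc z (int k)"
  shows "a 0 = 0" "K_inv a \<in> l1" "a \<in> l1" "z s = tsum a (2 * pi * s)" "G_map \<alpha> \<omega> a k = 0"
proof -
  show a0: "a 0 = 0" using profile_mean[OF w assms(4,5)] by (simp add: a_def)
  let ?B = "max 1 \<bar>\<alpha> * (2 * pi / \<omega>)\<bar>"
  show K: "K_inv a \<in> l1"
    by (rule K_inv_l1_of_decay[of _ "?B ^ 3 * M"]) (use profile_coeff_decay[OF w M, of ?B] in \<open>simp add: a_def\<close>)
  show a: "a \<in> l1" using K_inv_l1[OF a0 K] .
  have z: "z s = tsum a (2 * pi * s)" for s
    by (rule tsum_coeff_eq[OF a profile_continuous[OF w]]) (use w in \<open>auto simp: wright_profile_def a_def\<close>)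
  then show "z s = tsum a (2 * pi * s)" .
  define r where "r = \<alpha> * Re (iconv (bi_ext (U_op \<omega> a)) (bi_ext a) 0)"
  have "tsum (G_map \<alpha> \<omega> a) (2 * pi * s) = - r" for s
  proof -
    let ?y' = "tsum (\<lambda>k. \<i> * K_inv a k) (2 * pi * s)"
    have "((\<lambda>s. tsum a (2 * pi * s)) has_real_derivative ?y' * (2 * pi)) (at s)"
      by (rule DERIV_chain2[OF tsum_deriv[OF a K]]) (auto intro!: derivative_eq_intros)
    moreover have "((\<lambda>s. tsum a (2 * pi * s)) has_real_derivative
       - \<alpha> * (2 * pi / \<omega>) * z (s - \<omega> / (2 * pi)) * (1 + z s)) (at s)"
      using w unfolding wright_profile_def z[symmetric] by auto
    ultimately have "?y' * (2 * pi) = - \<alpha> * (2 * pi / \<omega>) * z (s - \<omega> / (2 * pi)) * (1 + z s)"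
      by (rule DERIV_unique)
    moreover have "2 * pi * (s - \<omega> / (2 * pi)) = 2 * pi * s - \<omega>" by (simp add: right_diff_distrib)
    ultimately have "?y' * (2 * pi) = - \<alpha> * (2 * pi / \<omega>) * tsum a (2 * pi * s - \<omega>) * (1 + tsum a (2 * pi * s))"
      by (simp only: z)
    also have "\<dots> = - \<alpha> * tsum a (2 * pi * s - \<omega>) * (1 + tsum a (2 * pi * s)) / \<omega> * (2 * pi)"
      by simp
    finally have "?y' = - \<alpha> * tsum a (2 * pi * s - \<omega>) * (1 + tsum a (2 * pi * s)) / \<omega>"
      by (rule mult_right_cancel[THEN iffD1, rotated]) simp
    then have "\<omega> * ?y' + \<alpha> * tsum a (2 * pi * s - \<omega>) * (1 + tsum a (2 * pi * s)) = 0"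
      using \<open>\<omega> > 0\<close> by simp
    then show ?thesis using wright_residual[OF a0 K, of \<omega> "2 * pi * s" \<alpha>] by (simp add: r_def)
  qed
  then have "rfc (\<lambda>s. tsum (G_map \<alpha> \<omega> a) (2 * pi * s)) (int k) = 0" if "k \<noteq> 0"
    using fc_const[of "int k" "complex_of_real (- r)"] that by simp
  then show "G_map \<alpha> \<omega> a k = 0"
    using fc_tsum[OF G_map_l1[OF a0 K], of \<alpha> \<omega> k] a0 by (cases "k = 0") (auto simp: G_map_def K_inv_def U_op_def conv_def)
qed

section \<open>From \<open>G_map\<close> to the normalized map \<open>F_map\<close>\<close>

text \<open>The extension of p e_1 lives at the indices 1 and -1, with cnj p at -1; hence the two
  shifts that make up \<open>L_op\<close>.\<close>

lemma conv_unit_left: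
  assumes "b 0 = 0" "0 < k"
  shows "conv (\<lambda>k. p * unit_seq 1 k) b k = p * b (k - 1) + cnj p * b (k + 1)"
proof -
  let ?A = "bi_ext (\<lambda>k. p * unit_seq 1 k)" and ?B = "bi_ext b"
  have A: "?A j = (if j = 1 then p else if j = -1 then cnj p else 0)" for j
    by (auto simp: bi_ext_def unit_seq_def nat_eq_iff)
  have "conv (\<lambda>k. p * unit_seq 1 k) b k = (\<Sum>\<^sub>\<infinity>j. ?A j * ?B (int k - j))"
    using assms by (simp add: conv_def)
  also have "\<dots> = (\<Sum>\<^sub>\<infinity>j\<in>{1,-1}. ?A j * ?B (int k - j))"
    by (rule infsum_cong_neutral) (auto simp: A simp del: One_nat_def)
  also have "\<dots> = p * ?B (int k - 1) + cnj p * ?B (int k + 1)"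
    by (simp add: A del: One_nat_def)
  also have "?B (int k - 1) = b (k - 1)" using bi_ext_int[of b "k - 1"] assms by (simp add: of_nat_diff)
  also have "?B (int k + 1) = b (k + 1)" using bi_ext_int[of b "k + 1"] assms by (simp add: add.commute)
  finally show ?thesis .
qed

lemma unit_seq_l1: "0 < j \<Longrightarrow> unit_seq j \<in> l1"
proof -
  assume "0 < j"
  moreover have "summable (\<lambda>k. cmod (unit_seq j k))"
    by (rule summable_finite[of "{j}"]) (auto simp: unit_seq_def)
  ultimately show ?thesis by (simp add: l1_def unit_seq_def)
qed

text \<open>Bilinear expansion of the convolution at e_1 + c: e_1 with itself gives the e_2 term and
  the cross terms give \<open>L_op\<close>. Of the \<epsilon>^2 in front, one factor is the common
  one and the other is the \<epsilon> inside \<open>F_map\<close>.\<close>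

lemma G_map_F_map:
  assumes c: "c \<in> l1"
  shows "G_map \<alpha> \<omega> (\<lambda>k. of_real \<epsilon> * (unit_seq 1 k + c k)) k = of_real \<epsilon> * F_map \<epsilon> \<alpha> \<omega> c k"
proof (cases "k = 0")
  case True
  then show ?thesis using c
    by (simp add: G_map_def F_map_def K_inv_def U_op_def conv_def L_op_def shift_plus_def shift_minus_def unit_seq_def l1_def)
next
  case False
  let ?e = "unit_seq 1" and ?p = "cis (- \<omega>)"
  have e: "?e \<in> l1" by (simp add: unit_seq_l1)
  have Ue: "U_op \<omega> ?e = (\<lambda>k. ?p * ?e k)" by (simp add: fun_eq_iff U_op_cis unit_seq_def)
  have c0: "c 0 = 0" using c by (simp add: l1_def)
  have U: "U_op \<omega> (\<lambda>k. of_real \<epsilon> * (?e k + c k)) = (\<lambda>k. of_real \<epsilon> * (U_op \<omega> ?e k + U_op \<omega> c k))"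
    by (simp add: fun_eq_iff U_op_def ring_distribs)
  have "conv (U_op \<omega> (\<lambda>k. of_real \<epsilon> * (?e k + c k))) (\<lambda>k. of_real \<epsilon> * (?e k + c k)) k
    = of_real \<epsilon> * (of_real \<epsilon> * (conv (U_op \<omega> ?e) ?e k + conv (U_op \<omega> ?e) c k + conv ?e (U_op \<omega> c) k
        + conv (U_op \<omega> c) c k))"
    using e c unfolding U conv_cmult_left conv_cmult_right
    by (simp add: conv_add_left conv_add_right l1_add conv_commute[of "U_op \<omega> c" ?e] add_ac del: One_nat_def)
  also have "conv (U_op \<omega> ?e) ?e k = ?p * unit_seq 2 k"
    unfolding Ue using False by (subst conv_unit_left) (auto simp: unit_seq_def)
  also have "conv (U_op \<omega> ?e) c k = ?p * c (k - 1) + cis \<omega> * c (k + 1)"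
    unfolding Ue using False c0 by (subst conv_unit_left) (auto simp: cis_cnj)
  also have "conv ?e (U_op \<omega> c) k = U_op \<omega> c (k - 1) + U_op \<omega> c (k + 1)"
    using conv_unit_left[of "U_op \<omega> c" k 1] False c0 by (simp add: U_op_def)
  finally have cv: "conv (U_op \<omega> (\<lambda>k. of_real \<epsilon> * (?e k + c k))) (\<lambda>k. of_real \<epsilon> * (?e k + c k)) k
    = of_real \<epsilon> * (of_real \<epsilon> * (?p * unit_seq 2 k + (?p * c (k - 1) + cis \<omega> * c (k + 1))
       + (U_op \<omega> c (k - 1) + U_op \<omega> c (k + 1)) + conv (U_op \<omega> c) c k))" .
  have L: "L_op \<omega> c k = (?p * c (k - 1) + cis \<omega> * c (k + 1)) + (U_op \<omega> c (k - 1) + U_op \<omega> c (k + 1))"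
    using False by (simp add: L_op_def shift_plus_def shift_minus_def cis_conv_exp add_ac)
  have K: "K_inv (\<lambda>k. of_real \<epsilon> * (?e k + c k)) k = of_real \<epsilon> * (?e k + K_inv c k)"
    by (simp add: K_inv_def unit_seq_def ring_distribs)
  have x: "exp (- \<i> * of_real \<omega>) = ?p" by (simp add: cis_conv_exp)
  show ?thesis
    unfolding G_map_def F_map_def cv L K x unfolding U unfolding Ue by (simp add: ring_distribs mult_ac add_ac)
qed

definition profile_of :: "real \<Rightarrow> cseq \<Rightarrow> real \<Rightarrow> real" where
  "profile_of \<epsilon> c s = tsum (\<lambda>k. of_real \<epsilon> * (unit_seq 1 k + c k)) (2 * pi * s)"

text \<open>Time translation makes the first coefficient positive; dividing by it leaves \<open>c\<close>.\<close>

definition norm_coeffs :: "cseq \<Rightarrow> cseq" where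
  "norm_coeffs a k = (if k \<le> 1 then 0 else a k * (cnj (a 1) / of_real (cmod (a 1))) ^ k / of_real (cmod (a 1)))"

lemma wright_profile_shift:
  assumes "wright_profile \<alpha> \<omega> z"
  shows "wright_profile \<alpha> \<omega> (\<lambda>s. z (s + \<theta>))"
  unfolding wright_profile_def
proof (intro conjI allI)
  fix s
  have "z ((s + \<theta>) + 1) = z (s + \<theta>)" using assms unfolding wright_profile_def by blast
  then show "z (s + 1 + \<theta>) = z (s + \<theta>)" by (simp add: add_ac)
  show "0 < 1 + z (s + \<theta>)" using assms unfolding wright_profile_def by blast
  have "(z has_real_derivative - \<alpha> * (2 * pi / \<omega>) * z (s + \<theta> - \<omega> / (2 * pi)) * (1 + z (s + \<theta>))) (at (s + \<theta>))"
    using assms unfolding wright_profile_def by blast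
  moreover have "s + \<theta> - \<omega> / (2 * pi) = s - \<omega> / (2 * pi) + \<theta>" by simp
  ultimately show "((\<lambda>s. z (s + \<theta>)) has_real_derivative
      - \<alpha> * (2 * pi / \<omega>) * z (s - \<omega> / (2 * pi) + \<theta>) * (1 + z (s + \<theta>))) (at s)"
    by (subst DERIV_shift[symmetric]) simp
qed

text \<open>Shifting time by \<phi> / (2 pi) multiplies a_k by e^(ik\<phi>); with \<phi> the
  argument of cnj a_1 the new first coefficient is |a_1|, which plays the role of \<epsilon>. The
  data are read off from the shifted solution, and \<theta> undoes the shift.\<close>

lemma profile_normalize:
  assumes w: "wright_profile \<alpha> \<omega> z" and M: "\<And>s. \<bar>z s\<bar> \<le> M" "M \<le> 1" and \<alpha>\<omega>: "\<alpha> \<noteq> 0" "\<omega> > 0"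
    and a1: "rfc z 1 \<noteq> 0"
  defines "c \<equiv> norm_coeffs (\<lambda>k. rfc z (int k))"
  shows "c \<in> lK_0" "F_map (cmod (rfc z 1)) \<alpha> \<omega> c k = 0"
    "\<exists>\<theta>. \<forall>s. z s = profile_of (cmod (rfc z 1)) c (s - \<theta>)"
proof -
  define a where "a k = rfc z (int k)" for k
  define \<epsilon> where "\<epsilon> = cmod (a 1)"
  define \<phi> where "\<phi> = Arg (cnj (a 1))"
  define a' where "a' k = cis (of_nat k * \<phi>) * a k" for k
  have \<epsilon>: "\<epsilon> > 0" and ae: "rfc z 1 = a 1" using a1 by (simp_all add: \<epsilon>_def a_def)
  have u: "cis \<phi> = cnj (a 1) / of_real \<epsilon>"
    using cis_Arg[of "cnj (a 1)"] a1 by (simp add: \<phi>_def \<epsilon>_def sgn_eq a_def)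
  define z' where "z' s = z (s + \<phi> / (2 * pi))" for s
  have w': "wright_profile \<alpha> \<omega> z'" unfolding z'_def[abs_def] by (rule wright_profile_shift[OF w])
  have M': "\<bar>z' s\<bar> \<le> M" for s using M by (simp add: z'_def)
  note ps = profile_series[OF w M \<alpha>\<omega>, folded a_def] 
  have al: "a \<in> l1" "a 0 = 0" using ps(1,3) by (simp_all add: a_def[abs_def])
  have zs: "z s = tsum a (2 * pi * s)" for s using ps(4)[of s] unfolding a_def[abs_def] .
  have a'l: "a' \<in> l1" using al by (simp add: l1_def a'_def norm_mult)
  have z's: "z' s = tsum a' (2 * pi * s)" for s
    by (simp add: z'_def zs ring_distribs tsum_shift a'_def[abs_def])
  have ra': "rfc z' (int k) = a' k" for k
    using fc_tsum[OF a'l, of k] by (simp add: z's)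
  note ps' = profile_series[OF w' M' M(2) \<alpha>\<omega>, unfolded ra']
  have a'1: "a' 1 = of_real \<epsilon>"
    using \<epsilon> by (simp add: a'_def u \<epsilon>_def complex_norm_square[symmetric] power2_eq_square mult.commute[of "cnj _"])
  have a'c: "a' = (\<lambda>k. of_real \<epsilon> * (unit_seq 1 k + c k))"
  proof
    fix k
    have "cis (of_nat k * \<phi>) = (cnj (a 1) / of_real \<epsilon>) ^ k" using Complex.DeMoivre[of \<phi> k] u by simp
    then have "a' k = of_real \<epsilon> * c k" if "k > 1"
      using that \<epsilon> unfolding c_def norm_coeffs_def a_def[symmetric] a'_def \<epsilon>_def[symmetric] by simp
    moreover have "c k = 0" if "k \<le> 1" using that by (simp add: c_def norm_coeffs_def)
    moreover have "a' 0 = 0" using al by (simp add: a'_def)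
    ultimately show "a' k = of_real \<epsilon> * (unit_seq 1 k + c k)"
      using a'1 by (cases "k = 0"; cases "k = 1") (auto simp: unit_seq_def)
  qed
  have c01: "c 0 = 0" "c 1 = 0" by (simp_all add: c_def norm_coeffs_def)
  have cK: "K_inv c \<in> l1"
  proof (rule l1_norm_le(1))
    show "K_inv a' \<in> l1" by (rule ps'(2))
    show "K_inv c 0 = 0" by (simp add: K_inv_def)
    fix k show "cmod (K_inv c k) \<le> (1 / \<epsilon>) * cmod (K_inv a' k)"
      using \<epsilon> c01 by (cases "k = 1") (auto simp: K_inv_def norm_mult a'c unit_seq_def)
  qed
  have cl: "c \<in> l1" using K_inv_l1[OF c01(1) cK] .
  show "c \<in> lK_0" using cK cl c01 by (simp add: lK_0_def l1_0_def)
  show "F_map (cmod (rfc z 1)) \<alpha> \<omega> c k = 0"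
    using ps'(5)[of k] G_map_F_map[OF cl, of \<alpha> \<omega> \<epsilon> k] \<epsilon> unfolding a'c ae \<epsilon>_def[symmetric] by simp
  show "\<exists>\<theta>. \<forall>s. z s = profile_of (cmod (rfc z 1)) c (s - \<theta>)"
  proof (intro exI allI)
    fix s
    show "z s = profile_of (cmod (rfc z 1)) c (s - \<phi> / (2 * pi))"
      using z's[of "s - \<phi> / (2 * pi)"] unfolding ae \<epsilon>_def[symmetric] profile_of_def a'c[symmetric] by (simp add: z'_def)
  qed
qed

section \<open>Slow oscillation in terms of the period-one profile\<close>

text \<open>Here q is t_+ / L. The delay becomes 1 / L after rescaling, so t_+ > 1 and t_- > 1 read
  1 / L < q and 1 / L < 1 - q.\<close>

definition sign_pattern :: "real \<Rightarrow> (real \<Rightarrow> real) \<Rightarrow> bool" where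
  "sign_pattern L z \<longleftrightarrow> (\<exists>q. 1 / L < q \<and> q < 1 - 1 / L \<and>
     (\<forall>s. q - 1 < s \<and> s < 0 \<longrightarrow> z s < 0) \<and> (\<forall>s. 0 < s \<and> s < q \<longrightarrow> z s > 0))"

text \<open>Multiplying w by exp of minus a primitive of g gives a constant. It serves w = 1 + y,
  whose equation is linear once the delayed value is regarded as a given coefficient.\<close>

lemma linear_ode_positive:
  fixes w g :: "real \<Rightarrow> real"
  assumes w: "\<And>t. (w has_real_derivative g t * w t) (at t)" and g: "\<And>X. continuous_on X g" and "w t0 > 0"
  shows "w t > 0"
proof -
  define a b where "a = min t t0" and "b = max t t0"
  define Y where "Y x = integral {a..x} g" for x
  have Y: "(Y has_real_derivative g x) (at x within {a..b})" if "x \<in> {a..b}" for x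
    unfolding Y_def[abs_def] by (rule integral_has_real_derivative[OF g that])
  have "((\<lambda>x. w x * exp (- Y x)) has_real_derivative 0) (at x within {a..b})" if "x \<in> {a..b}" for x
    by (rule derivative_eq_intros has_field_derivative_at_within[OF w] Y that refl)+ (simp add: algebra_simps)
  then obtain C where C: "\<And>x. x \<in> {a..b} \<Longrightarrow> w x * exp (- Y x) = C"
    using has_field_derivative_zero_constant[of "{a..b}" "\<lambda>x. w x * exp (- Y x)"] by auto
  have "w t * exp (- Y t) = w t0 * exp (- Y t0)"
    using C[of t] C[of t0] by (simp add: a_def b_def)
  also have "\<dots> > 0" using assms(3) by simp
  finally show ?thesis by (simp add: zero_less_mult_iff)
qed

text \<open>\<open>wright_profile\<close> contains 1 + z > 0, which \<open>sops\<close> does not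
  state: continuity and the sign change force y 0 = 0, and from there positivity of 1 + y spreads by
  \<open>linear_ode_positive\<close>.\<close>

lemma sops_iff:
  "sops \<alpha> L (\<lambda>t. z (t / L)) \<longleftrightarrow> L > 0 \<and> wright_profile \<alpha> (2 * pi / L) z \<and> sign_pattern L z"
proof
  assume s: "sops \<alpha> L (\<lambda>t. z (t / L))"
  define y where "y t = z (t / L)" for t
  from s obtain tm tp where t: "tm > 1" "tp > 1" "L = tm + tp"
    and neg: "\<And>t. - tm < t \<Longrightarrow> t < 0 \<Longrightarrow> y t < 0" and pos: "\<And>t. 0 < t \<Longrightarrow> t < tp \<Longrightarrow> y t > 0"
    and per: "\<And>t. y (t + L) = y t" and sol: "\<And>t. (y has_real_derivative (- \<alpha> * y (t - 1) * (1 + y t))) (at t)"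
    unfolding sops_def wright_solution_def y_def by blast
  have L: "L > 0" using t by simp
  have zy: "z s = y (L * s)" for s using L by (simp add: y_def)
  have cont: "continuous_on X y" for X using sol by (meson DERIV_isCont continuous_at_imp_continuous_on)
  have y0: "y 0 = 0"
  proof (rule antisym)
    have "isCont y 0" using sol DERIV_isCont by blast
    then have l: "(y \<longlongrightarrow> y 0) (at_left 0)" "(y \<longlongrightarrow> y 0) (at_right 0)"
      by (auto simp: isCont_def filterlim_at_split)
    show "y 0 \<le> 0"
      by (rule tendsto_upperbound[OF l(1)])
         (use eventually_at_left_real[of "- tm" 0] t in \<open>auto elim!: eventually_mono intro: less_imp_le neg\<close>)
    show "0 \<le> y 0"
      by (rule tendsto_lowerbound[OF l(2)])
         (use eventually_at_right_real[of 0 tp] t in \<open>auto elim!: eventually_mono intro: less_imp_le pos\<close>)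
  qed
  have "1 + y t > 0" for t
  proof (rule linear_ode_positive[where w = "\<lambda>t. 1 + y t" and g = "\<lambda>t. - \<alpha> * y (t - 1)" and ?t0.0 = 0])
    show "((\<lambda>t. 1 + y t) has_real_derivative - \<alpha> * y (t - 1) * (1 + y t)) (at t)" for t
      using sol[of t] by (auto intro!: derivative_eq_intros)
    show "continuous_on X (\<lambda>t. - \<alpha> * y (t - 1))" for X
      by (intro continuous_intros continuous_on_compose2[OF cont[of UNIV]]) auto
  qed (simp add: y0)
  then have "wright_profile \<alpha> (2 * pi / L) z"
    unfolding wright_profile_def
  proof (intro conjI allI)
    fix s
    show "z (s + 1) = z s" using per[of "L * s"] by (simp add: zy ring_distribs)
    have "((\<lambda>s. y (L * s)) has_real_derivative (- \<alpha> * y (L * s - 1) * (1 + y (L * s))) * L) (at s)"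
      by (rule DERIV_chain2[OF sol]) (auto intro!: derivative_eq_intros)
    moreover have "L * (s - 2 * pi / L / (2 * pi)) = L * s - 1" using L by (simp add: field_simps)
    ultimately show "(z has_real_derivative - \<alpha> * (2 * pi / (2 * pi / L)) * z (s - 2 * pi / L / (2 * pi)) * (1 + z s)) (at s)"
      using L by (simp add: zy[abs_def] mult_ac)
  qed (auto simp: zy)
  moreover have "sign_pattern L z"
    unfolding sign_pattern_def
  proof (intro exI conjI allI impI)
    show "1 / L < tp / L" using L t by (intro divide_strict_right_mono)
    have "tp / L < (L - 1) / L" using L t by (intro divide_strict_right_mono) auto
    then show "tp / L < 1 - 1 / L" using L by (simp add: diff_divide_distrib)
    show "z s < 0" if "tp / L - 1 < s \<and> s < 0" for s
    proof -
      have "- tm < L * s" using that L t by (simp add: field_simps)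
      moreover have "L * s < 0" using that L by (simp add: mult_pos_neg)
      ultimately show ?thesis unfolding zy by (rule neg)
    qed
    show "z s > 0" if "0 < s \<and> s < tp / L" for s
      unfolding zy by (rule pos) (use that L in \<open>auto simp: field_simps\<close>)
  qed
  ultimately show "L > 0 \<and> wright_profile \<alpha> (2 * pi / L) z \<and> sign_pattern L z" using L by blast
next
  assume *: "L > 0 \<and> wright_profile \<alpha> (2 * pi / L) z \<and> sign_pattern L z"
  then have L: "L > 0" and w: "wright_profile \<alpha> (2 * pi / L) z" by auto
  from * obtain q where q: "1 / L < q" "q < 1 - 1 / L" 
    "\<And>s. q - 1 < s \<Longrightarrow> s < 0 \<Longrightarrow> z s < 0" "\<And>s. 0 < s \<Longrightarrow> s < q \<Longrightarrow> z s > 0"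
    unfolding sign_pattern_def by blast
  show "sops \<alpha> L (\<lambda>t. z (t / L))"
    unfolding sops_def wright_solution_def
  proof (rule conjI[OF allI exI[of _ "L * (1 - q)", OF exI[of _ "L * q"]]], goal_cases)
    case (1 t)
    have "(z has_real_derivative (- \<alpha> * L * z (t / L - 1 / L) * (1 + z (t / L)))) (at (t / L))"
      using w L unfolding wright_profile_def by auto
    then have "((\<lambda>t. z (t / L)) has_real_derivative (- \<alpha> * L * z (t / L - 1 / L) * (1 + z (t / L))) * (1 / L)) (at t)"
      by (rule DERIV_chain2) (use L in \<open>auto intro!: derivative_eq_intros\<close>)
    then show ?case
      using L by (simp add: diff_divide_distrib mult.assoc)
  next
    case 2
    show ?case
    proof (intro conjI allI impI)
      show "1 < L * (1 - q)" "1 < L * q" "L = L * (1 - q) + L * q" using q(1,2) L by (simp_all add: field_simps)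
      show "z (t / L) < 0" if "- (L * (1 - q)) < t \<and> t < 0" for t
        by (rule q(3)) (use that L in \<open>auto simp: field_simps divide_neg_pos\<close>)
      show "0 < z (t / L)" if "0 < t \<and> t < L * q" for t
        by (rule q(4)) (use that L in \<open>auto simp: field_simps\<close>)
      fix t
      have "z (t / L + 1) = z (t / L)" using w by (auto simp: wright_profile_def)
      then show "z ((t + L) / L) = z (t / L)" using L by (simp add: add_divide_distrib)
    qed
  qed
qed

lemma sign_pattern_zero:
  fixes z :: "real \<Rightarrow> real"
  assumes c: "continuous_on UNIV z" and q: "0 < q" "q < 1"
    and neg: "\<And>s. q - 1 < s \<Longrightarrow> s < 0 \<Longrightarrow> z s < 0" and pos: "\<And>s. 0 < s \<Longrightarrow> s < q \<Longrightarrow> z s > 0"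
  shows "z 0 = (0::real)"
proof (rule antisym)
  have "isCont z 0" using c by (simp add: continuous_on_eq_continuous_at)
  then have l: "(z \<longlongrightarrow> z 0) (at_left 0)" "(z \<longlongrightarrow> z 0) (at_right 0)"
    by (auto simp: isCont_def filterlim_at_split)
  show "z 0 \<le> 0"
    by (rule tendsto_upperbound[OF l(1)])
       (use eventually_at_left_real[of "q - 1" 0] q in \<open>auto elim!: eventually_mono intro: less_imp_le neg\<close>)
  show "0 \<le> z 0"
    by (rule tendsto_lowerbound[OF l(2)])
       (use eventually_at_right_real[of 0 q] q in \<open>auto elim!: eventually_mono intro: less_imp_le pos\<close>)
qed

section \<open>Small solutions near the Hopf point\<close>

text \<open>Multiplier of the part of \<open>F_map\<close> that is linear in c and diagonal in the
  modes.\<close>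

definition symb :: "real \<Rightarrow> real \<Rightarrow> nat \<Rightarrow> complex" where
  "symb \<alpha> \<omega> k = \<i> * of_real (real k * \<omega>) + of_real \<alpha> * cis (- (real k * \<omega>))"

lemma symb_lower: "0 \<le> \<alpha> \<Longrightarrow> real k * \<omega> - \<alpha> \<le> cmod (symb \<alpha> \<omega> k)"
  using norm_diff_ineq[of "\<i> * of_real (real k * \<omega>)" "of_real \<alpha> * cis (- (real k * \<omega>))"]
  unfolding symb_def norm_mult norm_of_real norm_cis norm_ii by simp

lemma L_op_expand:
  "0 < k \<Longrightarrow> L_op \<omega> c k = (cis (- \<omega>) + cis (- (real (k - 1) * \<omega>))) * c (k - 1)
     + (cis \<omega> + cis (- (real (k + 1) * \<omega>))) * c (k + 1)"
  by (simp add: L_op_def shift_plus_def shift_minus_def U_op_cis ring_distribs cis_conv_exp)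

lemma L_op_bound: "0 < k \<Longrightarrow> cmod (L_op \<omega> c k) \<le> 2 * cmod (c (k - 1)) + 2 * cmod (c (k + 1))"
proof -
  have "cmod (cis x + cis y) \<le> 2" for x y using norm_triangle_ineq[of "cis x" "cis y"] by simp
  then show "0 < k \<Longrightarrow> ?thesis" unfolding L_op_expand
    by (intro order_trans[OF norm_triangle_ineq] add_mono) (simp_all only: norm_mult mult_right_mono norm_ge_zero)
qed

lemma F_map_expand:
  "F_map \<epsilon> \<alpha> \<omega> c k = (\<i> * of_real \<omega> + of_real \<alpha> * cis (- \<omega>)) * unit_seq 1 k + symb \<alpha> \<omega> k * c k
     + of_real \<epsilon> * of_real \<alpha> * cis (- \<omega>) * unit_seq 2 k + of_real \<alpha> * of_real \<epsilon> * L_op \<omega> c k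
     + of_real \<alpha> * of_real \<epsilon> * conv (U_op \<omega> c) c k"
  by (simp add: F_map_def symb_def K_inv_def U_op_cis cis_conv_exp ring_distribs mult_ac)

text \<open>One-sided, without the factor 2: \<open>l1_norm a\<close> is twice
  \<open>tail a 0\<close>.\<close>

definition tail :: "cseq \<Rightarrow> nat \<Rightarrow> real" where
  "tail a n = (\<Sum>k. cmod (a (k + n)))"

lemma tail_summable: "a \<in> l1 \<Longrightarrow> summable (\<lambda>k. cmod (a (k + n)))"
  using summable_iff_shift[of "\<lambda>k. cmod (a k)" n] by (simp add: l1_def)

lemma tail_Suc: "a \<in> l1 \<Longrightarrow> tail a n = cmod (a n) + tail a (Suc n)"
  unfolding tail_def using suminf_split_head[OF tail_summable, of a n] by simp

lemma tail_nonneg: "a \<in> l1 \<Longrightarrow> 0 \<le> tail a n"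
  unfolding tail_def by (rule suminf_nonneg[OF tail_summable]) auto

lemma tail_antimono: assumes "a \<in> l1" "m \<le> n" shows "tail a n \<le> tail a m"
  using assms(2)
proof (induction rule: dec_induct)
  case (step k)
  then show ?case using tail_Suc[OF assms(1), of k] norm_ge_zero[of "a k"] by linarith
qed simp

lemma l1_norm_tail: "l1_norm a = 2 * tail a 0"
  by (simp add: l1_norm_def tail_def)

lemma cmod_le_tail: "a \<in> l1 \<Longrightarrow> cmod (a n) \<le> tail a n"
  using tail_Suc[of a n] tail_nonneg[of a "Suc n"] by simp

lemma tail_mono:
  assumes "b \<in> l1" "a \<in> l1" "\<And>k. n \<le> k \<Longrightarrow> cmod (a k) \<le> cmod (b k)" shows "tail a n \<le> tail b n"
  unfolding tail_def by (rule suminf_le[OF _ tail_summable tail_summable]) (use assms in auto)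

lemma conv_tail: assumes "a \<in> l1" "b \<in> l1" shows "tail (conv a b) n \<le> 2 * tail a 0 * tail b 0"
proof -
  have c: "conv a b \<in> l1" by (rule conv_summable[OF assms])
  have "tail (conv a b) n \<le> tail (conv a b) 0" using tail_antimono[OF c] by simp
  also have "\<dots> = tail (conv a b) 1" using tail_Suc[OF c, of 0] c by (simp add: l1_def)
  also have "\<dots> \<le> l1_norm a * l1_norm b / 2"
    unfolding tail_def
  proof (rule suminf_le_const[OF tail_summable[OF c]])
    fix n show "(\<Sum>i<n. cmod (conv a b (i + 1))) \<le> l1_norm a * l1_norm b / 2"
      using conv_norm[OF assms, of n] by (simp add: sum.atLeast1_atMost_eq)
  qed
  finally show ?thesis by (simp add: l1_norm_tail)
qed

lemma tail_U_op [simp]: "tail (U_op \<omega> a) n = tail a n"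
  by (simp add: tail_def)

text \<open>On modes k \<ge> m the symbol has modulus at least m \<omega> - \<alpha>, and m \<ge> 3
  keeps clear of the inhomogeneous terms at modes 1 and 2. What remains carries a factor \<epsilon>,
  so each application gains one order in \<epsilon> over the tail that starts one mode
  earlier.\<close>

lemma F_zero_tail:
  assumes c: "c \<in> l1" and F: "\<And>k. F_map \<epsilon> \<alpha> \<omega> c k = 0" and pos: "0 \<le> \<alpha>" "0 \<le> \<epsilon>" "0 \<le> \<omega>"
    and m: "3 \<le> m" and d: "0 \<le> d" "d \<le> real m * \<omega> - \<alpha>"
  shows "d * tail c m \<le> \<alpha> * \<epsilon> * (4 * tail c (m - 1) + 2 * (tail c 0)\<^sup>2)"
proof -
  let ?q = "conv (U_op \<omega> c) c"
  have q: "?q \<in> l1" using c by (intro conv_summable) auto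
  have le: "d * cmod (c (k + m)) \<le> \<alpha> * \<epsilon> * (2 * cmod (c (k + (m - 1))) + 2 * cmod (c (k + (m + 1))) + cmod (?q (k + m)))" for k
  proof -
    let ?k = "k + m"
    have "symb \<alpha> \<omega> ?k * c ?k + of_real (\<alpha> * \<epsilon>) * (L_op \<omega> c ?k + ?q ?k) = 0"
      using F[of ?k] m unfolding F_map_expand by (simp add: unit_seq_def ring_distribs add.assoc)
    then have "symb \<alpha> \<omega> ?k * c ?k = - (of_real (\<alpha> * \<epsilon>) * (L_op \<omega> c ?k + ?q ?k))"
      by (simp only: eq_neg_iff_add_eq_0)
    then have "cmod (symb \<alpha> \<omega> ?k) * cmod (c ?k) = \<alpha> * \<epsilon> * cmod (L_op \<omega> c ?k + ?q ?k)"
      unfolding norm_mult[symmetric] using pos by (simp only: norm_minus_cancel) (simp add: norm_mult)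
    also have "\<dots> \<le> \<alpha> * \<epsilon> * ((2 * cmod (c (?k - 1)) + 2 * cmod (c (?k + 1))) + cmod (?q ?k))"
      using m pos by (intro mult_left_mono order_trans[OF norm_triangle_ineq] add_mono L_op_bound) auto
    also have "?k - 1 = k + (m - 1)" using m by simp
    finally have *: "cmod (symb \<alpha> \<omega> ?k) * cmod (c ?k) \<le> \<alpha> * \<epsilon> * (2 * cmod (c (k + (m - 1))) + 2 * cmod (c (k + (m + 1))) + cmod (?q (k + m)))"
      by (simp add: add.assoc)
    have "real m * \<omega> \<le> real ?k * \<omega>" using pos by (intro mult_right_mono) auto
    then have "d \<le> cmod (symb \<alpha> \<omega> ?k)" using d symb_lower[OF pos(1), of ?k \<omega>] by linarith
    then show ?thesis using * by (meson mult_right_mono norm_ge_zero order_trans)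
  qed
  note sm = tail_summable[OF c] tail_summable[OF q]
  have "d * tail c m = (\<Sum>k. d * cmod (c (k + m)))" unfolding tail_def by (rule suminf_mult[symmetric, OF sm(1)])
  also have "\<dots> \<le> (\<Sum>k. \<alpha> * \<epsilon> * (2 * cmod (c (k + (m - 1))) + 2 * cmod (c (k + (m + 1))) + cmod (?q (k + m))))"
    by (intro suminf_le le summable_mult summable_add sm)
  also have "\<dots> = \<alpha> * \<epsilon> * (2 * tail c (m - 1) + 2 * tail c (m + 1) + tail ?q m)"
    unfolding tail_def using sm by (simp only: suminf_mult summable_mult summable_add suminf_add[symmetric])
  also have "\<dots> \<le> \<alpha> * \<epsilon> * (4 * tail c (m - 1) + 2 * (tail c 0)\<^sup>2)"
    using pos tail_antimono[OF c, of "m - 1" "m + 1", OF order_trans[OF diff_le_self le_add1]] conv_tail[of "U_op \<omega> c" c m] c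
    by (intro mult_left_mono) (auto simp: power2_eq_square)
  finally show ?thesis .
qed

text \<open>Let e = |a_1| and R the weighted tail from mode 2. The modes k \<ge> 2 are not resonant,
  so R is bounded by a multiple of (e + R)^2; smallness of e + R makes this yield R \<le> e, and
  inserting that gives a bound quadratic in e.\<close>

lemma hopf_apriori:
  assumes a: "a 0 = 0" "K_inv a \<in> l1" and G: "\<And>k. G_map \<alpha> \<omega> a k = 0"
    and r: "\<bar>\<alpha> - pi / 2\<bar> \<le> 0.1" "\<bar>\<omega> - pi / 2\<bar> \<le> 0.1" and small: "tail (K_inv a) 0 \<le> 0.08"
  shows "tail (K_inv a) 2 \<le> 24 * (cmod (a 1))\<^sup>2"
proof -
  have pi: "3.14 < pi" "pi < 3.15" using pi_approx by simp_all
  have r': "1.47 \<le> \<omega>" "0 \<le> \<alpha>" "\<alpha> \<le> 1.68" 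
    using abs_le_D1[OF r(1)] abs_le_D2[OF r(1)] abs_le_D2[OF r(2)] pi by simp_all
  have al: "a \<in> l1" using K_inv_l1[OF a] .
  let ?q = "conv (U_op \<omega> a) a" and ?R = "tail (K_inv a) 2" and ?e = "cmod (a 1)"
  have q: "?q \<in> l1" using al by (intro conv_summable) auto
  have le: "0.6 * cmod (K_inv a (k + 2)) \<le> 1.68 * cmod (?q (k + 2))" for k
  proof -
    let ?k = "k + 2"
    have "G_map \<alpha> \<omega> a ?k = symb \<alpha> \<omega> ?k * a ?k + of_real \<alpha> * ?q ?k"
      by (simp add: G_map_def symb_def K_inv_def U_op_cis ring_distribs mult_ac)
    then have "symb \<alpha> \<omega> ?k * a ?k = - (of_real \<alpha> * ?q ?k)" using G[of ?k] by (simp add: eq_neg_iff_add_eq_0)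
    then have e: "cmod (symb \<alpha> \<omega> ?k) * cmod (a ?k) = \<alpha> * cmod (?q ?k)"
      unfolding norm_mult[symmetric] using r' by (simp only: norm_minus_cancel) (simp add: norm_mult)
    have "real ?k * 1.47 \<le> real ?k * \<omega>" using r' by (intro mult_left_mono) auto
    \<comment> \<open>At k = 2 this is 2.94 - 1.68 = 1.26 \<ge> 1.2, and the slope 1.47 exceeds 0.6
      for larger k.\<close>
    then have "0.6 * real ?k \<le> cmod (symb \<alpha> \<omega> ?k)" using symb_lower[OF r'(2), of ?k \<omega>] r' by simp
    then have "0.6 * real ?k * cmod (a ?k) \<le> cmod (symb \<alpha> \<omega> ?k) * cmod (a ?k)"
      by (intro mult_right_mono) auto
    also have "\<dots> \<le> 1.68 * cmod (?q ?k)" unfolding e using r' by (intro mult_right_mono) auto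
    finally show ?thesis by (simp only: K_inv_def norm_mult norm_of_nat mult.assoc)
  qed
  have "0.6 * ?R \<le> 1.68 * tail ?q 2"
    unfolding tail_def suminf_mult[symmetric, OF tail_summable[OF a(2)]] suminf_mult[symmetric, OF tail_summable[OF q]]
    by (intro suminf_le le summable_mult tail_summable a q)
  also have "\<dots> \<le> 1.68 * (2 * (tail a 0 * tail a 0))" using conv_tail[of "U_op \<omega> a" a 2] al by simp
  also have "tail a 0 \<le> ?e + ?R"
  proof -
    have "cmod (a k) \<le> cmod (K_inv a k)" for k
      using a(1) mult_right_mono[of 1 "real k" "cmod (a k)"]
      by (cases k) (auto simp: K_inv_def norm_mult simp del: of_nat_Suc)
    then have "tail a 2 \<le> ?R" by (intro tail_mono al a)
    then show ?thesis using tail_Suc[OF al, of 0] tail_Suc[OF al, of 1] a by (simp add: numeral_2_eq_2)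
  qed
  then have "tail a 0 * tail a 0 \<le> (?e + ?R) * (?e + ?R)"
    using tail_nonneg[OF al] tail_nonneg[OF a(2)] by (intro mult_mono) auto
  finally have 1: "0.6 * ?R \<le> 1.68 * (2 * ((?e + ?R) * (?e + ?R)))" by simp
  have R0: "0 \<le> ?R" using tail_nonneg[OF a(2)] .
  have "tail (K_inv a) 0 = ?e + ?R"
    using tail_Suc[OF a(2), of 0] tail_Suc[OF a(2), of 1] a by (simp add: K_inv_def numeral_2_eq_2)
  then have "(?e + ?R) * (?e + ?R) \<le> 0.08 * (?e + ?R)" using small R0 by (intro mult_right_mono) auto
  then have "25 * ((?e + ?R) * (?e + ?R)) \<le> 2 * (?e + ?R)" by simp
  moreover have "5 * ?R \<le> 28 * ((?e + ?R) * (?e + ?R))" using 1 by simp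
  \<comment> \<open>Since 5 R \<le> 28 * 0.08 (e + R) = 2.24 (e + R).\<close>
  moreover have "R \<le> e" if "25 * X \<le> 2 * (e + R)" "5 * R \<le> 28 * X" "0 \<le> e" for X e R :: real
    using that by argo
  ultimately have "?R \<le> ?e" using norm_ge_zero[of "a 1"] by blast
  then have "(?e + ?R) * (?e + ?R) \<le> (2 * ?e) * (2 * ?e)" using R0 by (intro mult_mono) auto
  then have "(?e + ?R) * (?e + ?R) \<le> 4 * ?e\<^sup>2" by (simp add: power2_eq_square)
  moreover have "5 * ?R \<le> 28 * ((?e + ?R) * (?e + ?R))" using 1 by simp
  moreover have "R \<le> 24 * Y" if "X \<le> 4 * Y" "5 * R \<le> 28 * X" "0 \<le> Y" for X Y R :: real
    using that by argo
  ultimately show ?thesis using zero_le_power2 by blast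
qed

lemma tendsto_cis_seq [tendsto_intros]: "(f \<longlongrightarrow> l) F \<Longrightarrow> ((\<lambda>x. cis (f x)) \<longlongrightarrow> cis l) F"
  unfolding cis_conv_exp by (intro tendsto_intros)

lemma sin_near:
  fixes x :: real
  shows "\<bar>x\<bar> \<le> 1 \<Longrightarrow> \<bar>x - sin x\<bar> \<le> \<bar>x\<bar> ^ 3" "\<bar>x\<bar> \<le> 1 \<Longrightarrow> \<bar>x\<bar> \<le> 2 * \<bar>sin x\<bar>"
proof -
  have "\<bar>sin x - (\<Sum>m<3. sin_coeff m * x ^ m)\<bar> \<le> inverse (fact 3) * \<bar>x\<bar> ^ 3"
    by (rule Maclaurin_sin_bound)
  also have "(\<Sum>m<3. sin_coeff m * x ^ m) = x" by (simp add: numeral_3_eq_3 sin_coeff_def)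
  finally have *: "\<bar>x - sin x\<bar> \<le> \<bar>x\<bar> ^ 3 / 6" by (simp add: abs_minus_commute fact_numeral)
  then show "\<bar>x - sin x\<bar> \<le> \<bar>x\<bar> ^ 3" using zero_le_power_abs[of x 3] by linarith
  assume "\<bar>x\<bar> \<le> 1"
  then have "\<bar>x\<bar> ^ 3 \<le> \<bar>x\<bar> ^ 1" by (intro power_decreasing) auto
  moreover have "\<bar>x\<bar> \<le> \<bar>sin x\<bar> + \<bar>x - sin x\<bar>" by linarith
  ultimately show "\<bar>x\<bar> \<le> 2 * \<bar>sin x\<bar>" using * abs_ge_zero[of "sin x"] unfolding power_one_right by argo
qed

text \<open>If \<alpha> and \<omega> approach their limits faster than \<epsilon> tends to 0, so do
  the coefficients \<alpha> e^(im\<omega>); the second-order expansion of c_2 rests on this.\<close>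

lemma tendsto_cis_quotient:
  assumes "(\<lambda>n. (\<alpha> n - \<alpha>0) / \<epsilon> n) \<longlonglongrightarrow> 0" "(\<lambda>n. (\<omega> n - \<omega>0) / \<epsilon> n) \<longlonglongrightarrow> 0"
  shows "(\<lambda>n. (of_real (\<alpha> n) * cis (m * \<omega> n) - of_real \<alpha>0 * cis (m * \<omega>0)) / of_real (\<epsilon> n)) \<longlonglongrightarrow> 0"
proof -
  have 1: "(\<lambda>n. complex_of_real ((\<alpha> n - \<alpha>0) / \<epsilon> n) * cis (m * \<omega> n)) \<longlonglongrightarrow> 0"
    by (rule tendsto_norm_zero_cancel) (use tendsto_rabs[OF assms(1)] in \<open>simp add: norm_mult norm_divide flip: of_real_diff\<close>)
  have 2: "(\<lambda>n. of_real \<alpha>0 * ((cis (m * \<omega> n) - cis (m * \<omega>0)) / of_real (\<epsilon> n))) \<longlonglongrightarrow> 0"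
  proof (rule tendsto_mult_right_zero, rule Lim_null_comparison)
    show "(\<lambda>n. \<bar>m\<bar> * \<bar>(\<omega> n - \<omega>0) / \<epsilon> n\<bar>) \<longlonglongrightarrow> 0"
      by (rule tendsto_mult_right_zero) (use tendsto_rabs[OF assms(2)] in simp)
    show "\<forall>\<^sub>F n in sequentially. norm ((cis (m * \<omega> n) - cis (m * \<omega>0)) / of_real (\<epsilon> n)) \<le> \<bar>m\<bar> * \<bar>(\<omega> n - \<omega>0) / \<epsilon> n\<bar>"
    proof (intro always_eventually allI)
      fix n
      have "cmod (cis (m * \<omega> n) - cis (m * \<omega>0)) \<le> \<bar>m\<bar> * \<bar>\<omega> n - \<omega>0\<bar>"
        using cis_lipschitz[of "m * \<omega> n" "m * \<omega>0"] by (simp add: abs_mult flip: right_diff_distrib)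
      then show "norm ((cis (m * \<omega> n) - cis (m * \<omega>0)) / of_real (\<epsilon> n)) \<le> \<bar>m\<bar> * \<bar>(\<omega> n - \<omega>0) / \<epsilon> n\<bar>"
        by (simp add: norm_divide divide_right_mono)
    qed
  qed
  from tendsto_add[OF 1 2] show ?thesis
    by (simp add: ring_distribs diff_divide_distrib)
qed

lemma L_op_123:
  "L_op \<omega> c 1 = (cis (- \<omega>) + 1) * c 0 + (cis \<omega> + cis (- (2 * \<omega>))) * c 2"
  "L_op \<omega> c 2 = (cis (- \<omega>) + cis (- \<omega>)) * c 1 + (cis \<omega> + cis (- (3 * \<omega>))) * c 3"
  "L_op \<omega> c 3 = (cis (- \<omega>) + cis (- (2 * \<omega>))) * c 2 + (cis \<omega> + cis (- (4 * \<omega>))) * c 4"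
proof -
  have *: "(1::nat) + 1 = 2" "(2::nat) + 1 = 3" "(3::nat) + 1 = 4" "(1::nat) - 1 = 0" "(2::nat) - 1 = 1" "(3::nat) - 1 = 2"
    by simp_all
  show "L_op \<omega> c 1 = (cis (- \<omega>) + 1) * c 0 + (cis \<omega> + cis (- (2 * \<omega>))) * c 2"
    using L_op_expand[of 1 \<omega> c] unfolding * by simp
  show "L_op \<omega> c 2 = (cis (- \<omega>) + cis (- \<omega>)) * c 1 + (cis \<omega> + cis (- (3 * \<omega>))) * c 3"
    using L_op_expand[of 2 \<omega> c] unfolding * by simp
  show "L_op \<omega> c 3 = (cis (- \<omega>) + cis (- (2 * \<omega>))) * c 2 + (cis \<omega> + cis (- (4 * \<omega>))) * c 4"
    using L_op_expand[of 3 \<omega> c] unfolding * by simp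
qed

text \<open>A bifurcation expansion along a sequence: modes 2, 3 and 1 yield the limits of c_2 /
  \<epsilon>, of c_3 / \<epsilon>^2 and of the first-mode symbol over \<epsilon>^2, which are the
  coefficients in \<open>alpha_bar\<close>, \<open>omega_bar\<close> and \<open>c_bar\<close>. The
  errors divided by \<epsilon>^2 therefore tend to 0 for \<alpha> and \<omega>, and for c to twice
  the limit of |c_3| / \<epsilon>^2, which is below 0.32; all of these lie strictly inside the
  window.\<close>

lemma hopf_local_zero:
  fixes \<epsilon> \<alpha> \<omega> :: "nat \<Rightarrow> real" and c :: "nat \<Rightarrow> cseq"
  assumes lK: "\<And>n. c n \<in> lK_0" and F: "\<And>n k. F_map (\<epsilon> n) (\<alpha> n) (\<omega> n) (c n) k = 0"
    and pos: "\<And>n. 0 < \<epsilon> n" and \<epsilon>: "\<epsilon> \<longlonglongrightarrow> 0" and \<alpha>: "\<alpha> \<longlonglongrightarrow> pi / 2" and \<omega>: "\<omega> \<longlonglongrightarrow> pi / 2"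
    and small: "\<And>n. l1_norm (K_inv (c n)) \<le> 48 * \<epsilon> n"
  shows "\<forall>\<^sub>F n in sequentially. is_local_zero (\<epsilon> n) (\<alpha> n) (\<omega> n) (c n)"
proof -
  define \<kappa> :: complex where "\<kappa> = (2 - \<i>) / 5"
  let ?q = "\<lambda>n. conv (U_op (\<omega> n) (c n)) (c n)"
  have cl: "c n \<in> l1" "c n 0 = 0" "c n 1 = 0" "K_inv (c n) \<in> l1" for n
    using lK[of n] by (auto simp: lK_0_def l1_0_def l1_def)
  have N: "tail (c n) 0 \<le> 24 * \<epsilon> n" for n
  proof -
    have "cmod (c n k) \<le> cmod (K_inv (c n) k)" for k
      using cl(2)[of n] mult_right_mono[of 1 "real k" "cmod (c n k)"]
      by (cases k) (auto simp: K_inv_def norm_mult simp del: of_nat_Suc)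
    then have "tail (c n) 0 \<le> tail (K_inv (c n)) 0" by (intro tail_mono cl)
    then show ?thesis using small[of n] by (simp add: l1_norm_tail)
  qed
  have q: "cmod (?q n k) \<le> 1152 * (\<epsilon> n)\<^sup>2" for n k
  proof -
    have ql: "?q n \<in> l1" using cl by (intro conv_summable) auto
    have "cmod (?q n k) \<le> 2 * (tail (c n) 0 * tail (c n) 0)"
      using cmod_le_tail[OF ql, of k] conv_tail[of "U_op (\<omega> n) (c n)" "c n" k] cl by simp
    also have "\<dots> \<le> 2 * ((24 * \<epsilon> n) * (24 * \<epsilon> n))"
      using N[of n] tail_nonneg[OF cl(1), of n 0] by (intro mult_left_mono mult_mono) auto
    finally show ?thesis by (simp add: power2_eq_square)
  qed
  have ev: "\<forall>\<^sub>F n in sequentially. \<epsilon> n < 1 \<and> \<alpha> n < 1.68 \<and> 0 < \<alpha> n \<and> 1.47 < \<omega> n"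
  proof -
    have pi: "3.14 < pi" "pi < 3.15" using pi_approx by simp_all
    show ?thesis
      by (intro eventually_conj order_tendstoD[OF \<epsilon>] order_tendstoD[OF \<alpha>] order_tendstoD[OF \<omega>]) (use pi in auto)
  qed
  \<comment> \<open>2.7 < 3 * 1.47 - 1.68, and 4 * 24 + 2 * 24^2 = 1248 gives 1.68 * 1248 / 2.7 <
    800; the second tail repeats this with 4 * 800 + 2 * 24^2 = 4352.\<close>
  have T: "\<forall>\<^sub>F n in sequentially. tail (c n) 3 \<le> 800 * (\<epsilon> n)\<^sup>2 \<and> tail (c n) 4 \<le> 2800 * (\<epsilon> n)^3"
    using ev
  proof eventually_elim
    case (elim n)
    have e2: "(\<epsilon> n)\<^sup>2 \<le> \<epsilon> n" using elim pos[of n] by (simp add: power2_eq_square)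
    have N2: "(tail (c n) 0)\<^sup>2 \<le> 576 * (\<epsilon> n)\<^sup>2"
      using power_mono[OF N[of n] tail_nonneg[OF cl(1)], of 2] by (simp add: power_mult_distrib)
    have t2: "tail (c n) 2 \<le> 24 * \<epsilon> n" using tail_antimono[OF cl(1), of 0 2] N[of n] by (rule order_trans) simp
    have "2.7 * tail (c n) 3 \<le> \<alpha> n * \<epsilon> n * (4 * tail (c n) (3 - 1) + 2 * (tail (c n) 0)\<^sup>2)"
      by (rule F_zero_tail[OF cl(1) F]) (use elim pos[of n] in auto)
    also have "\<dots> \<le> 1.68 * \<epsilon> n * (4 * tail (c n) (3 - 1) + 2 * (tail (c n) 0)\<^sup>2)"
      using elim pos[of n] tail_nonneg[OF cl(1)] by (intro mult_right_mono) (auto simp: less_imp_le)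
    also have "\<dots> \<le> 1.68 * \<epsilon> n * (1248 * \<epsilon> n)"
      using t2 N2 e2 pos[of n] by (intro mult_left_mono) auto
    finally have 3: "tail (c n) 3 \<le> 800 * (\<epsilon> n)\<^sup>2"
      by (simp add: power2_eq_square) (use mult_pos_pos[OF pos[of n] pos[of n]] in linarith)
    have "2.7 * tail (c n) 4 \<le> \<alpha> n * \<epsilon> n * (4 * tail (c n) (4 - 1) + 2 * (tail (c n) 0)\<^sup>2)"
      by (rule F_zero_tail[OF cl(1) F]) (use elim pos[of n] in auto)
    also have "\<dots> \<le> 1.68 * \<epsilon> n * (4 * tail (c n) (4 - 1) + 2 * (tail (c n) 0)\<^sup>2)"
      using elim pos[of n] tail_nonneg[OF cl(1)] by (intro mult_right_mono) (auto simp: less_imp_le)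
    also have "\<dots> \<le> 1.68 * \<epsilon> n * (4352 * (\<epsilon> n)\<^sup>2)"
      using 3 N2 pos[of n] by (intro mult_left_mono) auto
    finally have "tail (c n) 4 \<le> 2800 * (\<epsilon> n)^3"
      by (simp add: power2_eq_square power3_eq_cube)
         (use mult_pos_pos[OF mult_pos_pos[OF pos[of n] pos[of n]] pos[of n]] in linarith)
    then show ?case using 3 by blast
  qed
  have bnd: "(\<lambda>n. f n / of_real (\<epsilon> n ^ p)) \<longlonglongrightarrow> 0"
    if "\<forall>\<^sub>F n in sequentially. norm (f n) \<le> C * \<epsilon> n ^ Suc p" for f :: "nat \<Rightarrow> complex" and C p
  proof (rule Lim_null_comparison)
    show "(\<lambda>n. C * \<epsilon> n) \<longlonglongrightarrow> 0" using tendsto_mult_right_zero[OF \<epsilon>] .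
    show "\<forall>\<^sub>F n in sequentially. norm (f n / of_real (\<epsilon> n ^ p)) \<le> C * \<epsilon> n"
      using that
    proof eventually_elim
      case (elim n)
      then show ?case using pos[of n] by (simp add: norm_divide norm_power divide_simps mult_ac)
    qed
  qed
  have c3: "(\<lambda>n. c n 3 / of_real (\<epsilon> n ^ 1)) \<longlonglongrightarrow> 0"
    by (rule bnd[of _ 800], use T in eventually_elim)
       (use cmod_le_tail[OF cl(1), of _ 3] in \<open>auto simp: numeral_2_eq_2 intro: order_trans\<close>)
  have c4: "(\<lambda>n. c n 4 / of_real (\<epsilon> n ^ 1)) \<longlonglongrightarrow> 0"
  proof (rule bnd[of _ 2800], use T ev in eventually_elim)
    case (elim n)
    have "cmod (c n 4) \<le> 2800 * \<epsilon> n ^ 3" using cmod_le_tail[OF cl(1), of n 4] elim by linarith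
    also have "\<dots> \<le> 2800 * \<epsilon> n ^ Suc 1"
      using pos[of n] elim by (intro mult_left_mono power_decreasing) auto
    finally show ?case .
  qed
  have qq: "(\<lambda>n. ?q n k / of_real (\<epsilon> n ^ 1)) \<longlonglongrightarrow> 0" for k
    by (rule bnd[of _ 1152]) (use q in \<open>simp add: numeral_2_eq_2\<close>)
  have symb: "(\<lambda>n. symb (\<alpha> n) (\<omega> n) k) \<longlonglongrightarrow> symb (pi / 2) (pi / 2) k" for k
    unfolding symb_def by (intro tendsto_intros \<alpha> \<omega>)
  have c1: "cis (- (pi / 2)) = - \<i>" "cis (- (2 * (pi / 2))) = - 1" "cis (- (3 * (pi / 2))) = \<i>" "cis (pi / 2) = \<i>"
  proof -
    show "cis (- (pi / 2)) = - \<i>" "cis (- (2 * (pi / 2))) = - 1" "cis (pi / 2) = \<i>" by (simp_all add: complex_eq_iff)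
    have "cis (- (3 * (pi / 2))) = cis (- (2 * (pi / 2))) * cis (- (pi / 2))"
      unfolding cis_mult by (rule arg_cong[of _ _ cis]) simp
    moreover have "cis (- (2 * (pi / 2))) = - 1" "cis (- (pi / 2)) = - \<i>" by (simp_all add: complex_eq_iff)
    ultimately show "cis (- (3 * (pi / 2))) = \<i>" by simp
  qed
  have s2: "symb (pi / 2) (pi / 2) 2 = of_real (pi / 2) * (2 * \<i> - 1)"
    and s3: "symb (pi / 2) (pi / 2) 3 = 2 * pi * \<i>"
    unfolding symb_def using c1 by (simp_all add: algebra_simps)
  \<comment> \<open>\<kappa> solves mode two at leading order: the symbol at the Hopf point is (pi /
    2) (2 i - 1) and the forcing is (pi / 2) i.\<close>
  have \<kappa>i: "\<kappa> * (2 * \<i> - 1) = \<i>" by (simp add: \<kappa>_def complex_eq_iff)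
  have nz2: "symb (pi / 2) (pi / 2) 2 \<noteq> 0" unfolding s2 by (simp add: complex_eq_iff)
  have nz3: "symb (pi / 2) (pi / 2) 3 \<noteq> 0" unfolding s3 by simp
  have e2: "symb (\<alpha> n) (\<omega> n) 2 * (c n 2 / of_real (\<epsilon> n))
     = - of_real (\<alpha> n) * cis (- \<omega> n) - of_real (\<alpha> n) * ((cis (\<omega> n) + cis (- (3 * \<omega> n))) * c n 3) - of_real (\<alpha> n) * ?q n 2" for n
    using F[of n 2] pos[of n] cl(3)[of n] unfolding F_map_expand L_op_123
    by (simp add: unit_seq_def field_simps eq_neg_iff_add_eq_0)
  have e3: "symb (\<alpha> n) (\<omega> n) 3 * (c n 3 / of_real (\<epsilon> n ^ 2))
     = - of_real (\<alpha> n) * ((cis (- \<omega> n) + cis (- (2 * \<omega> n))) * (c n 2 / of_real (\<epsilon> n)))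
       - of_real (\<alpha> n) * ((cis (\<omega> n) + cis (- (4 * \<omega> n))) * (c n 4 / of_real (\<epsilon> n ^ 1))) - of_real (\<alpha> n) * (?q n 3 / of_real (\<epsilon> n ^ 1))" for n
  proof -
    have "symb (\<alpha> n) (\<omega> n) 3 * c n 3 = of_real (\<epsilon> n) * (- of_real (\<alpha> n) * ((cis (- \<omega> n) + cis (- (2 * \<omega> n))) * c n 2)
       - of_real (\<alpha> n) * ((cis (\<omega> n) + cis (- (4 * \<omega> n))) * c n 4) - of_real (\<alpha> n) * ?q n 3)"
      using F[of n 3] unfolding F_map_expand L_op_123
      by (simp add: unit_seq_def algebra_simps eq_neg_iff_add_eq_0)
    then have "symb (\<alpha> n) (\<omega> n) 3 * c n 3 / of_real (\<epsilon> n) = - of_real (\<alpha> n) * ((cis (- \<omega> n) + cis (- (2 * \<omega> n))) * c n 2)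
       - of_real (\<alpha> n) * ((cis (\<omega> n) + cis (- (4 * \<omega> n))) * c n 4) - of_real (\<alpha> n) * ?q n 3"
      using pos[of n] by simp
    then have "symb (\<alpha> n) (\<omega> n) 3 * c n 3 / of_real (\<epsilon> n) / of_real (\<epsilon> n) = (- of_real (\<alpha> n) * ((cis (- \<omega> n) + cis (- (2 * \<omega> n))) * c n 2)
       - of_real (\<alpha> n) * ((cis (\<omega> n) + cis (- (4 * \<omega> n))) * c n 4) - of_real (\<alpha> n) * ?q n 3) / of_real (\<epsilon> n)"
      by simp
    then show ?thesis by (simp add: diff_divide_distrib power2_eq_square)
  qed
  have e1: "(\<i> * of_real (\<omega> n) + of_real (\<alpha> n) * cis (- \<omega> n)) / of_real (\<epsilon> n ^ 2)
     = - of_real (\<alpha> n) * ((cis (\<omega> n) + cis (- (2 * \<omega> n))) * (c n 2 / of_real (\<epsilon> n))) - of_real (\<alpha> n) * (?q n 1 / of_real (\<epsilon> n ^ 1))" for n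
  proof -
    have "\<i> * of_real (\<omega> n) + of_real (\<alpha> n) * cis (- \<omega> n) = of_real (\<epsilon> n) *
       (- of_real (\<alpha> n) * ((cis (\<omega> n) + cis (- (2 * \<omega> n))) * c n 2) - of_real (\<alpha> n) * ?q n 1)"
      using F[of n 1] cl(2,3)[of n] unfolding F_map_expand L_op_123
      by (simp add: unit_seq_def algebra_simps eq_neg_iff_add_eq_0)
    then have "(\<i> * of_real (\<omega> n) + of_real (\<alpha> n) * cis (- \<omega> n)) / of_real (\<epsilon> n) =
       - of_real (\<alpha> n) * ((cis (\<omega> n) + cis (- (2 * \<omega> n))) * c n 2) - of_real (\<alpha> n) * ?q n 1"
      using pos[of n] by simp
    then have "(\<i> * of_real (\<omega> n) + of_real (\<alpha> n) * cis (- \<omega> n)) / of_real (\<epsilon> n) / of_real (\<epsilon> n) =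
       (- of_real (\<alpha> n) * ((cis (\<omega> n) + cis (- (2 * \<omega> n))) * c n 2) - of_real (\<alpha> n) * ?q n 1) / of_real (\<epsilon> n)"
      by (simp only:)
    then show ?thesis by (simp add: diff_divide_distrib power2_eq_square)
  qed
  have to0: "f \<longlonglongrightarrow> 0" if "(\<lambda>n. f n / of_real (\<epsilon> n ^ 1)) \<longlonglongrightarrow> 0" for f :: "nat \<Rightarrow> complex"
    using tendsto_mult[OF that tendsto_of_real[OF \<epsilon>]] pos by (simp add: less_imp_neq[THEN not_sym])
  have quot: "x \<longlonglongrightarrow> L / S" if "(\<lambda>n. s n * x n) \<longlonglongrightarrow> L" "s \<longlonglongrightarrow> S" "S \<noteq> 0" for x s :: "nat \<Rightarrow> complex" and L S
  proof (rule Lim_transform_eventually[OF tendsto_divide[OF that(1,2,3)]])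
    show "\<forall>\<^sub>F n in sequentially. s n * x n / s n = x n"
      using tendsto_imp_eventually_ne[OF that(2,3)] by eventually_elim simp
  qed
  note \<alpha>' = tendsto_of_real[OF \<alpha>]
  have C2: "(\<lambda>n. c n 2 / of_real (\<epsilon> n)) \<longlonglongrightarrow> \<kappa>"
  proof -
    have "(\<lambda>n. symb (\<alpha> n) (\<omega> n) 2 * (c n 2 / of_real (\<epsilon> n))) \<longlonglongrightarrow>
      - of_real (pi / 2) * cis (- (pi / 2)) - of_real (pi / 2) * ((cis (pi / 2) + cis (- (3 * (pi / 2)))) * 0)
        - of_real (pi / 2) * 0"
      unfolding e2 by (intro tendsto_intros \<alpha> \<omega> \<alpha>' to0[OF c3] to0[OF qq])
    from quot[OF this symb nz2] have "(\<lambda>n. c n 2 / of_real (\<epsilon> n)) \<longlonglongrightarrow> \<i> / (2 * \<i> - 1)"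
      unfolding s2 c1 by simp
    also have "\<i> / (2 * \<i> - 1) = \<kappa>"
    proof -
      have "2 * \<i> - 1 \<noteq> 0" by (simp add: complex_eq_iff)
      then show ?thesis using nonzero_divide_eq_eq \<kappa>i by metis
    qed
    finally show ?thesis .
  qed
  \<comment> \<open>Limit of c_3 / \<epsilon>^2: in mode three, with symbol 2 pi i, only the
    coupling to c_2 survives.\<close>
  define K3 :: complex where "K3 = (1 + \<i>) * \<kappa> / (4 * \<i>)"
  have C3: "(\<lambda>n. c n 3 / of_real (\<epsilon> n ^ 2)) \<longlonglongrightarrow> K3"
  proof -
    have "(\<lambda>n. symb (\<alpha> n) (\<omega> n) 3 * (c n 3 / of_real (\<epsilon> n ^ 2))) \<longlonglongrightarrow>
      - of_real (pi / 2) * ((cis (- (pi / 2)) + cis (- (2 * (pi / 2)))) * \<kappa>)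
      - of_real (pi / 2) * ((cis (pi / 2) + cis (- (4 * (pi / 2)))) * 0) - of_real (pi / 2) * 0"
      unfolding e3 by (intro tendsto_intros \<alpha> \<omega> \<alpha>' C2 c4 qq)
    from quot[OF this symb nz3] have "(\<lambda>n. c n 3 / of_real (\<epsilon> n ^ 2)) \<longlonglongrightarrow>
      (- of_real (pi / 2) * ((- \<i> + - 1) * \<kappa>)) / (2 * of_real pi * \<i>)"
      unfolding s3 c1 by simp
    also have "(- of_real (pi / 2) * ((- \<i> + - 1) * \<kappa>)) / (2 * of_real pi * \<i>) = K3"
      unfolding K3_def by (simp add: divide_simps) (simp add: algebra_simps)
    finally show ?thesis .
  qed
  have K3: "cmod K3 < 0.16"
  proof -
    have "(cmod K3)\<^sup>2 = 1 / 40"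
      by (simp add: K3_def \<kappa>_def norm_mult norm_divide power_mult_distrib power_divide cmod_power2)
    also have "\<dots> < 0.16\<^sup>2" by (simp add: power2_eq_square)
    finally show ?thesis by (rule power_less_imp_less_base) simp
  qed
  have E1: "(\<lambda>n. (\<i> * of_real (\<omega> n) + of_real (\<alpha> n) * cis (- \<omega> n)) / of_real (\<epsilon> n ^ 2)) \<longlonglongrightarrow> of_real (pi / 10) * (1 - 3 * \<i>)"
  proof -
    have "(\<lambda>n. (\<i> * of_real (\<omega> n) + of_real (\<alpha> n) * cis (- \<omega> n)) / of_real (\<epsilon> n ^ 2)) \<longlonglongrightarrow>
      - of_real (pi / 2) * ((cis (pi / 2) + cis (- (2 * (pi / 2)))) * \<kappa>) - of_real (pi / 2) * 0"
      unfolding e1 by (intro tendsto_intros \<alpha> \<omega> \<alpha>' C2 qq)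
    also have "- of_real (pi / 2) * ((cis (pi / 2) + cis (- (2 * (pi / 2)))) * \<kappa>) - of_real (pi / 2) * 0
       = of_real (pi / 10) * (1 - 3 * \<i>)"
      unfolding c1 by (simp add: \<kappa>_def complex_eq_iff)
    finally show ?thesis .
  qed
  have ne: "\<epsilon> n \<noteq> 0" for n using pos[of n] by simp
  \<comment> \<open>In terms of x, the real and imaginary part of the mode-one limit concern
    \<alpha> sin x and \<omega> - \<alpha> cos x.\<close>
  define x where "x n = pi / 2 - \<omega> n" for n
  have x0: "x \<longlonglongrightarrow> 0" unfolding x_def[abs_def] using tendsto_diff[OF tendsto_const \<omega>, of "pi / 2"] by simp
  have sc: "sin (x n) = cos (\<omega> n)" "cos (x n) = sin (\<omega> n)" for n by (simp_all add: x_def sin_diff cos_diff)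
  have Re: "(\<lambda>n. \<alpha> n * sin (x n) / \<epsilon> n ^ 2) \<longlonglongrightarrow> pi / 10"
    using tendsto_Re[OF E1] by (simp add: sc Re_divide_of_real flip: of_real_power)
  have Im: "(\<lambda>n. (\<omega> n - \<alpha> n * cos (x n)) / \<epsilon> n ^ 2) \<longlonglongrightarrow> - 3 * pi / 10"
    using tendsto_Im[OF E1] by (simp add: sc Im_divide_of_real mult.commute flip: of_real_power)
  have sx: "(\<lambda>n. sin (x n) / \<epsilon> n ^ 2) \<longlonglongrightarrow> 1 / 5"
  proof -
    have "(\<lambda>n. \<alpha> n * sin (x n) / \<epsilon> n ^ 2 / \<alpha> n) \<longlonglongrightarrow> pi / 10 / (pi / 2)"
      by (intro tendsto_intros Re \<alpha>) simp
    moreover have "\<forall>\<^sub>F n in sequentially. \<alpha> n * sin (x n) / \<epsilon> n ^ 2 / \<alpha> n = sin (x n) / \<epsilon> n ^ 2"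
      using ev by eventually_elim simp
    ultimately have "(\<lambda>n. sin (x n) / \<epsilon> n ^ 2) \<longlonglongrightarrow> pi / 10 / (pi / 2)"
      by (rule Lim_transform_eventually)
    then show ?thesis by simp
  qed
  have ev1: "\<forall>\<^sub>F n in sequentially. \<bar>x n\<bar> \<le> 1"
    using order_tendstoD(2)[OF tendsto_rabs[OF x0], of 1] by (simp add: eventually_mono less_imp_le)
  have xe: "(\<lambda>n. x n / \<epsilon> n ^ 2) \<longlonglongrightarrow> 1 / 5"
  proof -
    have "(\<lambda>n. (x n - sin (x n)) / \<epsilon> n ^ 2) \<longlonglongrightarrow> 0"
    proof (rule Lim_null_comparison)
      show "(\<lambda>n. \<bar>x n\<bar>\<^sup>2 * (2 * \<bar>sin (x n) / \<epsilon> n ^ 2\<bar>)) \<longlonglongrightarrow> 0"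
        by (rule tendsto_eq_intros x0 sx refl | simp)+
      show "\<forall>\<^sub>F n in sequentially. norm ((x n - sin (x n)) / \<epsilon> n ^ 2) \<le> \<bar>x n\<bar>\<^sup>2 * (2 * \<bar>sin (x n) / \<epsilon> n ^ 2\<bar>)"
        using ev1
      proof eventually_elim
        case (elim n)
        have "\<bar>x n - sin (x n)\<bar> \<le> \<bar>x n\<bar>\<^sup>2 * \<bar>x n\<bar>"
          using sin_near(1)[OF elim] by (simp add: power3_eq_cube power2_eq_square)
        also have "\<dots> \<le> \<bar>x n\<bar>\<^sup>2 * (2 * \<bar>sin (x n)\<bar>)" by (intro mult_left_mono sin_near(2)[OF elim]) simp
        finally have "\<bar>x n - sin (x n)\<bar> / \<epsilon> n ^ 2 \<le> \<bar>x n\<bar>\<^sup>2 * (2 * \<bar>sin (x n)\<bar>) / \<epsilon> n ^ 2"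
          by (rule divide_right_mono) simp
        then show ?case by (simp add: abs_divide)
      qed
    qed
    from tendsto_add[OF sx this] show ?thesis by (simp add: add_divide_distrib[symmetric])
  qed
  have cx: "(\<lambda>n. (1 - cos (x n)) / \<epsilon> n ^ 2) \<longlonglongrightarrow> 0"
  proof (rule Lim_null_comparison)
    show "(\<lambda>n. \<bar>x n\<bar> * \<bar>x n / \<epsilon> n ^ 2\<bar>) \<longlonglongrightarrow> 0"
      by (rule tendsto_eq_intros x0 xe refl | simp)+
    show "\<forall>\<^sub>F n in sequentially. norm ((1 - cos (x n)) / \<epsilon> n ^ 2) \<le> \<bar>x n\<bar> * \<bar>x n / \<epsilon> n ^ 2\<bar>"
    proof (intro always_eventually allI)
      fix n
      have "1 - cos (x n) = 2 * (sin (x n / 2))\<^sup>2" using cos_double_sin[of "x n / 2"] by simp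
      also have "\<dots> \<le> 2 * \<bar>x n / 2\<bar>\<^sup>2"
        using abs_sin_x_le_abs_x[of "x n / 2"] by (metis mult_left_mono power2_abs abs_ge_zero power_mono zero_le_numeral)
      also have "\<dots> \<le> \<bar>x n\<bar> * \<bar>x n\<bar>" by (simp add: power2_eq_square)
      finally have "(1 - cos (x n)) / \<epsilon> n ^ 2 \<le> \<bar>x n\<bar> * \<bar>x n\<bar> / \<epsilon> n ^ 2" by (rule divide_right_mono) simp
      then show "norm ((1 - cos (x n)) / \<epsilon> n ^ 2) \<le> \<bar>x n\<bar> * \<bar>x n / \<epsilon> n ^ 2\<bar>" by (simp add: abs_divide)
    qed
  qed
  \<comment> \<open>\<alpha> - pi / 2 = \<alpha> (1 - cos x) - (\<omega> - \<alpha> cos x) - x, and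
    over \<epsilon>^2 the three pieces 1 - cos x, \<omega> - \<alpha> cos x and x tend to 0, -3 pi /
    10 and 1 / 5.\<close>
  have ae: "(\<lambda>n. (\<alpha> n - pi / 2) / \<epsilon> n ^ 2) \<longlonglongrightarrow> (3 * pi / 2 - 1) / 5"
  proof -
    have "(\<lambda>n. \<alpha> n * ((1 - cos (x n)) / \<epsilon> n ^ 2) - (\<omega> n - \<alpha> n * cos (x n)) / \<epsilon> n ^ 2 - x n / \<epsilon> n ^ 2)
       \<longlonglongrightarrow> pi / 2 * 0 - (- 3 * pi / 10) - 1 / 5"
      by (intro tendsto_intros \<alpha> cx Im xe)
    moreover have "\<alpha> n * ((1 - cos (x n)) / \<epsilon> n ^ 2) - (\<omega> n - \<alpha> n * cos (x n)) / \<epsilon> n ^ 2 - x n / \<epsilon> n ^ 2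
       = (\<alpha> n - pi / 2) / \<epsilon> n ^ 2" for n
      using ne[of n] by (simp add: x_def field_simps)
    ultimately show ?thesis by (simp add: field_simps)
  qed
  have div1: "(\<lambda>n. f n / \<epsilon> n) \<longlonglongrightarrow> 0" if "(\<lambda>n. f n / \<epsilon> n ^ 2) \<longlonglongrightarrow> l" for f l
    using tendsto_mult[OF that \<epsilon>] ne by (simp add: power2_eq_square)
  have \<alpha>1: "(\<lambda>n. (\<alpha> n - pi / 2) / \<epsilon> n) \<longlonglongrightarrow> 0" by (rule div1[OF ae])
  have \<omega>1: "(\<lambda>n. (\<omega> n - pi / 2) / \<epsilon> n) \<longlonglongrightarrow> 0"
    using tendsto_minus[OF div1[OF xe]] by (simp add: x_def minus_divide_left)
  define Q where "Q m n = (of_real (\<alpha> n) * cis (m * \<omega> n) - of_real (pi / 2) * cis (m * (pi / 2))) / of_real (\<epsilon> n)" for m n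
  have Q: "Q m \<longlonglongrightarrow> 0" for m unfolding Q_def[abs_def] by (rule tendsto_cis_quotient[OF \<alpha>1 \<omega>1])
  \<comment> \<open>The limit of c_2 / \<epsilon> alone is too weak, since the window measures c_2 -
    \<kappa> \<epsilon> against \<epsilon>^2. Subtracting the mode-two equation at the Hopf point
    expresses c_2 / \<epsilon> - \<kappa> by terms that are all o(\<epsilon>).\<close>
  have D: "(\<lambda>n. (c n 2 - \<kappa> * of_real (\<epsilon> n)) / of_real (\<epsilon> n ^ 2)) \<longlonglongrightarrow> 0"
  proof -
    have eq: "symb (\<alpha> n) (\<omega> n) 2 * ((c n 2 - \<kappa> * of_real (\<epsilon> n)) / of_real (\<epsilon> n ^ 2))
      = - Q (- 1) n - \<kappa> * (2 * \<i> * of_real ((\<omega> n - pi / 2) / \<epsilon> n) + Q (- 2) n)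
        - of_real (\<alpha> n) * ((cis (\<omega> n) + cis (- (3 * \<omega> n))) * (c n 3 / of_real (\<epsilon> n ^ 1)))
        - of_real (\<alpha> n) * (?q n 2 / of_real (\<epsilon> n ^ 1))" for n
    proof -
      have z: "of_real (pi / 2) * cis (- (pi / 2)) + \<kappa> * symb (pi / 2) (pi / 2) 2 = 0"
        unfolding s2 c1 using \<kappa>i by (metis add.left_inverse mult.left_commute mult_minus_right)
      have s: "symb (\<alpha> n) (\<omega> n) 2 - symb (pi / 2) (pi / 2) 2 = of_real (\<epsilon> n) * (2 * \<i> * of_real ((\<omega> n - pi / 2) / \<epsilon> n) + Q (- 2) n)"
        using ne[of n] by (simp add: symb_def Q_def field_simps)
      have q1: "of_real (\<alpha> n) * cis (- \<omega> n) = of_real (\<epsilon> n) * Q (- 1) n + of_real (pi / 2) * cis (- (pi / 2))"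
        using ne[of n] by (simp add: Q_def)
      have z': "of_real (pi / 2) * cis (- (pi / 2)) = - (\<kappa> * symb (pi / 2) (pi / 2) 2)"
        using z by (simp only: eq_neg_iff_add_eq_0)
      have "symb (\<alpha> n) (\<omega> n) 2 * (c n 2 / of_real (\<epsilon> n) - \<kappa>)
        = - (of_real (\<alpha> n) * cis (- \<omega> n)) - of_real (\<alpha> n) * ((cis (\<omega> n) + cis (- (3 * \<omega> n))) * c n 3)
          - of_real (\<alpha> n) * ?q n 2 - \<kappa> * symb (\<alpha> n) (\<omega> n) 2"
        unfolding right_diff_distrib e2 by (simp add: mult.commute)
      also have "\<dots> = - of_real (\<epsilon> n) * Q (- 1) n - \<kappa> * (symb (\<alpha> n) (\<omega> n) 2 - symb (pi / 2) (pi / 2) 2)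
          - of_real (\<alpha> n) * ((cis (\<omega> n) + cis (- (3 * \<omega> n))) * c n 3) - of_real (\<alpha> n) * ?q n 2"
        unfolding q1 z' by (simp add: right_diff_distrib)
      finally have E: "symb (\<alpha> n) (\<omega> n) 2 * (c n 2 / of_real (\<epsilon> n) - \<kappa>) / of_real (\<epsilon> n)
        = (- of_real (\<epsilon> n) * Q (- 1) n - \<kappa> * (of_real (\<epsilon> n) * (2 * \<i> * of_real ((\<omega> n - pi / 2) / \<epsilon> n) + Q (- 2) n))
          - of_real (\<alpha> n) * ((cis (\<omega> n) + cis (- (3 * \<omega> n))) * c n 3) - of_real (\<alpha> n) * ?q n 2) / of_real (\<epsilon> n)"
        unfolding s by simp
      have m: "(c n 2 - \<kappa> * of_real (\<epsilon> n)) / of_real (\<epsilon> n ^ 2) = (c n 2 / of_real (\<epsilon> n) - \<kappa>) / of_real (\<epsilon> n)"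
        using ne[of n] by (simp add: field_simps power2_eq_square)
      show ?thesis unfolding m times_divide_eq_right E using ne[of n] by (simp add: diff_divide_distrib)
    qed
    have "(\<lambda>n. symb (\<alpha> n) (\<omega> n) 2 * ((c n 2 - \<kappa> * of_real (\<epsilon> n)) / of_real (\<epsilon> n ^ 2))) \<longlonglongrightarrow>
      - 0 - \<kappa> * (2 * \<i> * of_real 0 + 0) - of_real (pi / 2) * ((cis (pi / 2) + cis (- (3 * (pi / 2)))) * 0) - of_real (pi / 2) * 0"
      unfolding eq by (intro tendsto_intros Q \<alpha> \<omega> \<alpha>' \<omega>1 c3 qq)
    from quot[OF this symb nz2] show ?thesis by simp
  qed
  have T4: "(\<lambda>n. tail (c n) 4 / \<epsilon> n ^ 2) \<longlonglongrightarrow> 0"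
  proof (rule Lim_null_comparison)
    show "(\<lambda>n. 2800 * \<epsilon> n) \<longlonglongrightarrow> 0" using tendsto_mult_right_zero[OF \<epsilon>] .
    show "\<forall>\<^sub>F n in sequentially. norm (tail (c n) 4 / \<epsilon> n ^ 2) \<le> 2800 * \<epsilon> n"
      using T
    proof eventually_elim
      case (elim n)
      then show ?case using pos[of n] tail_nonneg[OF cl(1), of n 4] by (simp add: divide_simps power2_eq_square power3_eq_cube mult_ac)
    qed
  qed
  have l1: "l1_norm (\<lambda>k. c n k - c_bar (\<epsilon> n) k) / \<epsilon> n ^ 2
     = 2 * (cmod ((c n 2 - \<kappa> * of_real (\<epsilon> n)) / of_real (\<epsilon> n ^ 2)) + cmod (c n 3 / of_real (\<epsilon> n ^ 2)) + tail (c n) 4 / \<epsilon> n ^ 2)" for n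
  proof -
    let ?d = "\<lambda>k. c n k - c_bar (\<epsilon> n) k"
    have b: "c_bar (\<epsilon> n) \<in> l1" unfolding c_bar_def[abs_def] by (intro l1_cmult unit_seq_l1) simp
    have dl: "?d \<in> l1" by (intro l1_diff cl b)
    have "tail ?d 0 = cmod (?d 0) + (cmod (?d 1) + (cmod (?d 2) + (cmod (?d 3) + tail ?d 4)))"
      using tail_Suc[OF dl, of 0] tail_Suc[OF dl, of 1] tail_Suc[OF dl, of 2] tail_Suc[OF dl, of 3] by (simp add: eval_nat_numeral)
    moreover have "tail ?d 4 = tail (c n) 4" by (simp add: tail_def c_bar_def unit_seq_def)
    moreover have "?d 0 = 0" "?d 1 = 0" "?d 2 = c n 2 - \<kappa> * of_real (\<epsilon> n)" "?d 3 = c n 3"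
      using cl(2,3)[of n] by (simp_all add: c_bar_def unit_seq_def \<kappa>_def)
    ultimately have "tail ?d 0 = cmod (c n 2 - \<kappa> * of_real (\<epsilon> n)) + cmod (c n 3) + tail (c n) 4" by simp
    then show ?thesis by (simp add: l1_norm_tail norm_divide norm_power add_divide_distrib)
  qed
  have "(\<lambda>n. l1_norm (\<lambda>k. c n k - c_bar (\<epsilon> n) k) / \<epsilon> n ^ 2) \<longlonglongrightarrow> 2 * (cmod 0 + cmod K3 + 0)"
    unfolding l1 by (intro tendsto_intros D C3 T4)
  then have ev_c: "\<forall>\<^sub>F n in sequentially. l1_norm (\<lambda>k. c n k - c_bar (\<epsilon> n) k) / \<epsilon> n ^ 2 < 0.4929"
    by (rule order_tendstoD) (use K3 in simp)
  have "(\<lambda>n. \<bar>(\<alpha> n - pi / 2) / \<epsilon> n ^ 2 - (3 * pi / 2 - 1) / 5\<bar>) \<longlonglongrightarrow> \<bar>(3 * pi / 2 - 1) / 5 - (3 * pi / 2 - 1) / 5\<bar>"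
    by (intro tendsto_intros ae)
  then have ev_a: "\<forall>\<^sub>F n in sequentially. \<bar>(\<alpha> n - pi / 2) / \<epsilon> n ^ 2 - (3 * pi / 2 - 1) / 5\<bar> < 0.0594"
    by (rule order_tendstoD) simp
  have "(\<lambda>n. \<bar>x n / \<epsilon> n ^ 2 - 1 / 5\<bar>) \<longlonglongrightarrow> \<bar>1 / 5 - 1 / 5\<bar>"
    by (intro tendsto_intros xe)
  then have ev_o: "\<forall>\<^sub>F n in sequentially. \<bar>x n / \<epsilon> n ^ 2 - 1 / 5\<bar> < 0.0260"
    by (rule order_tendstoD) simp
  \<comment> \<open>48 * 0.006 < 0.3191.\<close>
  have ev_K: "\<forall>\<^sub>F n in sequentially. \<epsilon> n < 0.006" by (rule order_tendstoD[OF \<epsilon>]) simp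
  show ?thesis
    using ev_c ev_a ev_o ev_K
  proof eventually_elim
    case (elim n)
    have p: "0 < \<epsilon> n ^ 2" using pos[of n] by simp
    have "\<alpha> n - alpha_bar (\<epsilon> n) = ((\<alpha> n - pi / 2) / \<epsilon> n ^ 2 - (3 * pi / 2 - 1) / 5) * \<epsilon> n ^ 2"
      using ne[of n] by (simp add: alpha_bar_def field_simps)
    then have a: "\<bar>\<alpha> n - alpha_bar (\<epsilon> n)\<bar> < 0.0594 * \<epsilon> n ^ 2"
      using mult_strict_right_mono[OF elim(2) p] by (simp only: abs_mult) simp
    have "\<omega> n - omega_bar (\<epsilon> n) = - (x n / \<epsilon> n ^ 2 - 1 / 5) * \<epsilon> n ^ 2"
      using ne[of n] by (simp add: omega_bar_def x_def field_simps)
    then have o: "\<bar>\<omega> n - omega_bar (\<epsilon> n)\<bar> < 0.0260 * \<epsilon> n ^ 2"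
      using mult_strict_right_mono[OF elim(3) p] by (simp only: abs_mult abs_minus_cancel) simp
    have l: "l1_norm (\<lambda>k. c n k - c_bar (\<epsilon> n) k) < 0.4929 * \<epsilon> n ^ 2"
      using elim(1) p by (simp add: pos_divide_less_eq)
    have "l1_norm (K_inv (c n)) < 0.3191" using small[of n] elim(4) by simp
    then show ?case unfolding is_local_zero_def using lK F a o l by blast
  qed
qed

section \<open>The derivative of the branch\<close>

text \<open>\<open>smooth_family_on\<close> describes the derivative of c by difference quotients;
  this puts it into the form that the product and chain rules expect.\<close>

lemma has_vector_derivative_iff_quotient:
  fixes f :: "real \<Rightarrow> complex"
  shows "(f has_vector_derivative D) (at x within S) \<longleftrightarrow>
    ((\<lambda>y. (f y - f x) / of_real (y - x)) \<longlongrightarrow> D) (at x within S)"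
proof -
  have "norm (f y - f x - (y - x) *\<^sub>R D) / norm (y - x) = norm ((f y - f x) / of_real (y - x) - D)" if "y \<noteq> x" for y
  proof -
    have "(f y - f x) / of_real (y - x) - D = (f y - f x - (y - x) *\<^sub>R D) / of_real (y - x)"
      using that by (simp add: scaleR_conv_of_real diff_divide_distrib flip: of_real_diff)
    then show ?thesis by (simp only: norm_divide norm_of_real real_norm_def)
  qed
  then have "((\<lambda>y. norm (f y - f x - (y - x) *\<^sub>R D) / norm (y - x)) \<longlongrightarrow> 0) (at x within S)
    \<longleftrightarrow> ((\<lambda>y. norm ((f y - f x) / of_real (y - x) - D)) \<longlongrightarrow> 0) (at x within S)"
    by (intro Lim_cong_within) auto
  then show ?thesis
    unfolding has_vector_derivative_def has_derivative_iff_norm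
    by (simp add: bounded_linear_scaleR_left tendsto_norm_zero_iff LIM_zero_iff)
qed

lemma cis_chain_has_vector_derivative:
  assumes "(f has_real_derivative f') (at x within S)"
  shows "((\<lambda>x. cis (m * f x)) has_vector_derivative \<i> * of_real (m * f') * cis (m * f x)) (at x within S)"
proof -
  have "((\<lambda>x. complex_of_real (f x)) has_vector_derivative of_real f') (at x within S)"
    using assms by (intro has_vector_derivative_of_real) (simp add: has_real_derivative_iff_has_vector_derivative)
  moreover have "((\<lambda>z. exp (\<i> * of_real m * z)) has_field_derivative \<i> * of_real m * exp (\<i> * of_real m * of_real (f x)))
     (at (of_real (f x)) within (\<lambda>x. complex_of_real (f x)) ` S)"
    by (auto intro!: derivative_eq_intros)
  ultimately have "((\<lambda>z. exp (\<i> * of_real m * z)) \<circ> (\<lambda>x. complex_of_real (f x)) has_vector_derivative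
      of_real f' * (\<i> * of_real m * exp (\<i> * of_real m * of_real (f x)))) (at x within S)"
    by (rule field_vector_diff_chain_within)
  then show ?thesis by (simp add: o_def cis_conv_exp mult_ac)
qed

lemma sqrt5: "2.236 < sqrt 5" "sqrt 5 < 2.2365"
  by (rule real_less_rsqrt, simp add: power2_eq_square) (rule real_less_lsqrt, simp_all add: power2_eq_square)

lemma cmod_kappa: "cmod ((2 - \<i>) / 5) \<le> 0.4473"
proof -
  have "cmod (2 - \<i>) = sqrt 5" by (simp add: cmod_def)
  then show ?thesis using sqrt5 norm_divide[of "2 - \<i>" 5] by (simp del: norm_divide)
qed

locale zero_branch =
  fixes \<alpha>h \<omega>h :: "real \<Rightarrow> real" and ch :: "real \<Rightarrow> cseq"
  assumes unique_zero:
      "\<And>\<epsilon> \<alpha> \<omega> c. 0 < \<epsilon> \<Longrightarrow> \<epsilon> \<le> 0.1 \<Longrightarrow>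
         is_local_zero \<epsilon> \<alpha> \<omega> c \<longleftrightarrow> \<alpha> = \<alpha>h \<epsilon> \<and> \<omega> = \<omega>h \<epsilon> \<and> c = ch \<epsilon>"
    and smooth: "smooth_family_on {0<..0.1} \<alpha>h \<omega>h ch"
begin

lemma local_zero: "\<epsilon> \<in> {0<..0.1} \<Longrightarrow> is_local_zero \<epsilon> (\<alpha>h \<epsilon>) (\<omega>h \<epsilon>) (ch \<epsilon>)"
  using unique_zero by auto

lemma ch_facts:
  assumes "\<epsilon> \<in> {0<..0.1}"
  shows "ch \<epsilon> \<in> l1" "ch \<epsilon> 0 = 0" "ch \<epsilon> 1 = 0" "K_inv (ch \<epsilon>) \<in> l1" "F_map \<epsilon> (\<alpha>h \<epsilon>) (\<omega>h \<epsilon>) (ch \<epsilon>) k = 0"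
    "l1_norm (K_inv (ch \<epsilon>)) < 0.3191"
  using local_zero[OF assms] by (auto simp: is_local_zero_def lK_0_def l1_0_def l1_def)

lemma l1_norm_le_K_inv:
  assumes "a 0 = 0" "K_inv a \<in> l1" shows "l1_norm a \<le> l1_norm (K_inv a)"
proof -
  have "cmod (a k) \<le> cmod (K_inv a k)" for k
    using assms(1) mult_right_mono[of 1 "real k" "cmod (a k)"]
    by (cases k) (auto simp: K_inv_def norm_mult simp del: of_nat_Suc)
  then show ?thesis using l1_norm_le(2)[of a 1 "K_inv a"] assms by simp
qed

lemma c_bar_l1: "c_bar \<epsilon> \<in> l1" "l1_norm (c_bar \<epsilon>) = 2 * (sqrt 5 / 5) * \<bar>\<epsilon>\<bar>"
proof -
  show b: "c_bar \<epsilon> \<in> l1" unfolding c_bar_def[abs_def] by (intro l1_cmult unit_seq_l1) simp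
  have "l1_norm (c_bar \<epsilon>) = 2 * (\<Sum>k. if k = 2 then cmod ((2 - \<i>) / 5 * of_real \<epsilon>) else 0)"
    unfolding l1_norm_def by (intro arg_cong2[of _ _ _ _ "(*)"] suminf_cong refl) (simp add: c_bar_def unit_seq_def)
  also have "\<dots> = 2 * cmod ((2 - \<i>) / 5 * of_real \<epsilon>)"
    using sums_unique[OF sums_single[of 2 "\<lambda>k. cmod ((2 - \<i>) / 5 * of_real \<epsilon>)"]] by simp
  also have "cmod (2 - \<i>) = sqrt 5" by (simp add: cmod_def)
  ultimately show "l1_norm (c_bar \<epsilon>) = 2 * (sqrt 5 / 5) * \<bar>\<epsilon>\<bar>" by (simp add: norm_mult norm_divide)
qed

lemma eps_sq:
  fixes \<epsilon> :: real
  shows "\<epsilon> \<in> {0<..0.1} \<Longrightarrow> \<epsilon>\<^sup>2 \<le> \<epsilon> / 10 \<and> 0 < \<epsilon>\<^sup>2 \<and> \<epsilon>\<^sup>2 \<le> 1 / 100"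
proof -
  assume e: "\<epsilon> \<in> {0<..0.1}"
  then have "\<epsilon> * \<epsilon> \<le> \<epsilon> * (1/10)" "0 < \<epsilon> * \<epsilon>" by (auto intro!: mult_left_mono)
  then show ?thesis using e by (auto simp: power2_eq_square)
qed

text \<open>The window with \<epsilon>^2 \<le> 0.01 or \<epsilon>^2 \<le> \<epsilon> / 10: 0.01 (0.2
  + 0.026) = 0.00226, 0.01 (0.7425 + 0.0594) < 0.00803, 0.4929 / 20 < 0.02465, and 0.8946 + 0.04929
  < 0.944, where 0.8946 bounds 2 / sqrt 5, the norm of \<open>c_bar\<close> over \<epsilon>.\<close>

lemma base_bounds:
  assumes "\<epsilon> \<in> {0<..0.1}"
  shows "pi / 2 - 0.00226 \<le> \<omega>h \<epsilon>" "\<omega>h \<epsilon> < pi / 2" "pi / 2 < \<alpha>h \<epsilon>" "\<alpha>h \<epsilon> \<le> pi / 2 + 0.00803"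
    "cmod (ch \<epsilon> 2 - (2 - \<i>) / 5 * of_real \<epsilon>) \<le> 0.02465 * \<epsilon>" "cmod (ch \<epsilon> 3) \<le> 0.02465 * \<epsilon>"
    "l1_norm (ch \<epsilon>) \<le> 0.944 * \<epsilon>"
proof -
  note e2 = eps_sq[OF assms]
  have e: "\<epsilon> > 0" using assms by simp
  have pi: "3.1415 < pi" "pi < 3.1416" using pi_approx by simp_all
  note lz = local_zero[OF assms, unfolded is_local_zero_def]
  have o: "\<bar>\<omega>h \<epsilon> - omega_bar \<epsilon>\<bar> < 0.0260 * \<epsilon>\<^sup>2" and a: "\<bar>\<alpha>h \<epsilon> - alpha_bar \<epsilon>\<bar> < 0.0594 * \<epsilon>\<^sup>2"
    and l: "l1_norm (\<lambda>k. ch \<epsilon> k - c_bar \<epsilon> k) < 0.4929 * \<epsilon>\<^sup>2" using lz by blast+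
  note o' = abs_less_iff[THEN iffD1, OF o, unfolded omega_bar_def]
  show "pi / 2 - 0.00226 \<le> \<omega>h \<epsilon>" "\<omega>h \<epsilon> < pi / 2" using o' e2 by simp_all
  define P where "P = \<epsilon>\<^sup>2 * ((3 * pi / 2 - 1) / 5)"
  have ab: "alpha_bar \<epsilon> = pi / 2 + P" by (simp add: alpha_bar_def P_def)
  have "\<epsilon>\<^sup>2 * 0.742 \<le> P" "P \<le> \<epsilon>\<^sup>2 * 0.7425"
    unfolding P_def using pi e2 by (intro mult_left_mono; simp)+
  then show "pi / 2 < \<alpha>h \<epsilon>" "\<alpha>h \<epsilon> \<le> pi / 2 + 0.00803"
    using abs_less_iff[THEN iffD1, OF a, unfolded ab] e2 by simp_all
  let ?d = "\<lambda>k. ch \<epsilon> k - c_bar \<epsilon> k"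
  have dl: "?d \<in> l1" by (intro l1_diff ch_facts assms c_bar_l1)
  have d: "cmod (?d k) \<le> 0.02465 * \<epsilon>" for k
  proof -
    have "2 * cmod (?d k) \<le> l1_norm ?d"
      using cmod_le_tail[OF dl, of k] tail_antimono[OF dl, of 0 k] by (simp add: l1_norm_tail)
    then show ?thesis using l e2 e by simp
  qed
  show "cmod (ch \<epsilon> 2 - (2 - \<i>) / 5 * of_real \<epsilon>) \<le> 0.02465 * \<epsilon>" "cmod (ch \<epsilon> 3) \<le> 0.02465 * \<epsilon>"
    using d[of 2] d[of 3] by (simp_all add: c_bar_def unit_seq_def)
  have "l1_norm (ch \<epsilon>) = l1_norm (\<lambda>k. ?d k + c_bar \<epsilon> k)" by simp
  also have "\<dots> \<le> l1_norm ?d + l1_norm (c_bar \<epsilon>)" by (rule l1_norm_triangle[OF dl c_bar_l1(1)])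
  also have "l1_norm (c_bar \<epsilon>) = 2 * (sqrt 5 / 5) * \<epsilon>" using c_bar_l1(2) e by simp
  also have "2 * (sqrt 5 / 5) * \<epsilon> \<le> 0.8946 * \<epsilon>" using sqrt5 e by (intro mult_right_mono) auto
  finally show "l1_norm (ch \<epsilon>) \<le> 0.944 * \<epsilon>" using l e2 e by simp
qed

lemma first_derivatives:
  assumes "\<epsilon> \<in> {0<..0.1}"
  obtains u v w where "(\<alpha>h has_real_derivative u) (at \<epsilon> within {0<..0.1})"
    "(\<omega>h has_real_derivative v) (at \<epsilon> within {0<..0.1})" "w \<in> lK_0"
    "((\<lambda>\<eta>. l1_norm (K_inv (\<lambda>k. (ch \<eta> k - ch \<epsilon> k) / of_real (\<eta> - \<epsilon>) - w k))) \<longlongrightarrow> 0) (at \<epsilon> within {0<..0.1})"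
proof -
  let ?I = "{0<..0.1::real}"
  from smooth obtain D\<alpha> D\<omega> Dc where
    0: "\<forall>\<epsilon>\<in>?I. D\<alpha> (0::nat) \<epsilon> = \<alpha>h \<epsilon> \<and> D\<omega> (0::nat) \<epsilon> = \<omega>h \<epsilon> \<and> Dc (0::nat) \<epsilon> = ch \<epsilon>"
    and D': "\<forall>n. \<forall>\<epsilon>\<in>?I. Dc n \<epsilon> \<in> lK_0 \<and>
           (D\<alpha> n has_real_derivative D\<alpha> (Suc n) \<epsilon>) (at \<epsilon> within ?I) \<and>
           (D\<omega> n has_real_derivative D\<omega> (Suc n) \<epsilon>) (at \<epsilon> within ?I) \<and>
           ((\<lambda>\<eta>. l1_norm (K_inv (\<lambda>k. (Dc n \<eta> k - Dc n \<epsilon> k) / of_real (\<eta> - \<epsilon>) - Dc (Suc n) \<epsilon> k)))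
              \<longlongrightarrow> 0) (at \<epsilon> within ?I)"
    unfolding smooth_family_on_def by blast
  note D = D'[rule_format]
  show ?thesis
  proof (rule that[of "D\<alpha> 1 \<epsilon>" "D\<omega> 1 \<epsilon>" "Dc 1 \<epsilon>"])
    show "(\<alpha>h has_real_derivative D\<alpha> 1 \<epsilon>) (at \<epsilon> within ?I)"
      by (rule has_field_derivative_transform_within[of "D\<alpha> 0", OF _ zero_less_one assms]) (use D[OF assms, of 0] 0 in auto)
    show "(\<omega>h has_real_derivative D\<omega> 1 \<epsilon>) (at \<epsilon> within ?I)"
      by (rule has_field_derivative_transform_within[of "D\<omega> 0", OF _ zero_less_one assms]) (use D[OF assms, of 0] 0 in auto)
    show "Dc 1 \<epsilon> \<in> lK_0" using D[OF assms] by blast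
    have "((\<lambda>\<eta>. l1_norm (K_inv (\<lambda>k. (Dc 0 \<eta> k - Dc 0 \<epsilon> k) / of_real (\<eta> - \<epsilon>) - Dc (Suc 0) \<epsilon> k))) \<longlongrightarrow> 0) (at \<epsilon> within ?I)"
      using D[OF assms, of 0] by blast
    then show "((\<lambda>\<eta>. l1_norm (K_inv (\<lambda>k. (ch \<eta> k - ch \<epsilon> k) / of_real (\<eta> - \<epsilon>) - Dc 1 \<epsilon> k))) \<longlongrightarrow> 0) (at \<epsilon> within ?I)"
      by (rule Lim_transform_within[OF _ zero_less_one]) (use 0 assms in auto)
  qed
qed

text \<open>The weighted norm dominates the unweighted one, and that dominates each coefficient, so
  differentiability in the strong norm passes to both; multiplying the quotient by \<eta> -
  \<epsilon> gives continuity in the strong norm.\<close>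

lemma ch_quotient_l1:
  assumes \<epsilon>: "\<epsilon> \<in> {0<..0.1}" and w: "w \<in> lK_0"
    and lim: "((\<lambda>\<eta>. l1_norm (K_inv (\<lambda>k. (ch \<eta> k - ch \<epsilon> k) / of_real (\<eta> - \<epsilon>) - w k))) \<longlongrightarrow> 0) (at \<epsilon> within {0<..0.1})"
  shows "((\<lambda>\<eta>. l1_norm (\<lambda>k. ch \<eta> k - ch \<epsilon> k) / \<bar>\<eta> - \<epsilon>\<bar>) \<longlongrightarrow> l1_norm w) (at \<epsilon> within {0<..0.1})"
    "((\<lambda>\<eta>. ch \<eta> k) has_vector_derivative w k) (at \<epsilon> within {0<..0.1})"
    "((\<lambda>\<eta>. l1_norm (K_inv (\<lambda>k. ch \<eta> k - ch \<epsilon> k))) \<longlongrightarrow> 0) (at \<epsilon> within {0<..0.1})"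
proof -
  let ?I = "{0<..0.1::real}" and ?F = "at \<epsilon> within {0<..0.1}"
  let ?q = "\<lambda>\<eta> k. (ch \<eta> k - ch \<epsilon> k) / of_real (\<eta> - \<epsilon>)"
  have w': "w \<in> l1" "w 0 = 0" "K_inv w \<in> l1" using w by (auto simp: lK_0_def l1_0_def l1_def)
  have evI: "\<forall>\<^sub>F \<eta> in ?F. \<eta> \<in> ?I \<and> \<eta> \<noteq> \<epsilon>" by (auto simp: eventually_at intro!: exI[of _ 1])
  have Kq: "K_inv (?q \<eta>) = (\<lambda>k. (1 / of_real (\<eta> - \<epsilon>)) * (K_inv (ch \<eta>) k - K_inv (ch \<epsilon>) k))" for \<eta>
    by (simp add: K_inv_def fun_eq_iff right_diff_distrib diff_divide_distrib)
  have ql: "?q \<eta> 0 = 0 \<and> K_inv (?q \<eta>) \<in> l1 \<and> ?q \<eta> \<in> l1" if "\<eta> \<in> ?I" for \<eta>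
  proof -
    have "K_inv (?q \<eta>) \<in> l1" unfolding Kq by (intro l1_cmult l1_diff ch_facts that \<epsilon>)
    moreover have "?q \<eta> 0 = 0" using ch_facts(2) that \<epsilon> by simp
    ultimately show ?thesis using K_inv_l1[of "?q \<eta>"] by blast
  qed
  have Kd: "K_inv (\<lambda>k. ?q \<eta> k - w k) = (\<lambda>k. K_inv (?q \<eta>) k - K_inv w k)" for \<eta>
    by (simp add: K_inv_def fun_eq_iff right_diff_distrib)
  have Kdl: "K_inv (\<lambda>k. ?q \<eta> k - w k) \<in> l1" if "\<eta> \<in> ?I" for \<eta>
    unfolding Kd using ql[OF that] w' by (intro l1_diff) auto
  have small: "((\<lambda>\<eta>. l1_norm (\<lambda>k. ?q \<eta> k - w k)) \<longlongrightarrow> 0) ?F"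
  proof (rule tendsto_sandwich[OF _ _ tendsto_const lim])
    show "\<forall>\<^sub>F \<eta> in ?F. 0 \<le> l1_norm (\<lambda>k. ?q \<eta> k - w k)"
      using evI by eventually_elim (use ql w' in \<open>auto intro!: l1_norm_nonneg l1_diff\<close>)
    show "\<forall>\<^sub>F \<eta> in ?F. l1_norm (\<lambda>k. ?q \<eta> k - w k) \<le> l1_norm (K_inv (\<lambda>k. ?q \<eta> k - w k))"
      using evI by eventually_elim (use ql w' Kdl in \<open>intro l1_norm_le_K_inv; auto\<close>)
  qed
  have tri: "\<bar>l1_norm a - l1_norm b\<bar> \<le> l1_norm (\<lambda>k. a k - b k)" if "a \<in> l1" "b \<in> l1" for a b
    using l1_norm_triangle[OF l1_diff[OF that] that(2)] l1_norm_triangle[OF l1_diff[OF that(2,1)] that(1)]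
      l1_norm_diff_swap[of a b] by simp
  have "((\<lambda>\<eta>. l1_norm (?q \<eta>) - l1_norm w) \<longlongrightarrow> 0) ?F"
  proof (rule Lim_null_comparison[OF _ small])
    show "\<forall>\<^sub>F \<eta> in ?F. norm (l1_norm (?q \<eta>) - l1_norm w) \<le> l1_norm (\<lambda>k. ?q \<eta> k - w k)"
      using evI by eventually_elim (use ql w' tri in auto)
  qed
  then have "((\<lambda>\<eta>. l1_norm (?q \<eta>)) \<longlongrightarrow> l1_norm w) ?F" by (simp add: LIM_zero_iff)
  then show "((\<lambda>\<eta>. l1_norm (\<lambda>k. ch \<eta> k - ch \<epsilon> k) / \<bar>\<eta> - \<epsilon>\<bar>) \<longlongrightarrow> l1_norm w) ?F"
  proof (rule Lim_transform_eventually)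
    show "\<forall>\<^sub>F \<eta> in ?F. l1_norm (?q \<eta>) = l1_norm (\<lambda>k. ch \<eta> k - ch \<epsilon> k) / \<bar>\<eta> - \<epsilon>\<bar>"
      using evI
    proof eventually_elim
      case (elim \<eta>)
      have "(\<lambda>k. ch \<eta> k - ch \<epsilon> k) \<in> l1" using elim by (intro l1_diff ch_facts \<epsilon>) auto
      from l1_norm_cmult[OF this, of "1 / of_real (\<eta> - \<epsilon>)"] show ?case
        by (simp add: norm_divide flip: of_real_diff)
    qed
  qed
  show "((\<lambda>\<eta>. ch \<eta> k) has_vector_derivative w k) ?F"
    unfolding has_vector_derivative_iff_quotient
  proof (rule LIM_zero_cancel, rule Lim_null_comparison[OF _ small])
    show "\<forall>\<^sub>F \<eta> in ?F. norm (?q \<eta> k - w k) \<le> l1_norm (\<lambda>k. ?q \<eta> k - w k)"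
      using evI
    proof eventually_elim
      case (elim \<eta>)
      then have d: "(\<lambda>k. ?q \<eta> k - w k) \<in> l1" using ql w' by (intro l1_diff) auto
      show ?case using cmod_le_tail[OF d, of k] tail_antimono[OF d, of 0 k] tail_nonneg[OF d, of 0] by (simp add: l1_norm_tail)
    qed
  qed
  show "((\<lambda>\<eta>. l1_norm (K_inv (\<lambda>k. ch \<eta> k - ch \<epsilon> k))) \<longlongrightarrow> 0) ?F"
  proof (rule tendsto_sandwich[OF _ _ tendsto_const])
    have d: "K_inv (\<lambda>k. ch \<eta> k - ch \<epsilon> k) \<in> l1" if "\<eta> \<in> ?I" for \<eta>
    proof -
      have "K_inv (\<lambda>k. ch \<eta> k - ch \<epsilon> k) = (\<lambda>k. K_inv (ch \<eta>) k - K_inv (ch \<epsilon>) k)"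
        by (simp add: K_inv_def fun_eq_iff right_diff_distrib)
      then show ?thesis using l1_diff[OF ch_facts(4)[OF that] ch_facts(4)[OF \<epsilon>]] by simp
    qed
    show "\<forall>\<^sub>F \<eta> in ?F. 0 \<le> l1_norm (K_inv (\<lambda>k. ch \<eta> k - ch \<epsilon> k))"
      using evI by eventually_elim (use d l1_norm_nonneg in auto)
    show "\<forall>\<^sub>F \<eta> in ?F. l1_norm (K_inv (\<lambda>k. ch \<eta> k - ch \<epsilon> k))
       \<le> \<bar>\<eta> - \<epsilon>\<bar> * (l1_norm (K_inv (\<lambda>k. ?q \<eta> k - w k)) + l1_norm (K_inv w))"
      using evI
    proof eventually_elim
      case (elim \<eta>)
      have "K_inv (\<lambda>k. ch \<eta> k - ch \<epsilon> k) = (\<lambda>k. of_real (\<eta> - \<epsilon>) * (K_inv (\<lambda>k. ?q \<eta> k - w k) k + K_inv w k))"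
        using elim by (simp add: K_inv_def fun_eq_iff field_simps)
      moreover have "l1_norm (\<lambda>k. of_real (\<eta> - \<epsilon>) * (K_inv (\<lambda>k. ?q \<eta> k - w k) k + K_inv w k))
        = \<bar>\<eta> - \<epsilon>\<bar> * l1_norm (\<lambda>k. K_inv (\<lambda>k. ?q \<eta> k - w k) k + K_inv w k)"
        using elim Kdl w' by (subst l1_norm_cmult) (auto intro!: l1_add simp flip: of_real_diff)
      moreover have "l1_norm (\<lambda>k. K_inv (\<lambda>k. ?q \<eta> k - w k) k + K_inv w k)
          \<le> l1_norm (K_inv (\<lambda>k. ?q \<eta> k - w k)) + l1_norm (K_inv w)"
        using elim Kdl w' by (intro l1_norm_triangle) auto
      ultimately show ?case by (simp add: mult_left_mono)
    qed
    have "((\<lambda>\<eta>. \<bar>\<eta> - \<epsilon>\<bar> * (l1_norm (K_inv (\<lambda>k. ?q \<eta> k - w k)) + l1_norm (K_inv w))) \<longlongrightarrow> \<bar>\<epsilon> - \<epsilon>\<bar> * (0 + l1_norm (K_inv w))) ?F"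
      by (intro tendsto_intros lim)
    then show "((\<lambda>\<eta>. \<bar>\<eta> - \<epsilon>\<bar> * (l1_norm (K_inv (\<lambda>k. ?q \<eta> k - w k)) + l1_norm (K_inv w))) \<longlongrightarrow> 0) ?F"
      by simp
  qed
qed

end

text \<open>\<open>mode\<close> is \<open>F_map / \<alpha>\<close> without its quadratic term, in the unknowns \<open>\<rho> = \<omega> / \<alpha>\<close>, \<open>\<omega>\<close>, \<open>c\<close>;
  \<open>L_op'\<close> and \<open>mode'\<close> are \<open>\<epsilon>\<close>-derivatives, with \<open>r\<close>, \<open>v\<close>, \<open>w\<close> the derivatives of \<open>\<rho>\<close>, \<open>\<omega>\<close>, \<open>c\<close>.\<close>

definition mode :: "real \<Rightarrow> real \<Rightarrow> real \<Rightarrow> cseq \<Rightarrow> nat \<Rightarrow> complex" where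
  "mode \<epsilon> \<rho> \<omega> c k = (if k = 1 then \<i> * of_real \<rho> + cis (- \<omega>) else 0)
     + (\<i> * of_nat k * of_real \<rho> + cis (- (real k * \<omega>))) * c k
     + (if k = 2 then of_real \<epsilon> * cis (- \<omega>) else 0) + of_real \<epsilon> * L_op \<omega> c k"

definition L_op' :: "real \<Rightarrow> real \<Rightarrow> cseq \<Rightarrow> nat \<Rightarrow> complex" where
  "L_op' v \<omega> c k = of_real v * ((- \<i> * cis (- \<omega>) - \<i> * of_nat (k - 1) * cis (- (real (k - 1) * \<omega>))) * c (k - 1)
     + (\<i> * cis \<omega> - \<i> * of_nat (k + 1) * cis (- (real (k + 1) * \<omega>))) * c (k + 1))"

definition mode' :: "real \<Rightarrow> real \<Rightarrow> real \<Rightarrow> real \<Rightarrow> real \<Rightarrow> cseq \<Rightarrow> cseq \<Rightarrow> nat \<Rightarrow> complex" where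
  "mode' \<epsilon> r \<rho> v \<omega> w c k = (if k = 1 then \<i> * of_real r - \<i> * of_real v * cis (- \<omega>) else 0)
     + ((\<i> * of_nat k * of_real \<rho> + cis (- (real k * \<omega>))) * w k
       + (\<i> * of_nat k * of_real r - \<i> * of_nat k * of_real v * cis (- (real k * \<omega>))) * c k)
     + (if k = 2 then cis (- \<omega>) - \<i> * of_real \<epsilon> * of_real v * cis (- \<omega>) else 0)
     + (L_op \<omega> c k + of_real \<epsilon> * (L_op \<omega> w k + L_op' v \<omega> c k))"

lemma F_map_mode:
  assumes "\<alpha> \<noteq> 0"
  shows "F_map \<epsilon> \<alpha> \<omega> c k = of_real \<alpha> * (mode \<epsilon> (\<omega> / \<alpha>) \<omega> c k + of_real \<epsilon> * conv (U_op \<omega> c) c k)"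
proof -
  have "of_real \<alpha> * complex_of_real (\<omega> / \<alpha>) = of_real \<omega>" using assms by simp
  then have "of_real \<alpha> * (\<i> * complex_of_real (\<omega> / \<alpha>)) = \<i> * of_real \<omega>"
    "of_real \<alpha> * (\<i> * of_nat k * complex_of_real (\<omega> / \<alpha>)) = \<i> * of_nat k * of_real \<omega>"
    by (metis mult.left_commute mult.assoc)+
  then show ?thesis
    unfolding F_map_expand mode_def symb_def unit_seq_def
    by (simp add: ring_distribs mult_ac del: of_real_divide)
qed

lemma mode_has_vector_derivative:
  assumes d\<rho>: "(\<rho> has_real_derivative r) (at \<epsilon> within I)" and d\<omega>: "(\<omega> has_real_derivative v) (at \<epsilon> within I)"
    and dc: "\<And>k. ((\<lambda>\<eta>. c \<eta> k) has_vector_derivative w k) (at \<epsilon> within I)" and k: "0 < k"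
  shows "((\<lambda>\<eta>. mode \<eta> (\<rho> \<eta>) (\<omega> \<eta>) (c \<eta>) k) has_vector_derivative mode' \<epsilon> r (\<rho> \<epsilon>) v (\<omega> \<epsilon>) w (c \<epsilon>) k) (at \<epsilon> within I)"
proof -
  let ?F = "at \<epsilon> within I"
  have em: "((\<lambda>\<eta>. cis (- (real j * \<omega> \<eta>))) has_vector_derivative - \<i> * of_nat j * of_real v * cis (- (real j * \<omega> \<epsilon>))) ?F" for j
    using cis_chain_has_vector_derivative[OF d\<omega>, of "- real j"] by (simp add: mult_ac)
  have e1: "((\<lambda>\<eta>. cis (- \<omega> \<eta>)) has_vector_derivative - \<i> * of_real v * cis (- \<omega> \<epsilon>)) ?F"
    using em[of 1] by simp
  have ep: "((\<lambda>\<eta>. cis (\<omega> \<eta>)) has_vector_derivative \<i> * of_real v * cis (\<omega> \<epsilon>)) ?F"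
    using cis_chain_has_vector_derivative[OF d\<omega>, of 1] by simp
  have r: "((\<lambda>\<eta>. complex_of_real (\<rho> \<eta>)) has_vector_derivative of_real r) ?F"
    using d\<rho> by (intro has_vector_derivative_of_real) (simp add: has_real_derivative_iff_has_vector_derivative)
  have i: "((\<lambda>\<eta>. complex_of_real \<eta>) has_vector_derivative 1) ?F"
    using has_vector_derivative_of_real[OF DERIV_ident] by simp
  have 1: "((\<lambda>\<eta>. if k = 1 then \<i> * of_real (\<rho> \<eta>) + cis (- \<omega> \<eta>) else 0) has_vector_derivative
    (if k = 1 then \<i> * of_real r - \<i> * of_real v * cis (- \<omega> \<epsilon>) else 0)) ?F"
    using has_vector_derivative_add[OF has_vector_derivative_mult_right[OF r, of \<i>] e1] by simp
  have 2: "((\<lambda>\<eta>. (\<i> * of_nat k * of_real (\<rho> \<eta>) + cis (- (real k * \<omega> \<eta>))) * c \<eta> k) has_vector_derivative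
     ((\<i> * of_nat k * of_real (\<rho> \<epsilon>) + cis (- (real k * \<omega> \<epsilon>))) * w k
       + (\<i> * of_nat k * of_real r - \<i> * of_nat k * of_real v * cis (- (real k * \<omega> \<epsilon>))) * c \<epsilon> k)) ?F"
    using has_vector_derivative_mult[OF has_vector_derivative_add[OF has_vector_derivative_mult_right[OF r, of "\<i> * of_nat k"] em[of k]] dc[of k]]
    by simp
  have 3: "((\<lambda>\<eta>. if k = 2 then of_real \<eta> * cis (- \<omega> \<eta>) else 0) has_vector_derivative
    (if k = 2 then cis (- \<omega> \<epsilon>) - \<i> * of_real \<epsilon> * of_real v * cis (- \<omega> \<epsilon>) else 0)) ?F"
    using has_vector_derivative_mult[OF i e1] by (simp add: mult_ac)
  have L: "((\<lambda>\<eta>. L_op (\<omega> \<eta>) (c \<eta>) k) has_vector_derivative (L_op (\<omega> \<epsilon>) w k + L_op' v (\<omega> \<epsilon>) (c \<epsilon>) k)) ?F"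
    unfolding L_op_expand[OF k]
    using has_vector_derivative_add[OF
        has_vector_derivative_mult[OF has_vector_derivative_add[OF e1 em[of "k - 1"]] dc[of "k - 1"]]
        has_vector_derivative_mult[OF has_vector_derivative_add[OF ep em[of "k + 1"]] dc[of "k + 1"]]]
    by (rule has_vector_derivative_eq_rhs) (simp add: L_op'_def ring_distribs mult_ac)
  have 4: "((\<lambda>\<eta>. of_real \<eta> * L_op (\<omega> \<eta>) (c \<eta>) k) has_vector_derivative
     (L_op (\<omega> \<epsilon>) (c \<epsilon>) k + of_real \<epsilon> * (L_op (\<omega> \<epsilon>) w k + L_op' v (\<omega> \<epsilon>) (c \<epsilon>) k))) ?F"
    using has_vector_derivative_mult[OF i L] by (simp add: add.commute)
  show ?thesis unfolding mode_def mode'_def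
    by (intro has_vector_derivative_add 1 2 3 4)
qed

lemma cis_sum_bound: "cmod (cis x + cis y) \<le> 2"
  using norm_triangle_ineq[of "cis x" "cis y"] by simp

text \<open>Differentiating e^(-ij\<omega>) brings down j; together with the other exponential of
  \<open>L_op\<close> the weight is j + 1, at j = k - 1 and j = k + 1.\<close>

lemma L_op'_bound:
  "0 < k \<Longrightarrow> cmod (L_op' v \<omega> c k) \<le> \<bar>v\<bar> * (real k * cmod (c (k - 1)) + (real k + 2) * cmod (c (k + 1)))"
proof -
  assume k: "0 < k"
  have b: "cmod (- \<i> * cis x - \<i> * of_nat m * cis y) \<le> 1 + real m" "cmod (\<i> * cis x - \<i> * of_nat m * cis y) \<le> 1 + real m" for x y m
    using norm_triangle_ineq4[of "- \<i> * cis x" "\<i> * of_nat m * cis y"] norm_triangle_ineq4[of "\<i> * cis x" "\<i> * of_nat m * cis y"]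
    by (simp_all add: norm_mult)
  have k1: "1 + real (k - 1) = real k" "1 + real (k + 1) = real k + 2" using k by auto
  have "cmod ((- \<i> * cis (- \<omega>) - \<i> * of_nat (k - 1) * cis (- (real (k - 1) * \<omega>))) * c (k - 1)) \<le> real k * cmod (c (k - 1))"
    unfolding norm_mult using b(1)[of "- \<omega>" "k - 1"] unfolding k1 by (intro mult_right_mono) auto
  moreover have "cmod ((\<i> * cis \<omega> - \<i> * of_nat (k + 1) * cis (- (real (k + 1) * \<omega>))) * c (k + 1)) \<le> (real k + 2) * cmod (c (k + 1))"
    unfolding norm_mult using b(2)[of \<omega> "k + 1"] unfolding k1 by (intro mult_right_mono) auto
  ultimately show ?thesis
    unfolding L_op'_def norm_mult[of "of_real v"] norm_of_real
    by (intro mult_left_mono order_trans[OF norm_triangle_ineq] add_mono) auto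
qed

lemma sum_shift_le_suminf:
  fixes f :: "nat \<Rightarrow> real"
  assumes "summable f" "\<And>j. 0 \<le> f j"
  shows "(\<Sum>k=2..n. f (k - 1)) \<le> suminf f" "(\<Sum>k=2..n. f (k + 1)) \<le> suminf f" "(\<Sum>k=2..n. f k) \<le> suminf f"
proof -
  have *: "(\<Sum>k=2..n. f (g k)) \<le> suminf f" if "inj_on g {2..n}" for g
  proof -
    have "(\<Sum>k=2..n. f (g k)) = sum f (g ` {2..n})" using sum.reindex[OF that, of f] by simp
    also have "\<dots> \<le> suminf f" by (rule sum_le_suminf) (use assms in auto)
    finally show ?thesis .
  qed
  moreover have "inj_on (\<lambda>k. k - 1) {2..n}" by (rule inj_onI) (simp, arith)
  ultimately show "(\<Sum>k=2..n. f (k - 1)) \<le> suminf f" by blast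
  from *[of "\<lambda>k. k + 1"] *[of "\<lambda>k. k"]
  show "(\<Sum>k=2..n. f (k + 1)) \<le> suminf f" "(\<Sum>k=2..n. f k) \<le> suminf f"
    by (auto simp: inj_on_def)
qed
context zero_branch begin

text \<open>On the branch \<open>mode\<close> equals -\<epsilon> times the convolution, so
  -\<open>mode'\<close> is a limit of difference quotients of \<epsilon> times the convolution.
  Those are bounded by \<open>conv_lipschitz\<close> uniformly in the number of modes, and finite
  sums pass to the limit; no formula for the derivative of the convolution is required.\<close>

lemma mode'_sum_bound:
  assumes \<epsilon>: "\<epsilon> \<in> {0<..0.1}"
    and dv: "(\<omega>h has_real_derivative v) (at \<epsilon> within {0<..0.1})" and w: "w \<in> lK_0"
    and dw: "((\<lambda>\<eta>. l1_norm (K_inv (\<lambda>k. (ch \<eta> k - ch \<epsilon> k) / of_real (\<eta> - \<epsilon>) - w k))) \<longlongrightarrow> 0) (at \<epsilon> within {0<..0.1})"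
    and dr: "((\<lambda>\<eta>. \<omega>h \<eta> / \<alpha>h \<eta>) has_real_derivative r) (at \<epsilon> within {0<..0.1})"
  shows "(\<Sum>k=1..n. cmod (mode' \<epsilon> r (\<omega>h \<epsilon> / \<alpha>h \<epsilon>) v (\<omega>h \<epsilon>) w (ch \<epsilon>) k))
    \<le> (l1_norm (ch \<epsilon>))\<^sup>2 / 2 + \<epsilon> * ((\<bar>v\<bar> * l1_norm (K_inv (ch \<epsilon>)) * l1_norm (ch \<epsilon>)
      + l1_norm w * (l1_norm (ch \<epsilon>) + l1_norm (ch \<epsilon>))) / 2)"
proof -
  let ?I = "{0<..0.1::real}" and ?F = "at \<epsilon> within {0<..0.1}"
  let ?C = "\<lambda>\<eta>. l1_norm (ch \<eta>)" and ?q = "\<lambda>\<eta> k. conv (U_op (\<omega>h \<eta>) (ch \<eta>)) (ch \<eta>) k"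
  let ?m = "mode' \<epsilon> r (\<omega>h \<epsilon> / \<alpha>h \<epsilon>) v (\<omega>h \<epsilon>) w (ch \<epsilon>)"
  note Q = ch_quotient_l1[OF \<epsilon> w dw]
  have pos: "\<alpha>h \<eta> > 0" if "\<eta> \<in> ?I" for \<eta> using base_bounds(3)[OF that] pi_gt_zero by linarith
  \<comment> \<open>Every \<epsilon> in the interval is approached from the left, so the limit is
    over a proper filter at the end point 0.1 too.\<close>
  have nb: "?F \<noteq> bot"
  proof -
    have "\<epsilon> islimpt ?I"
      using islimpt_greaterThanLessThan2[of 0 \<epsilon>] \<epsilon> by (auto elim!: islimpt_subset)
    then show ?thesis by (simp add: trivial_limit_within)
  qed
  have evI: "\<forall>\<^sub>F \<eta> in ?F. \<eta> \<in> ?I \<and> \<eta> \<noteq> \<epsilon>" by (auto simp: eventually_at intro!: exI[of _ 1])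
  have eq: "of_real \<eta> * ?q \<eta> k = - mode \<eta> (\<omega>h \<eta> / \<alpha>h \<eta>) (\<omega>h \<eta>) (ch \<eta>) k" if "\<eta> \<in> ?I" for \<eta> k
    using ch_facts(5)[OF that, of k] pos[OF that] F_map_mode[of "\<alpha>h \<eta>" \<eta> "\<omega>h \<eta>" "ch \<eta>" k]
    by (simp add: eq_neg_iff_add_eq_0 add.commute)
  have dp: "((\<lambda>\<eta>. (of_real \<eta> * ?q \<eta> k - of_real \<epsilon> * ?q \<epsilon> k) / of_real (\<eta> - \<epsilon>)) \<longlongrightarrow> - ?m k) ?F" if "0 < k" for k
  proof -
    have "((\<lambda>\<eta>. - mode \<eta> (\<omega>h \<eta> / \<alpha>h \<eta>) (\<omega>h \<eta>) (ch \<eta>) k) has_vector_derivative - ?m k) ?F"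
      by (intro has_vector_derivative_minus mode_has_vector_derivative[where \<rho> = "\<lambda>\<eta>. \<omega>h \<eta> / \<alpha>h \<eta>"] dr dv Q that)
    then have "((\<lambda>\<eta>. of_real \<eta> * ?q \<eta> k) has_vector_derivative - ?m k) ?F"
      by (rule has_vector_derivative_transform[OF \<epsilon>, rotated]) (rule eq)
    then show ?thesis unfolding has_vector_derivative_iff_quotient .
  qed
  have lim1: "((\<lambda>\<eta>. \<Sum>k=1..n. cmod ((of_real \<eta> * ?q \<eta> k - of_real \<epsilon> * ?q \<epsilon> k) / of_real (\<eta> - \<epsilon>))) \<longlongrightarrow> (\<Sum>k=1..n. cmod (- ?m k))) ?F"
    by (intro tendsto_sum tendsto_norm dp) auto
  have C: "(?C \<longlongrightarrow> ?C \<epsilon>) ?F"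
  proof (rule LIM_zero_cancel, rule Lim_null_comparison[OF _ Q(3)])
    show "\<forall>\<^sub>F \<eta> in ?F. norm (?C \<eta> - ?C \<epsilon>) \<le> l1_norm (K_inv (\<lambda>k. ch \<eta> k - ch \<epsilon> k))"
      using evI
    proof eventually_elim
      case (elim \<eta>)
      then have \<eta>: "\<eta> \<in> ?I" by blast
      have K: "K_inv (\<lambda>k. ch \<eta> k - ch \<epsilon> k) = (\<lambda>k. K_inv (ch \<eta>) k - K_inv (ch \<epsilon>) k)"
        by (simp add: K_inv_def fun_eq_iff right_diff_distrib)
      have "l1_norm (\<lambda>k. ch \<eta> k - ch \<epsilon> k) \<le> l1_norm (K_inv (\<lambda>k. ch \<eta> k - ch \<epsilon> k))"
        by (rule l1_norm_le_K_inv) (use ch_facts[OF \<eta>] ch_facts[OF \<epsilon>] K l1_diff in auto)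
      then show ?case
        using l1_norm_triangle[OF l1_diff[OF ch_facts(1)[OF \<eta>] ch_facts(1)[OF \<epsilon>]] ch_facts(1)[OF \<epsilon>]]
          l1_norm_triangle[OF l1_diff[OF ch_facts(1)[OF \<epsilon>] ch_facts(1)[OF \<eta>]] ch_facts(1)[OF \<eta>]]
          l1_norm_diff_swap[of "ch \<eta>" "ch \<epsilon>"] by simp
    qed
  qed
  let ?B = "\<lambda>\<eta>. (?C \<eta>)\<^sup>2 / 2 + \<epsilon> * ((\<bar>(\<omega>h \<eta> - \<omega>h \<epsilon>) / (\<eta> - \<epsilon>)\<bar> * l1_norm (K_inv (ch \<epsilon>)) * ?C \<epsilon>
      + l1_norm (\<lambda>k. ch \<eta> k - ch \<epsilon> k) / \<bar>\<eta> - \<epsilon>\<bar> * (?C \<epsilon> + ?C \<eta>)) / 2)"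
  have lim2: "(?B \<longlongrightarrow> (?C \<epsilon>)\<^sup>2 / 2 + \<epsilon> * ((\<bar>v\<bar> * l1_norm (K_inv (ch \<epsilon>)) * ?C \<epsilon> + l1_norm w * (?C \<epsilon> + ?C \<epsilon>)) / 2)) ?F"
    by (intro tendsto_intros C Q(1) dv[unfolded has_field_derivative_iff]) auto
  have "(\<Sum>k=1..n. cmod (- ?m k)) \<le> (?C \<epsilon>)\<^sup>2 / 2 + \<epsilon> * ((\<bar>v\<bar> * l1_norm (K_inv (ch \<epsilon>)) * ?C \<epsilon> + l1_norm w * (?C \<epsilon> + ?C \<epsilon>)) / 2)"
  proof (rule tendsto_le[OF nb lim2 lim1])
    show "\<forall>\<^sub>F \<eta> in ?F. (\<Sum>k=1..n. cmod ((of_real \<eta> * ?q \<eta> k - of_real \<epsilon> * ?q \<epsilon> k) / of_real (\<eta> - \<epsilon>))) \<le> ?B \<eta>"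
      using evI
    proof eventually_elim
      case (elim \<eta>)
      then have \<eta>: "\<eta> \<in> ?I" and ne: "\<eta> \<noteq> \<epsilon>" by blast+
      let ?h = "\<bar>\<eta> - \<epsilon>\<bar>"
      have h: "?h > 0" using ne by simp
      have e: "\<epsilon> > 0" using \<epsilon> by simp
      have t: "cmod ((of_real \<eta> * ?q \<eta> k - of_real \<epsilon> * ?q \<epsilon> k) / of_real (\<eta> - \<epsilon>))
        \<le> cmod (?q \<eta> k) + \<epsilon> * (cmod (?q \<epsilon> k - ?q \<eta> k) / ?h)" for k
      proof -
        have "(of_real \<eta> * ?q \<eta> k - of_real \<epsilon> * ?q \<epsilon> k) = of_real (\<eta> - \<epsilon>) * ?q \<eta> k + of_real \<epsilon> * (?q \<eta> k - ?q \<epsilon> k)"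
          by (simp add: algebra_simps)
        then have "cmod (of_real \<eta> * ?q \<eta> k - of_real \<epsilon> * ?q \<epsilon> k) \<le> ?h * cmod (?q \<eta> k) + \<epsilon> * cmod (?q \<epsilon> k - ?q \<eta> k)"
          using norm_triangle_ineq[of "of_real (\<eta> - \<epsilon>) * ?q \<eta> k" "of_real \<epsilon> * (?q \<eta> k - ?q \<epsilon> k)"] e
          by (simp add: norm_mult norm_minus_commute[of "?q \<epsilon> k"] del: of_real_diff)
        then have "cmod (of_real \<eta> * ?q \<eta> k - of_real \<epsilon> * ?q \<epsilon> k) / ?h \<le> (?h * cmod (?q \<eta> k) + \<epsilon> * cmod (?q \<epsilon> k - ?q \<eta> k)) / ?h"
          using h by (intro divide_right_mono) auto
        then show ?thesis using h by (simp add: norm_divide add_divide_distrib del: of_real_diff)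
      qed
      have "(\<Sum>k=1..n. cmod ((of_real \<eta> * ?q \<eta> k - of_real \<epsilon> * ?q \<epsilon> k) / of_real (\<eta> - \<epsilon>)))
        \<le> (\<Sum>k=1..n. cmod (?q \<eta> k) + \<epsilon> * (cmod (?q \<epsilon> k - ?q \<eta> k) / ?h))"
        by (intro sum_mono t)
      also have "\<dots> = (\<Sum>k=1..n. cmod (?q \<eta> k)) + \<epsilon> * ((\<Sum>k=1..n. cmod (?q \<epsilon> k - ?q \<eta> k)) / ?h)"
        by (simp add: sum.distrib sum_distrib_left sum_divide_distrib)
      also have "\<dots> \<le> ?B \<eta>"
      proof (intro add_mono mult_left_mono)
        show "(\<Sum>k=1..n. cmod (?q \<eta> k)) \<le> (?C \<eta>)\<^sup>2 / 2"
          using conv_norm[of "U_op (\<omega>h \<eta>) (ch \<eta>)" "ch \<eta>" n] ch_facts[OF \<eta>] by (simp add: power2_eq_square)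
        \<comment> \<open>\<open>ch \<epsilon>\<close> takes the first place in
          \<open>conv_lipschitz\<close>, so the weighted norm belongs to the fixed point and only
          unweighted norms vary with \<eta>.\<close>
        have "(\<Sum>k=1..n. cmod (?q \<epsilon> k - ?q \<eta> k)) / ?h \<le> (\<bar>\<omega>h \<epsilon> - \<omega>h \<eta>\<bar> * l1_norm (K_inv (ch \<epsilon>)) * ?C \<epsilon>
           + l1_norm (\<lambda>k. ch \<epsilon> k - ch \<eta> k) * (?C \<epsilon> + ?C \<eta>)) / 2 / ?h"
          using h conv_lipschitz[of "ch \<epsilon>" "ch \<eta>" "\<omega>h \<epsilon>" "\<omega>h \<eta>" n] ch_facts[OF \<eta>] ch_facts[OF \<epsilon>]
          by (intro divide_right_mono) auto
        also have "\<dots> = (\<bar>(\<omega>h \<eta> - \<omega>h \<epsilon>) / (\<eta> - \<epsilon>)\<bar> * l1_norm (K_inv (ch \<epsilon>)) * ?C \<epsilon>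
           + l1_norm (\<lambda>k. ch \<eta> k - ch \<epsilon> k) / ?h * (?C \<epsilon> + ?C \<eta>)) / 2"
          using l1_norm_diff_swap[of "ch \<epsilon>" "ch \<eta>"] abs_minus_commute[of "\<omega>h \<epsilon>" "\<omega>h \<eta>"]
          by (simp add: abs_divide add_divide_distrib)
        finally show "(\<Sum>k=1..n. cmod (?q \<epsilon> k - ?q \<eta> k)) / ?h \<le> (\<bar>(\<omega>h \<eta> - \<omega>h \<epsilon>) / (\<eta> - \<epsilon>)\<bar> * l1_norm (K_inv (ch \<epsilon>)) * ?C \<epsilon>
           + l1_norm (\<lambda>k. ch \<eta> k - ch \<epsilon> k) / ?h * (?C \<epsilon> + ?C \<eta>)) / 2" .
      qed (use e in simp)
      finally show ?case .
    qed
  qed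
  then show ?thesis by simp
qed

end

lemma L_op'_bound_12:
  "cmod (L_op' v \<omega> c 1) \<le> \<bar>v\<bar> * (cmod (c 0) + 3 * cmod (c 2))"
  "cmod (L_op' v \<omega> c 2) \<le> \<bar>v\<bar> * (2 * cmod (c 1) + 4 * cmod (c 3))"
proof -
  have *: "(1::nat) + 1 = 2" "(2::nat) + 1 = 3" "(1::nat) - 1 = 0" "(2::nat) - 1 = 1"
    "real 1 = 1" "real 2 = 2" "(1::real) + 2 = 3" "(2::real) + 2 = 4"
    by simp_all
  show "cmod (L_op' v \<omega> c 1) \<le> \<bar>v\<bar> * (cmod (c 0) + 3 * cmod (c 2))"
    using L_op'_bound[of 1 v \<omega> c] unfolding * by simp
  show "cmod (L_op' v \<omega> c 2) \<le> \<bar>v\<bar> * (2 * cmod (c 1) + 4 * cmod (c 3))"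
    using L_op'_bound[of 2 v \<omega> c] unfolding * by simp
qed

text \<open>In these numerical lemmas \<open>e = \<epsilon>\<close>, \<open>R = \<bar>\<rho>'\<bar> + \<bar>\<omega>'\<bar>\<close>, \<open>Y = \<epsilon> \<Sum>\<bar>c'\<^sub>k\<bar>\<close>, \<open>S\<close> bounds the derivative of the
  quadratic term, and \<open>E\<close> is the error of the leading-order equation for mode one. A first crude
  pass closes the system for \<open>R\<close>, \<open>Y\<close>, \<open>S\<close>; the second pass makes \<open>E\<close> small enough.\<close>

lemma numerics_step1:
  fixes e R Y S Z :: real
  assumes "0 < e" "S \<le> 446/10000 * e + 16/10000 * R + 189/1000 * Y"
    "158/100 * Y \<le> 11888/10000 * e + 301/10000 * R + 1/10 * S"
    "R \<le> 2 * Z" "Z \<le> 165/10000 * R + 675/1000 * e + 143/100 * Y + S"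
  shows "R \<le> 44/10 * e" "Y \<le> 86/100 * e" "S \<le> 22/100 * e"
  using assms by linarith+

text \<open>The letters stand for products: a = \<epsilon> R P, b = \<epsilon> C, d = \<epsilon> Y,
  f = \<epsilon>^2 R (P + C), g = \<epsilon>^2 R, h = \<epsilon> S, with P and C the sums of k |c_k|
  and |c_k|. Treating them as atoms leaves linear arithmetic.\<close>

lemma numerics_Y:
  fixes a b d e f g h R S Y :: real
  assumes "1.98 * Y \<le> a + 4 * b + 4 * d + 2 * f + e + g + h" "a \<le> (1/10) * (R * 0.1596)" "b \<le> e * 0.0472"
    "f \<le> (1/10) * ((1/10) * (R * (0.1596 + 0.0472)))" "g \<le> (1/10) * (1/10 * R)" "d \<le> 1/10 * Y" "h \<le> 1/10 * S" "0 \<le> R"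
  shows "158/100 * Y \<le> 11888/10000 * e + 301/10000 * R + 1/10 * S"
  using assms by simp

text \<open>V = \<epsilon> |c'_2 - \<kappa>| with \<kappa> = (2 - i) / 5; the letters a, b, d, q
  stand for \<epsilon> S, \<epsilon> R, \<epsilon> Y, \<epsilon>^2.\<close>

lemma numerics_V:
  fixes a b d e q R S V Y :: real
  assumes "2.2 * V \<le> a + 0.1954 * b + 0.0104 * e + 0.0493 * q + 2 * d" "a \<le> 1/10 * S" "b \<le> 1/10 * R"
    "d \<le> 1/10 * Y" "q \<le> e / 10" "0 \<le> R" "0 < e"
  shows "22/10 * V \<le> 196/10000 * R + 154/10000 * e + 2/10 * Y + 1/10 * S"
  using assms by simp

lemma numerics_E:
  fixes x y z p s e R S V E :: real
  assumes "E \<le> x + y + z + p + s" "x \<le> 0.0023 * R" "y \<le> 1.43 * (0.02465 * e + V)"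
    "z \<le> 0.0069 * (2 * e * 0.4473)" "p \<le> 142/10000 * R" "s \<le> S" "0 < e"
  shows "E \<le> 165/10000 * R + 62/10000 * e + 143/100 * (247/10000 * e + V) + S"
proof -
  have "y \<le> 3526/100000 * e + 143/100 * V" "z \<le> 618/100000 * e" "x \<le> 23/10000 * R"
    using assms(2-4,7) by (simp_all add: ring_distribs)
  then show ?thesis using assms(1,5-7) by (simp add: ring_distribs)
qed

lemma numerics_step2:
  fixes e R Y S V E :: real
  assumes "0 < e" "R \<le> 44/10 * e" "Y \<le> 86/100 * e" "S \<le> 22/100 * e"
    "22/10 * V \<le> 196/10000 * R + 154/10000 * e + 2/10 * Y + 1/10 * S"
    "E \<le> 165/10000 * R + 62/10000 * e + 143/100 * (247/10000 * e + V) + S"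
  shows "E \<le> 54/100 * e"
  using assms by argo

section \<open>Sign of the derivative of \<alpha>\<close>

context zero_branch begin

text \<open>The distance of \<omega> to pi / 2 is at most 0.00226 and \<open>cis\<close> is
  1-Lipschitz; the ratio is at worst about 1 - 0.01029 / 1.5788, where 0.01029 = 0.00226 +
  0.00803.\<close>

lemma cis_bounds:
  assumes "\<epsilon> \<in> {0<..0.1}"
  defines "\<omega> \<equiv> \<omega>h \<epsilon>"
  shows "cmod (cis (- \<omega>) + \<i>) \<le> 0.0023" "cmod (cis \<omega> - \<i>) \<le> 0.0023" "cmod (cis (- (2 * \<omega>)) + 1) \<le> 0.0046"
    "0.9934 \<le> \<omega> / \<alpha>h \<epsilon>" "\<omega> / \<alpha>h \<epsilon> \<le> 1"
proof -
  note b = base_bounds[OF assms(1), folded \<omega>_def]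
  have c: "cis (- (pi / 2)) = - \<i>" "cis (pi / 2) = \<i>" "cis (- (2 * (pi / 2))) = - 1" by (simp_all add: complex_eq_iff)
  show "cmod (cis (- \<omega>) + \<i>) \<le> 0.0023"
    using cis_lipschitz[of "- \<omega>" "- (pi / 2)"] b unfolding c by simp
  show "cmod (cis \<omega> - \<i>) \<le> 0.0023"
    using cis_lipschitz[of "\<omega>" "pi / 2"] b unfolding c by simp
  show "cmod (cis (- (2 * \<omega>)) + 1) \<le> 0.0046"
    using cis_lipschitz[of "- (2 * \<omega>)" "- (2 * (pi / 2))"] b unfolding c by simp
  have pi: "3.1415 < pi" "pi < 3.1416" using pi_approx by simp_all
  show "\<omega> / \<alpha>h \<epsilon> \<le> 1" using b pi by simp
  show "0.9934 \<le> \<omega> / \<alpha>h \<epsilon>" using b pi by (simp add: field_simps)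
qed

text \<open>(2 - i) / 5 times 2 i - 1 is i, so the quantity in the upper bound vanishes at the Hopf
  point and is at most 0.0023 + 0.4473 * 0.0178 here. The lower bounds are sqrt 5 - 0.0178 for k = 2
  and 3 * 0.9934 - 1 = 1.9802 for k \<ge> 3.\<close>

lemma mode_symbol_lower:
  assumes "\<epsilon> \<in> {0<..0.1}"
  defines "\<omega> \<equiv> \<omega>h \<epsilon>" and "\<rho> \<equiv> \<omega>h \<epsilon> / \<alpha>h \<epsilon>"
  shows "cmod (cis (- \<omega>) + (2 - \<i>) / 5 * (\<i> * of_nat 2 * of_real \<rho> + cis (- (2 * \<omega>)))) \<le> 0.0104"
    "2.2 \<le> cmod (\<i> * of_nat 2 * of_real \<rho> + cis (- (2 * \<omega>)))"
    "2 \<le> k \<Longrightarrow> 1.98 \<le> cmod (\<i> * of_nat k * of_real \<rho> + cis (- (real k * \<omega>)))"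
proof -
  note b = cis_bounds[OF assms(1), folded \<rho>_def \<omega>_def]
  let ?D = "\<i> * of_nat 2 * of_real \<rho> + cis (- (2 * \<omega>))" and ?k = "(2 - \<i>) / 5"
  have k: "cmod ?k \<le> 0.4473" "cmod (2 * \<i> - 1) \<ge> 2.236"
    using cmod_kappa sqrt5 by (blast, simp add: cmod_def)
  have eq: "?D - (2 * \<i> - 1) = 2 * \<i> * of_real (\<rho> - 1) + (cis (- (2 * \<omega>)) + 1)"
    by (simp add: algebra_simps)
  have "cmod (2 * \<i> * of_real (\<rho> - 1)) \<le> 0.0132" using b by (simp add: norm_mult del: of_real_diff)
  then have d: "cmod (?D - (2 * \<i> - 1)) \<le> 0.0178"
    unfolding eq using norm_triangle_ineq[of "2 * \<i> * of_real (\<rho> - 1)" "cis (- (2 * \<omega>)) + 1"] b(3) by simp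
  then show D: "2.2 \<le> cmod ?D"
    using k(2) norm_triangle_ineq2[of "2 * \<i> - 1" ?D] by (simp add: norm_minus_commute)
  have "cis (- \<omega>) + ?k * ?D = (cis (- \<omega>) + \<i>) + ?k * (?D - (2 * \<i> - 1))"
    by (simp add: complex_eq_iff field_simps)
  also have "cmod \<dots> \<le> 0.0023 + 0.4473 * 0.0178"
    by (intro order_trans[OF norm_triangle_ineq] add_mono b(1)) (unfold norm_mult, intro mult_mono k(1) d; simp)
  finally show "cmod (cis (- \<omega>) + ?k * ?D) \<le> 0.0104" by simp
  assume "2 \<le> k"
  then consider "k = 2" | "3 \<le> k" by linarith
  then show "1.98 \<le> cmod (\<i> * of_nat k * of_real \<rho> + cis (- (real k * \<omega>)))"
  proof cases
    case 1 then show ?thesis using D by simp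
  next
    case 2
    have "3 * 0.9934 \<le> real k * \<rho>" using 2 b by (intro mult_mono) auto
    moreover have "cmod (\<i> * of_nat k * of_real \<rho>) = real k * \<rho>" using b by (simp add: norm_mult)
    ultimately show ?thesis
      using norm_diff_ineq[of "\<i> * of_nat k * of_real \<rho>" "cis (- (real k * \<omega>))"] by simp
  qed
qed

lemma alpha_derivative_positive:
  assumes \<epsilon>: "\<epsilon> \<in> {0<..0.1}"
  shows "\<exists>d>0. (\<alpha>h has_real_derivative d) (at \<epsilon> within {0<..0.1})"
proof -
  obtain u v w where du: "(\<alpha>h has_real_derivative u) (at \<epsilon> within {0<..0.1})"
    and dv: "(\<omega>h has_real_derivative v) (at \<epsilon> within {0<..0.1})" and w: "w \<in> lK_0"
    and dw: "((\<lambda>\<eta>. l1_norm (K_inv (\<lambda>k. (ch \<eta> k - ch \<epsilon> k) / of_real (\<eta> - \<epsilon>) - w k))) \<longlongrightarrow> 0) (at \<epsilon> within {0<..0.1})"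
    using first_derivatives[OF \<epsilon>] .
  define \<alpha> where "\<alpha> = \<alpha>h \<epsilon>"
  define \<omega> where "\<omega> = \<omega>h \<epsilon>"
  define c where "c = ch \<epsilon>"
  define \<rho> where "\<rho> = \<omega> / \<alpha>"
  define r where "r = (v * \<alpha> - \<omega> * u) / \<alpha>\<^sup>2"
  have pi: "3.1415 < pi" "pi < 3.1416" using pi_approx by simp_all
  note b = base_bounds[OF \<epsilon>, folded \<alpha>_def \<omega>_def c_def]
  have \<alpha>: "1.57 < \<alpha>" "\<alpha> < 1.58" and \<omega>: "0 < \<omega>" using b pi by simp_all
  have dr: "((\<lambda>\<eta>. \<omega>h \<eta> / \<alpha>h \<eta>) has_real_derivative r) (at \<epsilon> within {0<..0.1})"
    using \<alpha> by (auto intro!: derivative_eq_intros du dv simp: r_def \<alpha>_def[symmetric] \<omega>_def[symmetric] power2_eq_square)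
  note cf = ch_facts[OF \<epsilon>, folded c_def]
  have wf: "w \<in> l1" "w 0 = 0" "w 1 = 0" "K_inv w \<in> l1" using w by (auto simp: lK_0_def l1_0_def l1_def)
  note cb = cis_bounds[OF \<epsilon>, folded \<alpha>_def \<omega>_def, folded \<rho>_def]
  note sb = mode_symbol_lower[OF \<epsilon>, folded \<alpha>_def \<omega>_def, folded \<rho>_def]
  define m where "m = mode' \<epsilon> r \<rho> v \<omega> w c"
  define R where "R = \<bar>r\<bar> + \<bar>v\<bar>"
  define W where "W = (\<Sum>k. cmod (w k))"
  define C where "C = (\<Sum>k. cmod (c k))"
  define P where "P = (\<Sum>k. cmod (K_inv c k))"
  define S where "S = (l1_norm c)\<^sup>2 / 2 + \<epsilon> * ((\<bar>v\<bar> * l1_norm (K_inv c) * l1_norm c + l1_norm w * (l1_norm c + l1_norm c)) / 2)"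
  \<comment> \<open>W is only bounded by a constant while R will be of order \<epsilon>; the factor
    \<epsilon> puts R, Y and S on the same scale.\<close>
  define Y where "Y = \<epsilon> * W"
  have e: "0 < \<epsilon>" "\<epsilon> \<le> 1 / 10" using \<epsilon> by auto
  note e2 = eps_sq[OF \<epsilon>]
  have msum: "(\<Sum>k=1..n. cmod (m k)) \<le> S" for n
    using mode'_sum_bound[OF \<epsilon> dv w dw dr, of n] unfolding m_def S_def \<rho>_def \<alpha>_def \<omega>_def c_def .
  have R0: "0 \<le> R" "\<bar>v\<bar> \<le> R" "\<bar>r\<bar> \<le> R" by (simp_all add: R_def)
  have W0: "0 \<le> W" and C0: "0 \<le> C" and P0: "0 \<le> P"
    using wf cf by (simp_all add: W_def C_def P_def suminf_nonneg l1_def)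
  have norms: "l1_norm c = 2 * C" "l1_norm w = 2 * W" "l1_norm (K_inv c) = 2 * P"
    by (simp_all add: l1_norm_def C_def W_def P_def)
  have C: "C \<le> 0.472 * \<epsilon>" using b(7) unfolding norms by simp
  have C': "C \<le> 0.0472" using C e by simp
  have P: "P \<le> 0.1596" using cf(6) unfolding norms by simp
  have Y0: "0 \<le> Y" using e W0 by (simp add: Y_def)
  have \<epsilon>R: "\<epsilon> * R \<le> 1 / 10 * R" using e R0 by (intro mult_right_mono) auto
  have \<epsilon>Y: "\<epsilon> * Y \<le> 1 / 10 * Y" using e Y0 by (intro mult_right_mono) auto
  have S_eq: "S = 2 * (C * C) + 2 * (\<epsilon> * (\<bar>v\<bar> * (P * C))) + 4 * (Y * C)"
    unfolding S_def norms Y_def by (simp add: power2_eq_square algebra_simps)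
  have S1: "S \<le> 446/10000 * \<epsilon> + 16/10000 * R + 189/1000 * Y"
  proof -
    have "C * C \<le> (0.472 * \<epsilon>) * 0.0472" using C C' C0 e by (intro mult_mono) auto
    moreover have "\<epsilon> * (\<bar>v\<bar> * (P * C)) \<le> (1/10) * (R * (0.1596 * 0.0472))"
      using e R0 P P0 C' C0 by (intro mult_mono) auto
    moreover have "Y * C \<le> Y * 0.0472" using Y0 C' by (intro mult_left_mono)
    ultimately show ?thesis unfolding S_eq using e R0 Y0 by simp
  qed
  have S0: "0 \<le> S" unfolding S_eq using C0 P0 Y0 e by simp
  have \<epsilon>S: "\<epsilon> * S \<le> 1 / 10 * S" using e S0 by (intro mult_right_mono) auto
  have mb: "cmod (m k) \<le> S" if "0 < k" for k
    using member_le_sum[of k "{1..k}" "\<lambda>k. cmod (m k)"] msum[of k] that by simp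
  have cle: "cmod (c k) \<le> C" for k
    using cmod_le_tail[OF cf(1), of k] tail_antimono[OF cf(1), of 0 k] by (simp add: tail_def C_def)
  have wle: "cmod (w k) \<le> W" for k
    using cmod_le_tail[OF wf(1), of k] tail_antimono[OF wf(1), of 0 k] by (simp add: tail_def W_def)
  have dsym: "cmod (\<i> * of_nat k * of_real r - \<i> * of_nat k * of_real v * cis (- (real k * \<omega>))) \<le> real k * R" for k
  proof -
    have "cmod (\<i> * of_nat k * of_real r - \<i> * of_nat k * of_real v * cis (- (real k * \<omega>)))
      \<le> real k * \<bar>r\<bar> + real k * \<bar>v\<bar>"
      using norm_triangle_ineq4[of "\<i> * of_nat k * of_real r" "\<i> * of_nat k * of_real v * cis (- (real k * \<omega>))"]
      by (simp add: norm_mult)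
    then show ?thesis by (simp add: R_def ring_distribs)
  qed
  \<comment> \<open>Each differentiated mode k \<ge> 2 is solved for its diagonal term, whose symbol
    is at least 1.98 in modulus, and the results are summed; every neighbour in \<open>L_op\<close>
    costs a factor 2.\<close>
  have W_ineq: "1.98 * W \<le> R * P + 4 * C + 4 * Y + 2 * (\<epsilon> * (R * (P + C))) + 1 + \<epsilon> * R + S"
  proof -
    have mode_le: "1.98 * cmod (w k) \<le> R * cmod (K_inv c k) + (if k = 2 then 1 + \<epsilon> * R else 0)
        + (2 * cmod (c (k - 1)) + 2 * cmod (c (k + 1))) + \<epsilon> * (2 * cmod (w (k - 1)) + 2 * cmod (w (k + 1)))
        + \<epsilon> * (R * ((cmod (K_inv c (k - 1)) + cmod (c (k - 1))) + (cmod (K_inv c (k + 1)) + cmod (c (k + 1))))) + cmod (m k)"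
      if k: "2 \<le> k" for k
    proof -
      let ?A = "(\<i> * of_nat k * of_real \<rho> + cis (- (real k * \<omega>))) * w k"
      let ?B = "(\<i> * of_nat k * of_real r - \<i> * of_nat k * of_real v * cis (- (real k * \<omega>))) * c k"
      let ?E = "if k = 2 then cis (- \<omega>) - \<i> * of_real \<epsilon> * of_real v * cis (- \<omega>) else 0"
      have "?A = m k - ?B - ?E - L_op \<omega> c k - of_real \<epsilon> * L_op \<omega> w k - of_real \<epsilon> * L_op' v \<omega> c k"
        using k by (simp add: m_def mode'_def ring_distribs)
      then have "cmod ?A \<le> cmod (m k) + cmod ?B + cmod ?E + cmod (L_op \<omega> c k) + cmod (of_real \<epsilon> * L_op \<omega> w k) + cmod (of_real \<epsilon> * L_op' v \<omega> c k)"
        by (auto intro!: order_trans[OF norm_triangle_ineq4] add_mono simp del: mult_eq_0_iff)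
      moreover have "1.98 * cmod (w k) \<le> cmod ?A"
        unfolding norm_mult using sb(3)[OF k] by (intro mult_right_mono) auto
      moreover have "cmod ?B \<le> R * cmod (K_inv c k)"
        using mult_right_mono[OF dsym[of k] norm_ge_zero[of "c k"]] by (simp add: norm_mult K_inv_def mult_ac)
      moreover have "cmod ?E \<le> (if k = 2 then 1 + \<epsilon> * R else 0)"
      proof -
        have "cmod (cis (- \<omega>) - \<i> * of_real \<epsilon> * of_real v * cis (- \<omega>)) \<le> 1 + \<epsilon> * \<bar>v\<bar>"
          using norm_triangle_ineq4[of "cis (- \<omega>)" "\<i> * of_real \<epsilon> * of_real v * cis (- \<omega>)"] e by (simp add: norm_mult)
        also have "\<dots> \<le> 1 + \<epsilon> * R" using e R0 by (intro add_mono mult_left_mono) auto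
        finally show ?thesis by simp
      qed
      moreover have "cmod (L_op \<omega> c k) \<le> 2 * cmod (c (k - 1)) + 2 * cmod (c (k + 1))"
        using k by (intro L_op_bound) auto
      moreover have "cmod (of_real \<epsilon> * L_op \<omega> w k) \<le> \<epsilon> * (2 * cmod (w (k - 1)) + 2 * cmod (w (k + 1)))"
        using k e L_op_bound[of k \<omega> w] by (simp add: norm_mult)
      moreover have "cmod (of_real \<epsilon> * L_op' v \<omega> c k)
         \<le> \<epsilon> * (R * ((cmod (K_inv c (k - 1)) + cmod (c (k - 1))) + (cmod (K_inv c (k + 1)) + cmod (c (k + 1)))))"
      proof -
        \<comment> \<open>k = (k - 1) + 1 and k + 2 = (k + 1) + 1 split each weight of
          \<open>L_op'\<close> into a \<open>K_inv\<close> part and an unweighted part.\<close>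
        have k1: "real k = real (k - 1) + 1" "real k + 2 = real (k + 1) + 1" using k by auto
        have "(real j + 1) * cmod (c j) = cmod (K_inv c j) + cmod (c j)" for j
          by (simp only: K_inv_def norm_mult norm_of_nat ring_distribs mult_1)
        from this[of "k - 1"] this[of "k + 1"] have "cmod (L_op' v \<omega> c k) \<le> \<bar>v\<bar> * ((cmod (K_inv c (k - 1)) + cmod (c (k - 1))) + (cmod (K_inv c (k + 1)) + cmod (c (k + 1))))"
          using L_op'_bound[of k v \<omega> c] k by (simp only: k1[symmetric])
        also have "\<dots> \<le> R * ((cmod (K_inv c (k - 1)) + cmod (c (k - 1))) + (cmod (K_inv c (k + 1)) + cmod (c (k + 1))))"
          using R0 by (intro mult_right_mono) auto
        finally show ?thesis using e by (simp add: norm_mult)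
      qed
      ultimately show ?thesis by linarith
    qed
    have sc: "summable (\<lambda>k. cmod (c k))" "summable (\<lambda>k. cmod (w k))" "summable (\<lambda>k. cmod (K_inv c k))"
      using cf wf by (simp_all add: l1_def)
    have sKc: "summable (\<lambda>k. cmod (K_inv c k) + cmod (c k))" by (intro summable_add sc)
    have PC: "(\<Sum>k. cmod (K_inv c k) + cmod (c k)) = P + C" unfolding P_def C_def by (rule suminf_add[symmetric]) (rule sc)+
    have bound: "1.98 * (\<Sum>k=2..n. cmod (w k)) \<le> R * P + 4 * C + 4 * Y + 2 * (\<epsilon> * (R * (P + C))) + 1 + \<epsilon> * R + S" for n
    proof -
      have "1.98 * (\<Sum>k=2..n. cmod (w k)) \<le> (\<Sum>k=2..n. R * cmod (K_inv c k) + (if k = 2 then 1 + \<epsilon> * R else 0)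
        + (2 * cmod (c (k - 1)) + 2 * cmod (c (k + 1))) + \<epsilon> * (2 * cmod (w (k - 1)) + 2 * cmod (w (k + 1)))
        + \<epsilon> * (R * ((cmod (K_inv c (k - 1)) + cmod (c (k - 1))) + (cmod (K_inv c (k + 1)) + cmod (c (k + 1))))) + cmod (m k))"
        unfolding sum_distrib_left by (intro sum_mono mode_le) auto
      also have "\<dots> = R * (\<Sum>k=2..n. cmod (K_inv c k)) + (\<Sum>k=2..n. if k = 2 then 1 + \<epsilon> * R else 0)
        + (2 * (\<Sum>k=2..n. cmod (c (k - 1))) + 2 * (\<Sum>k=2..n. cmod (c (k + 1))))
        + \<epsilon> * (2 * (\<Sum>k=2..n. cmod (w (k - 1))) + 2 * (\<Sum>k=2..n. cmod (w (k + 1))))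
        + \<epsilon> * (R * ((\<Sum>k=2..n. cmod (K_inv c (k - 1)) + cmod (c (k - 1))) + (\<Sum>k=2..n. cmod (K_inv c (k + 1)) + cmod (c (k + 1)))))
        + (\<Sum>k=2..n. cmod (m k))"
        by (simp only: sum.distrib sum_distrib_left[symmetric])
      also have "\<dots> \<le> R * P + (1 + \<epsilon> * R) + (2 * C + 2 * C) + \<epsilon> * (2 * W + 2 * W)
        + \<epsilon> * (R * ((P + C) + (P + C))) + S"
      proof (intro add_mono mult_left_mono)
        show "(\<Sum>k=2..n. cmod (K_inv c k)) \<le> P" unfolding P_def by (rule sum_shift_le_suminf(3)[OF sc(3)]) simp
        show "(\<Sum>k=2..n. if k = 2 then 1 + \<epsilon> * R else 0) \<le> 1 + \<epsilon> * R" using e R0 by (simp add: sum.delta)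
        show "(\<Sum>k=2..n. cmod (c (k - 1))) \<le> C" "(\<Sum>k=2..n. cmod (c (k + 1))) \<le> C"
          unfolding C_def by (rule sum_shift_le_suminf[OF sc(1)]; simp)+
        show "(\<Sum>k=2..n. cmod (w (k - 1))) \<le> W" "(\<Sum>k=2..n. cmod (w (k + 1))) \<le> W"
          unfolding W_def by (rule sum_shift_le_suminf[OF sc(2)]; simp)+
        show "(\<Sum>k=2..n. cmod (K_inv c (k - 1)) + cmod (c (k - 1))) \<le> P + C"
          "(\<Sum>k=2..n. cmod (K_inv c (k + 1)) + cmod (c (k + 1))) \<le> P + C"
          unfolding PC[symmetric] by (rule sum_shift_le_suminf[OF sKc]; simp)+
        have "(\<Sum>k=2..n. cmod (m k)) \<le> (\<Sum>k=1..n. cmod (m k))" by (rule sum_mono2) auto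
        then show "(\<Sum>k=2..n. cmod (m k)) \<le> S" using msum[of n] by linarith
      qed (use e R0 in auto)
      finally show ?thesis by (simp add: Y_def algebra_simps)
    qed
    have "W = (\<Sum>k. cmod (w (k + 2)))"
      using tail_Suc[OF wf(1), of 0] tail_Suc[OF wf(1), of 1] wf by (simp add: W_def tail_def numeral_2_eq_2)
    also have "1.98 * \<dots> = (\<Sum>k. 1.98 * cmod (w (k + 2)))" by (rule suminf_mult[symmetric, OF tail_summable[OF wf(1)]])
    also have "\<dots> \<le> R * P + 4 * C + 4 * Y + 2 * (\<epsilon> * (R * (P + C))) + 1 + \<epsilon> * R + S"
    proof (rule suminf_le_const[OF summable_mult[OF tail_summable[OF wf(1)]]])
      fix n
      have "(\<Sum>k<n. cmod (w (k + 2))) = (\<Sum>k=2..n+1. cmod (w k))"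
        by (rule sum.reindex_bij_witness[where i = "\<lambda>k. k - 2" and j = "\<lambda>k. k + 2"]) auto
      then show "(\<Sum>k<n. 1.98 * cmod (w (k + 2))) \<le> R * P + 4 * C + 4 * Y + 2 * (\<epsilon> * (R * (P + C))) + 1 + \<epsilon> * R + S"
        using bound[of "n + 1"] by (simp only: sum_distrib_left[symmetric])
    qed
    finally show ?thesis .
  qed
  have Y1: "158/100 * Y \<le> 11888/10000 * \<epsilon> + 301/10000 * R + 1/10 * S"
  proof -
    have "\<epsilon> * (1.98 * W) \<le> \<epsilon> * (R * P + 4 * C + 4 * Y + 2 * (\<epsilon> * (R * (P + C))) + 1 + \<epsilon> * R + S)"
      using e by (intro mult_left_mono W_ineq) auto
    then have 1: "1.98 * Y \<le> \<epsilon> * (R * P) + 4 * (\<epsilon> * C) + 4 * (\<epsilon> * Y) + 2 * (\<epsilon> * (\<epsilon> * (R * (P + C)))) + \<epsilon> + \<epsilon> * (\<epsilon> * R) + \<epsilon> * S"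
      by (simp add: Y_def algebra_simps)
    have 2: "\<epsilon> * (R * P) \<le> (1/10) * (R * 0.1596)" using e R0 P P0 by (intro mult_mono) auto
    have 3: "\<epsilon> * C \<le> \<epsilon> * 0.0472" using e C' by (intro mult_left_mono) auto
    have 4: "\<epsilon> * (\<epsilon> * (R * (P + C))) \<le> (1/10) * ((1/10) * (R * (0.1596 + 0.0472)))"
      using e R0 P P0 C' C0 by (intro mult_mono add_mono) auto
    have 5: "\<epsilon> * (\<epsilon> * R) \<le> (1/10) * (1/10 * R)" using e R0 by (intro mult_mono) auto
    show ?thesis by (rule numerics_Y[OF 1 2 3 4 5 \<epsilon>Y \<epsilon>S R0(1)])
  qed
  \<comment> \<open>Coefficient with which c 2 enters mode one; it equals i - 1 at \<omega> = pi /
    2.\<close>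
  define s2 where "s2 = cis \<omega> + cis (- (2 * \<omega>))"
  have s2': "cmod (s2 - (\<i> - 1)) \<le> 0.0069"
  proof -
    have eq: "s2 - (\<i> - 1) = (cis \<omega> - \<i>) + (cis (- (2 * \<omega>)) + 1)" by (simp add: s2_def)
    show ?thesis unfolding eq using norm_triangle_ineq[of "cis \<omega> - \<i>" "cis (- (2 * \<omega>)) + 1"] cb(2,3) by simp
  qed
  have s2: "cmod s2 \<le> 1.43"
  proof -
    have "cmod (\<i> - 1) = sqrt 2" by (simp add: cmod_def)
    moreover have "sqrt 2 \<le> 1.42" by (rule real_le_lsqrt) (simp_all add: power2_eq_square)
    ultimately show ?thesis using norm_triangle_ineq[of "s2 - (\<i> - 1)" "\<i> - 1"] s2' by simp
  qed
  define L1 where "L1 = L_op' v \<omega> c 1"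
  have L1: "\<epsilon> * cmod L1 \<le> 142/10000 * R"
  proof -
    have "cmod L1 \<le> \<bar>v\<bar> * (3 * cmod (c 2))"
      using L_op'_bound_12(1)[of v \<omega> c] cf(2) by (simp add: L1_def)
    also have "\<dots> \<le> R * (3 * 0.0472)" using R0 cle[of 2] C' C0 by (intro mult_mono) auto
    finally have "\<epsilon> * cmod L1 \<le> (1/10) * (R * (3 * 0.0472))" using e R0 by (intro mult_mono) auto
    then show ?thesis using R0 by simp
  qed
  \<comment> \<open>-i v e^(-i\<omega>) is close to -v because e^(-i\<omega>) is close to -i; the
    difference goes to the right side.\<close>
  have M1: "\<i> * of_real r - of_real v = of_real v * (\<i> * (cis (- \<omega>) + \<i>)) - s2 * (c 2 + of_real \<epsilon> * w 2) - of_real \<epsilon> * L1 + m 1"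
    using cf(2,3) wf(2,3) unfolding m_def mode'_def L_op_123 L1_def s2_def
    by (simp add: algebra_simps)
  define Z where "Z = cmod (\<i> * of_real r - of_real v)"
  have vb: "cmod (of_real v * (\<i> * (cis (- \<omega>) + \<i>))) \<le> 0.0023 * R"
  proof -
    have "cmod (of_real v * (\<i> * (cis (- \<omega>) + \<i>))) = \<bar>v\<bar> * cmod (cis (- \<omega>) + \<i>)" by (simp add: norm_mult)
    also have "\<dots> \<le> R * 0.0023" using R0 cb(1) by (intro mult_mono) auto
    finally show ?thesis by simp
  qed
  have Z1: "Z \<le> 165/10000 * R + 675/1000 * \<epsilon> + 143/100 * Y + S"
  proof -
    have "cmod (c 2 + of_real \<epsilon> * w 2) \<le> C + Y"
    proof -
      have "cmod (of_real \<epsilon> * w 2) \<le> Y" using e wle[of 2] by (simp add: norm_mult Y_def)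
      then show ?thesis using norm_triangle_ineq[of "c 2" "of_real \<epsilon> * w 2"] cle[of 2] by linarith
    qed
    then have "cmod (s2 * (c 2 + of_real \<epsilon> * w 2)) \<le> 1.43 * (C + Y)"
      unfolding norm_mult using s2 by (intro mult_mono) auto
    moreover have "Z \<le> cmod (of_real v * (\<i> * (cis (- \<omega>) + \<i>))) + cmod (s2 * (c 2 + of_real \<epsilon> * w 2)) + cmod (of_real \<epsilon> * L1) + cmod (m 1)"
      unfolding Z_def M1 by (intro order_trans[OF norm_triangle_ineq] order_trans[OF norm_triangle_ineq4] add_mono) auto
    moreover have "cmod (of_real \<epsilon> * L1) = \<epsilon> * cmod L1" using e by (simp add: norm_mult)
    ultimately show ?thesis using vb L1 mb[of 1] C e by simp
  qed
  \<comment> \<open>r and -v are the imaginary and real part of one complex number, so its modulus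
    controls both.\<close>
  have R2: "R \<le> 2 * Z"
    using abs_Re_le_cmod[of "\<i> * of_real r - of_real v"] abs_Im_le_cmod[of "\<i> * of_real r - of_real v"]
    by (simp add: Z_def R_def)
  note st1 = numerics_step1[OF e(1) S1 Y1 R2 Z1]
  define \<kappa> :: complex where "\<kappa> = (2 - \<i>) / 5"
  have \<kappa>: "cmod \<kappa> \<le> 0.4473" unfolding \<kappa>_def by (rule cmod_kappa)
  \<comment> \<open>Second pass: bounding w 2 by W alone ignores its direction, which fixes the
    signs of r and v; V measures its distance to the leading value.\<close>
  define V where "V = \<epsilon> * cmod (w 2 - \<kappa>)"
  have V1: "22/10 * V \<le> 196/10000 * R + 154/10000 * \<epsilon> + 2/10 * Y + 1/10 * S"
  proof -
    let ?D = "\<i> * of_nat 2 * of_real \<rho> + cis (- (2 * \<omega>))"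
    let ?B = "(\<i> * of_nat 2 * of_real r - \<i> * of_nat 2 * of_real v * cis (- (2 * \<omega>))) * c 2"
    let ?s = "cis \<omega> + cis (- (3 * \<omega>))"
    have "?D * (w 2 - \<kappa>) = m 2 - ?B - (cis (- \<omega>) + \<kappa> * ?D) + \<i> * of_real \<epsilon> * of_real v * cis (- \<omega>) - ?s * c 3
      - of_real \<epsilon> * (?s * w 3) - of_real \<epsilon> * L_op' v \<omega> c 2"
      using cf(3) wf(3) unfolding m_def mode'_def L_op_123
      by (simp add: algebra_simps)
    then have "cmod (?D * (w 2 - \<kappa>)) \<le> cmod (m 2) + cmod ?B + cmod (cis (- \<omega>) + \<kappa> * ?D) + cmod (\<i> * of_real \<epsilon> * of_real v * cis (- \<omega>))
      + cmod (?s * c 3) + cmod (of_real \<epsilon> * (?s * w 3)) + cmod (of_real \<epsilon> * L_op' v \<omega> c 2)"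
      by (simp only:) (intro order_trans[OF norm_triangle_ineq] order_trans[OF norm_triangle_ineq4] add_mono order_refl)
    moreover have "2.2 * cmod (w 2 - \<kappa>) \<le> cmod (?D * (w 2 - \<kappa>))"
      unfolding norm_mult[of ?D] using sb(2) by (intro mult_right_mono) auto
    moreover have "cmod ?B \<le> (2 * R) * 0.0472"
      unfolding norm_mult[of _ "c 2"] using dsym[of 2] cle[of 2] C' R0 by (intro mult_mono) auto
    moreover have "cmod (\<i> * of_real \<epsilon> * of_real v * cis (- \<omega>)) \<le> 1/10 * R"
      using mult_mono[OF e(2) R0(2)] R0 e by (simp add: norm_mult)
    moreover have "cmod (?s * c 3) \<le> 2 * (0.02465 * \<epsilon>)"
      unfolding norm_mult using b(6) cis_sum_bound by (intro mult_mono) auto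
    moreover have "cmod (of_real \<epsilon> * (?s * w 3)) \<le> 2 * Y"
    proof -
      have "cmod (?s * w 3) \<le> 2 * W" unfolding norm_mult using wle[of 3] cis_sum_bound by (intro mult_mono) auto
      then have "\<epsilon> * cmod (?s * w 3) \<le> \<epsilon> * (2 * W)" using e by (intro mult_left_mono) auto
      then show ?thesis using e unfolding norm_mult[of "of_real \<epsilon>"] by (simp add: Y_def)
    qed
    moreover have "cmod (of_real \<epsilon> * L_op' v \<omega> c 2) \<le> 1/1000 * R"
    proof -
      have "cmod (L_op' v \<omega> c 2) \<le> \<bar>v\<bar> * (4 * cmod (c 3))"
        using L_op'_bound_12(2)[of v \<omega> c] cf(3) by simp
      also have "\<dots> \<le> R * (4 * 0.002465)" using R0 b(6) e by (intro mult_mono) auto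
      finally have "\<epsilon> * cmod (L_op' v \<omega> c 2) \<le> (1/10) * (R * (4 * 0.002465))" using e R0 by (intro mult_mono) auto
      then show ?thesis using e R0 by (simp add: norm_mult)
    qed
    ultimately have "2.2 * cmod (w 2 - \<kappa>) \<le> S + (2 * R) * 0.0472 + 0.0104 + 1/10 * R + 2 * (0.02465 * \<epsilon>) + 2 * Y + 1/1000 * R"
      using mb[of 2] sb(1)[folded \<kappa>_def] by linarith
    then have "2.2 * cmod (w 2 - \<kappa>) \<le> S + 0.1954 * R + 0.0104 + 0.0493 * \<epsilon> + 2 * Y" using R0 by simp
    then have "\<epsilon> * (2.2 * cmod (w 2 - \<kappa>)) \<le> \<epsilon> * (S + 0.1954 * R + 0.0104 + 0.0493 * \<epsilon> + 2 * Y)"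
      using e by (intro mult_left_mono) auto
    then have 1: "2.2 * V \<le> \<epsilon> * S + 0.1954 * (\<epsilon> * R) + 0.0104 * \<epsilon> + 0.0493 * \<epsilon>\<^sup>2 + 2 * (\<epsilon> * Y)"
      by (simp add: V_def algebra_simps power2_eq_square)
    show ?thesis by (rule numerics_V[OF 1 \<epsilon>S \<epsilon>R \<epsilon>Y conjunct1[OF e2] R0(1) e(1)])
  qed
  \<comment> \<open>The derivative of \<epsilon> c_2 is c_2 + \<epsilon> c'_2, close to 2 \<epsilon>
    \<kappa>; E is the defect of mode one with that value inserted.\<close>
  define E where "E = cmod (\<i> * of_real r - of_real v + (\<i> - 1) * (2 * of_real \<epsilon> * \<kappa>))"
  have E1: "E \<le> 165/10000 * R + 62/10000 * \<epsilon> + 143/100 * (247/10000 * \<epsilon> + V) + S"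
  proof -
    let ?g = "c 2 - \<kappa> * of_real \<epsilon> + of_real \<epsilon> * (w 2 - \<kappa>)"
    have "cmod ?g \<le> 0.02465 * \<epsilon> + V"
      using norm_triangle_ineq[of "c 2 - \<kappa> * of_real \<epsilon>" "of_real \<epsilon> * (w 2 - \<kappa>)"] b(5) e
      by (simp add: norm_mult V_def \<kappa>_def)
    then have y: "cmod (s2 * ?g) \<le> 1.43 * (0.02465 * \<epsilon> + V)"
      unfolding norm_mult[of s2] using s2 by (intro mult_mono) auto
    have z: "cmod ((s2 - (\<i> - 1)) * (2 * of_real \<epsilon> * \<kappa>)) \<le> 0.0069 * (2 * \<epsilon> * 0.4473)"
      unfolding norm_mult[of "s2 - (\<i> - 1)"] using s2' \<kappa> e by (intro mult_mono) (auto simp: norm_mult)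
    have eq: "\<i> * of_real r - of_real v + (\<i> - 1) * (2 * of_real \<epsilon> * \<kappa>)
       = of_real v * (\<i> * (cis (- \<omega>) + \<i>)) - s2 * ?g - (s2 - (\<i> - 1)) * (2 * of_real \<epsilon> * \<kappa>) - of_real \<epsilon> * L1 + m 1"
      unfolding M1 by (simp add: algebra_simps)
    have x: "E \<le> cmod (of_real v * (\<i> * (cis (- \<omega>) + \<i>))) + cmod (s2 * ?g) + cmod ((s2 - (\<i> - 1)) * (2 * of_real \<epsilon> * \<kappa>))
        + cmod (of_real \<epsilon> * L1) + cmod (m 1)"
      unfolding E_def eq by (intro order_trans[OF norm_triangle_ineq] order_trans[OF norm_triangle_ineq4] add_mono) auto
    have "cmod (of_real \<epsilon> * L1) = \<epsilon> * cmod L1" using e by (simp add: norm_mult)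
    then have p: "cmod (of_real \<epsilon> * L1) \<le> 142/10000 * R" using L1 by simp
    show ?thesis by (rule numerics_E[OF x vb y z p mb[of 1, OF zero_less_one] e(1)])
  qed
  have E2: "E \<le> 54/100 * \<epsilon>" by (rule numerics_step2[OF e(1) st1 V1 E1])
  \<comment> \<open>(i - 1) (2 - i) = -1 + 3 i, so v is near -2 \<epsilon> / 5 and r near -6
    \<epsilon> / 5.\<close>
  have "\<i> * of_real r - of_real v + (\<i> - 1) * (2 * of_real \<epsilon> * \<kappa>) = Complex (- v - 2 * \<epsilon> / 5) (r + 6 * \<epsilon> / 5)"
    by (simp add: complex_eq_iff \<kappa>_def)
  then have "\<bar>- v - 2 * \<epsilon> / 5\<bar> \<le> 54/100 * \<epsilon>" "\<bar>r + 6 * \<epsilon> / 5\<bar> \<le> 54/100 * \<epsilon>"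
    using abs_Re_le_cmod[of "Complex (- v - 2 * \<epsilon> / 5) (r + 6 * \<epsilon> / 5)"]
      abs_Im_le_cmod[of "Complex (- v - 2 * \<epsilon> / 5) (r + 6 * \<epsilon> / 5)"] E2 by (simp_all add: E_def)
  then have vr: "v \<ge> - 94/100 * \<epsilon>" "r \<le> - 66/100 * \<epsilon>" unfolding abs_le_iff by linarith+
  \<comment> \<open>1.57 * 0.66 = 1.0362 against 0.94: this margin is why the error had to be
    brought down to 0.54 \<epsilon>.\<close>
  have "1.57 * (66/100 * \<epsilon>) \<le> \<alpha> * (- r)" using \<alpha> vr e by (intro mult_mono) auto
  then have "v - \<alpha> * r > 0" using vr e by simp
  moreover have "\<omega> * u = \<alpha> * (v - \<alpha> * r)" using \<alpha> by (simp add: r_def field_simps power2_eq_square)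
  ultimately have "\<omega> * u > 0" using \<alpha> by simp
  then have "u > 0" using \<omega> by (simp add: zero_less_mult_iff)
  then show ?thesis using du by blast
qed

end

section \<open>Slowly oscillating solutions along the branch\<close>

text \<open>Dominated convergence for series with majorant C / k^2. At k = 0 the majorant is 0 by
  division by zero, so eventually the sequences must vanish there.\<close>

lemma tendsto_l1_norm:
  assumes "\<And>k. (\<lambda>n. b n k) \<longlonglongrightarrow> l k" and "\<forall>\<^sub>F n in sequentially. \<forall>k. cmod (b n k) \<le> C / real k ^ 2"
  shows "(\<lambda>n. l1_norm (b n)) \<longlonglongrightarrow> l1_norm l"
proof -
  have "eventually (\<lambda>(k, n). norm (complex_of_real (cmod (b n k))) \<le> C / real k ^ 2) (at_top \<times>\<^sub>F sequentially)"
    unfolding eventually_prod_filter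
    by (rule exI[of _ "\<lambda>_. True"], rule exI[of _ "\<lambda>n. \<forall>k. cmod (b n k) \<le> C / real k ^ 2"]) (use assms(2) in auto)
  moreover have "(\<lambda>n. complex_of_real (cmod (b n k))) \<longlonglongrightarrow> of_real (cmod (l k))" for k
    by (intro tendsto_intros assms)
  ultimately have t: "\<forall>\<^sub>F n in sequentially. summable (\<lambda>k. norm (complex_of_real (cmod (b n k))))"
      "summable (\<lambda>k. norm (complex_of_real (cmod (l k))))"
      "(\<lambda>n. \<Sum>k. complex_of_real (cmod (b n k))) \<longlonglongrightarrow> (\<Sum>k. complex_of_real (cmod (l k)))"
    using tannerys_theorem[OF _ _ summable_inverse_squares[of C], where F = sequentially
        and a = "\<lambda>k n. complex_of_real (cmod (b n k))" and b = "\<lambda>k. complex_of_real (cmod (l k))"] by auto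
  have "(\<lambda>n. Re (\<Sum>k. complex_of_real (cmod (b n k)))) \<longlonglongrightarrow> Re (\<Sum>k. complex_of_real (cmod (l k)))"
    by (intro tendsto_Re t)
  moreover have "\<forall>\<^sub>F n in sequentially. Re (\<Sum>k. complex_of_real (cmod (b n k))) = (\<Sum>k. cmod (b n k))"
    using t(1) by eventually_elim (simp add: suminf_of_real[symmetric])
  moreover have "Re (\<Sum>k. complex_of_real (cmod (l k))) = (\<Sum>k. cmod (l k))"
    using t(2) by (simp add: suminf_of_real[symmetric])
  ultimately have "(\<lambda>n. \<Sum>k. cmod (b n k)) \<longlonglongrightarrow> (\<Sum>k. cmod (l k))"
    using Lim_transform_eventually by fastforce
  then show ?thesis unfolding l1_norm_def by (intro tendsto_intros)
qed

text \<open>A nontrivial shift must put the required zero at q - 1, the only place modulo the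
  period, apart from 0, where z may vanish; but z is negative just to the right of q - 1, where the
  shifted pattern asks for positive values.\<close>

lemma sign_pattern_shift_unique:
  fixes z :: "real \<Rightarrow> real"
  assumes c: "continuous_on UNIV z" and per: "\<And>s. z (s + 1) = z s" and L: "L > 0"
    and p: "sign_pattern L z" "sign_pattern L (\<lambda>s. z (s - \<delta>))"
  shows "z (s - \<delta>) = z s"
proof -
  define d where "d = frac \<delta>"
  have sh: "z (s - \<delta>) = z (s - d)" for s
    using periodic_int[of z "s - \<delta>" "\<lfloor>\<delta>\<rfloor>"] per by (simp add: d_def frac_def algebra_simps)
  have d01: "0 \<le> d" "d < 1" by (simp_all add: d_def frac_lt_1)
  from p(1) obtain q where q: "1 / L < q" "q < 1 - 1 / L"
    and neg: "\<And>s. q - 1 < s \<Longrightarrow> s < 0 \<Longrightarrow> z s < 0" and pos: "\<And>s. 0 < s \<Longrightarrow> s < q \<Longrightarrow> z s > 0"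
    unfolding sign_pattern_def by blast
  from p(2) obtain q' where q': "1 / L < q'" "q' < 1 - 1 / L"
    and neg': "\<And>s. q' - 1 < s \<Longrightarrow> s < 0 \<Longrightarrow> z (s - d) < 0" and pos': "\<And>s. 0 < s \<Longrightarrow> s < q' \<Longrightarrow> z (s - d) > 0"
    unfolding sign_pattern_def sh by blast
  have L': "0 < 1 / L" using L by simp
  have q01: "0 < q" "q < 1" "0 < q'" "q' < 1" using q q' L' by linarith+
  have c': "continuous_on UNIV (\<lambda>s. z (s - d))"
    by (rule continuous_on_compose2[OF c]) (auto intro: continuous_intros)
  have z0: "z (- d) = 0" using sign_pattern_zero[OF c' q01(3,4) neg' pos'] by simp
  have "d = 0"
  proof (rule ccontr)
    assume "d \<noteq> 0"
    then have d: "0 < d" using d01 by simp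
    have "\<not> (q - 1 < - d)" using neg[of "- d"] z0 d by auto
    moreover have "\<not> (1 - d < q)" using pos[of "1 - d"] z0 d01 per[of "- d"] by (auto simp: add.commute)
    ultimately have dq: "d = 1 - q" by simp
    define s where "s = min q' (1 - q) / 2"
    have "0 < s" "s < q'" "s < 1 - q" using q01 by (auto simp: s_def)
    then show False using pos'[of s] neg[of "s - d"] by (simp add: dq)
  qed
  then show ?thesis by (simp add: sh)
qed

lemma positive_on_interval_bound:
  fixes f :: "real \<Rightarrow> real"
  assumes "continuous_on UNIV f" "\<And>x. x \<in> {a..b} \<Longrightarrow> f x > 0"
  obtains \<mu> where "\<mu> > 0" "\<And>x. x \<in> {a..b} \<Longrightarrow> f x \<ge> \<mu>"
proof (cases "a \<le> b")
  case True
  then obtain x where "x \<in> {a..b}" "\<forall>y\<in>{a..b}. f x \<le> f y"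
    using continuous_attains_inf[of "{a..b}" f] continuous_on_subset[OF assms(1)] by auto
  then show ?thesis using that[of "f x"] assms(2) by auto
qed (use that[of 1] in auto)

lemma inverse_close: 
  assumes "(L0::real) > 0" "\<eta> > 0"
  shows "\<exists>d>0. \<forall>L. \<bar>L - L0\<bar> < d \<longrightarrow> \<bar>1 / L - 1 / L0\<bar> < \<eta>"
proof -
  have "isCont (\<lambda>L::real. 1 / L) L0" using assms by (intro continuous_intros) auto
  then have "\<exists>d>0. \<forall>x. x \<noteq> L0 \<and> norm (x - L0) < d \<longrightarrow> norm (1 / x - 1 / L0) < \<eta>"
    using assms(2) unfolding isCont_def LIM_def dist_norm by blast
  then show ?thesis using assms(2) unfolding real_norm_def by (metis abs_zero diff_self)
qed
lemma common_lower_bound: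
  fixes A :: "real set"
  assumes "finite A" "\<And>x. x \<in> A \<Longrightarrow> x > 0"
  obtains d where "d > 0" "\<And>x. x \<in> A \<Longrightarrow> d \<le> x"
proof (cases "A = {}")
  case False
  then show ?thesis using assms by (intro that[of "Min A"]) simp_all
qed (use that[of 1] in simp)

text \<open>Closeness in the sup norm does not exclude extra zeros near 0 and q; the equation does.
  The delayed argument is then near -1 / L0 or q - 1 / L0, inside an interval of fixed sign because
  both phases last longer than the delay, so w strictly increases near 0 and strictly decreases near
  q. Elsewhere closeness keeps the sign. The upward zero \<sigma> of w may differ from 0, hence the
  translation.\<close>

lemma sops_persist:
  assumes w0: "wright_profile \<alpha>0 (2 * pi / L0) z0" and L0: "L0 > 0" and \<alpha>0: "\<alpha>0 > 0" and sp: "sign_pattern L0 z0" and e: "e > 0"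
  obtains d where "d > 0"
    "\<And>\<alpha> L w. \<bar>\<alpha> - \<alpha>0\<bar> < d \<Longrightarrow> \<bar>L - L0\<bar> < d \<Longrightarrow> (\<And>s. \<bar>w s - z0 s\<bar> < d) \<Longrightarrow> wright_profile \<alpha> (2 * pi / L) w
      \<Longrightarrow> L > 0 \<and> (\<exists>\<sigma>. \<bar>\<sigma>\<bar> < e \<and> sign_pattern L (\<lambda>s. w (s + \<sigma>)))"
proof -
  from sp obtain q where q: "1 / L0 < q" "q < 1 - 1 / L0"
    and neg: "\<And>s. q - 1 < s \<Longrightarrow> s < 0 \<Longrightarrow> z0 s < 0" and pos: "\<And>s. 0 < s \<Longrightarrow> s < q \<Longrightarrow> z0 s > 0"
    unfolding sign_pattern_def by blast
  define l where "l = 1 / L0"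
  have l: "0 < l" "l < q" "q < 1 - l" using L0 q by (simp_all add: l_def)
  \<comment> \<open>Small enough that the windows around 0, q and the delayed points stay in the
    right sign intervals, also when 1 / L moves by \<eta>.\<close>
  define \<eta> where "\<eta> = min e (min (q - l) (min (1 - l - q) l)) / 4"
  have \<eta>: "0 < \<eta>" "\<eta> < e" "4 * \<eta> \<le> q - l" "4 * \<eta> \<le> 1 - l - q" "4 * \<eta> \<le> l"
    using e l by (simp_all add: \<eta>_def)
  have c: "continuous_on UNIV z0" "continuous_on UNIV (\<lambda>s. - z0 s)"
    using profile_continuous[OF w0] by (auto intro: continuous_intros)
  have im1: "- z0 x > 0" if "x \<in> {- l - 2 * \<eta>..- l + 2 * \<eta>}" for x
    using neg[of x] \<eta> l that by auto
  obtain m1 where m1: "m1 > 0" "\<And>x. x \<in> {- l - 2 * \<eta>..- l + 2 * \<eta>} \<Longrightarrow> - z0 x \<ge> m1"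
    using positive_on_interval_bound[OF c(2) im1] by blast
  have im2: "z0 x > 0" if "x \<in> {q - l - 2 * \<eta>..q - l + 2 * \<eta>}" for x
    using pos[of x] \<eta> l that by auto
  obtain m2 where m2: "m2 > 0" "\<And>x. x \<in> {q - l - 2 * \<eta>..q - l + 2 * \<eta>} \<Longrightarrow> z0 x \<ge> m2"
    using positive_on_interval_bound[OF c(1) im2] by blast
  have im3: "z0 x > 0" if "x \<in> {\<eta>..q - \<eta>}" for x
    using pos[of x] \<eta> l that by auto
  obtain m3 where m3: "m3 > 0" "\<And>x. x \<in> {\<eta>..q - \<eta>} \<Longrightarrow> z0 x \<ge> m3"
    using positive_on_interval_bound[OF c(1) im3] by blast
  have im4: "- z0 x > 0" if "x \<in> {q + \<eta> - 1..- \<eta>}" for x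
    using neg[of x] \<eta> l that by auto
  obtain m4 where m4: "m4 > 0" "\<And>x. x \<in> {q + \<eta> - 1..- \<eta>} \<Longrightarrow> - z0 x \<ge> m4"
    using positive_on_interval_bound[OF c(2) im4] by blast
  obtain d0 where d0: "d0 > 0" "\<forall>L. \<bar>L - L0\<bar> < d0 \<longrightarrow> \<bar>1 / L - 1 / L0\<bar> < \<eta>"
    using inverse_close[OF L0 \<eta>(1)] by (elim exE conjE)
  have "\<And>x. x \<in> {m1, m2, m3, m4, d0, \<alpha>0, L0} \<Longrightarrow> x > 0"
    using m1(1) m2(1) m3(1) m4(1) d0(1) \<alpha>0 L0 by blast
  then obtain d where d0': "d > 0" "\<And>x. x \<in> {m1, m2, m3, m4, d0, \<alpha>0, L0} \<Longrightarrow> d \<le> x"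
    using common_lower_bound[of "{m1, m2, m3, m4, d0, \<alpha>0, L0}"] by blast
  have d: "d > 0" "d \<le> m1" "d \<le> m2" "d \<le> m3" "d \<le> m4" "d \<le> d0" "d \<le> \<alpha>0" "d \<le> L0"
    by (rule d0'; simp)+
  show thesis
  proof (rule that[OF d(1)])
    fix \<alpha> L w
    assume A: "\<bar>\<alpha> - \<alpha>0\<bar> < d" "\<bar>L - L0\<bar> < d" "\<And>s. \<bar>w s - z0 s\<bar> < d" "wright_profile \<alpha> (2 * pi / L) w"
    have \<alpha>L: "\<alpha> > 0" "L > 0" using A(1,2) d(7,8) by linarith+
    have lL: "\<bar>1 / L - l\<bar> < \<eta>" using d0(2)[rule_format, of L] A(2) d(6) unfolding l_def by linarith
    have near: "z0 s - d < w s" "w s < z0 s + d" for s using A(3)[of s] by auto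
    have per: "w (s + 1) = w s" for s using A(4) by (simp add: wright_profile_def)
    have w1: "1 + w s > 0" for s using A(4) by (simp add: wright_profile_def)
    have der: "(w has_real_derivative (- \<alpha> * L * w (s - 1 / L) * (1 + w s))) (at s)" for s
      using A(4) \<alpha>L by (simp add: wright_profile_def)
    have cw: "isCont w s" for s using der DERIV_isCont by blast
    have up: "w x < w y" if "- \<eta> \<le> x" "x < y" "y \<le> \<eta>" for x y
    proof (rule DERIV_pos_imp_increasing[OF that(2)])
      fix t assume t: "x \<le> t" "t \<le> y"
      have "t - 1 / L \<in> {- l - 2 * \<eta>..- l + 2 * \<eta>}" using t that lL by auto
      then have "w (t - 1 / L) < 0" using m1(2)[of "t - 1 / L"] near(2)[of "t - 1 / L"] d(2) by linarith
      then have "- \<alpha> * L * w (t - 1 / L) * (1 + w t) > 0" using \<alpha>L w1[of t] by (simp add: mult_pos_neg mult_neg_pos)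
      then show "\<exists>y. DERIV w t :> y \<and> y > 0" using der by blast
    qed
    have down: "w y < w x" if "q - \<eta> \<le> x" "x < y" "y \<le> q + \<eta>" for x y
    proof (rule DERIV_neg_imp_decreasing[OF that(2)])
      fix t assume t: "x \<le> t" "t \<le> y"
      have "t - 1 / L \<in> {q - l - 2 * \<eta>..q - l + 2 * \<eta>}" using t that lL by auto
      then have "w (t - 1 / L) > 0" using m2(2)[of "t - 1 / L"] near(1)[of "t - 1 / L"] d(3) by linarith
      then have "- \<alpha> * L * w (t - 1 / L) * (1 + w t) < 0" using \<alpha>L w1[of t] by (simp add: mult_pos_neg mult_neg_pos)
      then show "\<exists>y. DERIV w t :> y \<and> y < 0" using der by blast
    qed
    have mid: "w s > 0" if "\<eta> \<le> s" "s \<le> q - \<eta>" for s using m3(2)[of s] near(1)[of s] d(4) that by simp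
    have lo: "w s < 0" if "q + \<eta> - 1 \<le> s" "s \<le> - \<eta>" for s using m4(2)[of s] near(2)[of s] d(5) that by simp
    have ends: "w (- \<eta>) < 0" "w \<eta> > 0" "w (q - \<eta>) > 0" "w (q + \<eta>) < 0"
      using lo[of "- \<eta>"] mid[of \<eta>] mid[of "q - \<eta>"] lo[of "q + \<eta> - 1"] per[of "q + \<eta> - 1"] \<eta> l by auto
    obtain \<sigma> where \<sigma>: "- \<eta> \<le> \<sigma>" "\<sigma> \<le> \<eta>" "w \<sigma> = 0"
      using IVT[of w "- \<eta>" 0 \<eta>] ends \<eta> cw by auto
    obtain \<rho> where \<rho>: "q - \<eta> \<le> \<rho>" "\<rho> \<le> q + \<eta>" "w \<rho> = 0"
      using IVT2[of w "q + \<eta>" 0 "q - \<eta>"] ends \<eta> cw by auto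
    have wpos: "w x > 0" if "\<sigma> < x" "x < \<rho>" for x
    proof -
      consider "x \<le> \<eta>" | "\<eta> \<le> x \<and> x \<le> q - \<eta>" | "q - \<eta> \<le> x" by linarith
      then show ?thesis
        by cases (use up[of \<sigma> x] down[of x \<rho>] mid[of x] that \<sigma> \<rho> in auto)
    qed
    have wneg: "w x < 0" if "\<rho> - 1 < x" "x < \<sigma>" for x
    proof -
      consider "- \<eta> \<le> x" | "q + \<eta> - 1 \<le> x \<and> x \<le> - \<eta>" | "x \<le> q + \<eta> - 1" by linarith
      then show ?thesis
        by cases (use up[of x \<sigma>] down[of \<rho> "x + 1"] per[of x] lo[of x] that \<sigma> \<rho> in auto)
    qed
    have "sign_pattern L (\<lambda>s. w (s + \<sigma>))"
      unfolding sign_pattern_def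
    proof (intro exI[of _ "\<rho> - \<sigma>"] conjI allI impI)
      show "1 / L < \<rho> - \<sigma>" "\<rho> - \<sigma> < 1 - 1 / L" using \<sigma> \<rho> lL \<eta> by (auto simp: abs_less_iff)
    qed (auto intro!: wpos wneg)
    moreover have "\<bar>\<sigma>\<bar> < e" using \<sigma> \<eta> by auto
    ultimately show "L > 0 \<and> (\<exists>\<sigma>. \<bar>\<sigma>\<bar> < e \<and> sign_pattern L (\<lambda>s. w (s + \<sigma>)))" using \<alpha>L by blast
  qed
qed

lemma sops_set_iff:
  "(\<alpha>, L, z) \<in> sops_set \<longleftrightarrow> L > 0 \<and> wright_profile \<alpha> (2 * pi / L) (apply_bcontfun z) \<and> sign_pattern L (apply_bcontfun z)"
  by (simp add: sops_set_def sops_iff)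

lemma profile_lipschitz:
  assumes w: "wright_profile \<alpha> \<omega> z" and M: "\<And>s. \<bar>z s\<bar> \<le> 1"
  shows "\<bar>z x - z y\<bar> \<le> 2 * \<bar>\<alpha> * (2 * pi / \<omega>)\<bar> * \<bar>x - y\<bar>"
proof -
  have "norm (z x - z y) \<le> (2 * \<bar>\<alpha> * (2 * pi / \<omega>)\<bar>) * norm (x - y)"
  proof (rule field_differentiable_bound[where S = UNIV])
    fix s
    show "(z has_field_derivative (- \<alpha> * (2 * pi / \<omega>) * z (s - \<omega> / (2 * pi)) * (1 + z s))) (at s within UNIV)"
      using w by (simp add: wright_profile_def)
    have "\<bar>1 + z s\<bar> \<le> 2" using M[of s] by linarith
    then have "\<bar>\<alpha> * (2 * pi / \<omega>)\<bar> * \<bar>z (s - \<omega> / (2 * pi))\<bar> * \<bar>1 + z s\<bar> \<le> \<bar>\<alpha> * (2 * pi / \<omega>)\<bar> * 1 * 2"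
      using M by (intro mult_mono) auto
    then show "norm (- \<alpha> * (2 * pi / \<omega>) * z (s - \<omega> / (2 * pi)) * (1 + z s)) \<le> 2 * \<bar>\<alpha> * (2 * pi / \<omega>)\<bar>"
      by (simp add: abs_mult mult_ac)
  qed auto
  then show ?thesis by simp
qed

lemma norm_unit_seq_1: "l1_norm (unit_seq 1) = 2"
proof -
  have "(\<Sum>k. cmod (unit_seq 1 k)) = (\<Sum>k. if k = 1 then 1 else 0)" by (intro suminf_cong) (simp add: unit_seq_def)
  also have "\<dots> = 1" using sums_unique[OF sums_single[of 1 "\<lambda>k. 1::real"]] by simp
  finally show ?thesis by (simp add: l1_norm_def)
qed

lemma rfc_tendsto:
  fixes z :: "nat \<Rightarrow> (real \<Rightarrow>\<^sub>C real)"
  assumes "z \<longlonglongrightarrow> z0"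
  shows "(\<lambda>n. rfc (apply_bcontfun (z n)) k) \<longlonglongrightarrow> rfc (apply_bcontfun z0) k"
proof (rule LIM_zero_cancel, rule Lim_null_comparison)
  show "(\<lambda>n. dist (z n) z0) \<longlonglongrightarrow> 0" using assms tendsto_dist_iff by blast
  have c: "continuous_on {0..1} (\<lambda>s. complex_of_real (apply_bcontfun f s))" for f :: "real \<Rightarrow>\<^sub>C real"
    by (intro continuous_intros continuous_on_subset[OF continuous_on_apply_bcontfun]) auto
  show "\<forall>\<^sub>F n in sequentially. norm (rfc (apply_bcontfun (z n)) k - rfc (apply_bcontfun z0) k) \<le> dist (z n) z0"
  proof (intro always_eventually allI)
    fix n
    have "cmod (fc (\<lambda>s. complex_of_real (apply_bcontfun (z n) s) - complex_of_real (apply_bcontfun z0 s)) k) \<le> dist (z n) z0"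
    proof (rule fc_bound)
      show "cmod (complex_of_real (apply_bcontfun (z n) s) - complex_of_real (apply_bcontfun z0 s)) \<le> dist (z n) z0" for s
        using dist_bounded[of "z n" s z0] by (simp add: dist_real_def flip: of_real_diff)
    qed (intro continuous_on_diff c)
    then show "norm (rfc (apply_bcontfun (z n)) k - rfc (apply_bcontfun z0) k) \<le> dist (z n) z0"
      by (simp add: fc_diff[OF c c])
  qed
qed

lemma tendsto_orbit:
  fixes X :: "nat \<Rightarrow> orbit"
  assumes "X \<longlonglongrightarrow> (\<alpha>, L, z)"
  shows "(\<lambda>n. fst (X n)) \<longlonglongrightarrow> \<alpha>" "(\<lambda>n. fst (snd (X n))) \<longlonglongrightarrow> L" "(\<lambda>n. snd (snd (X n))) \<longlonglongrightarrow> z"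
  using tendsto_fst[OF assms] tendsto_fst[OF tendsto_snd[OF assms]] tendsto_snd[OF tendsto_snd[OF assms]] by simp_all

lemma sops_nonzero:
  assumes "sign_pattern L z" "L > 0" shows "\<exists>s. z s \<noteq> 0"
proof -
  obtain q where q: "1 / L < q" "\<And>s. 0 < s \<Longrightarrow> s < q \<Longrightarrow> z s > 0" using assms(1) unfolding sign_pattern_def by blast
  have "0 < 1 / L" using assms(2) by simp
  then have "z (q / 2) > 0" using q(1) by (intro q(2)) linarith+
  then show ?thesis by (metis less_irrefl)
qed

section \<open>Solutions on the branch and the curve they form\<close>

context zero_branch begin

text \<open>The branch profile in the translate with first coefficient \<epsilon> > 0; its upward
  zero need not be at 0.\<close>

definition Yp :: "real \<Rightarrow> real \<Rightarrow> real" where "Yp \<epsilon> = profile_of \<epsilon> (ch \<epsilon>)"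

definition coef :: "real \<Rightarrow> cseq" where "coef \<epsilon> k = of_real \<epsilon> * (unit_seq 1 k + ch \<epsilon> k)"

lemma Yp_tsum: "Yp \<epsilon> s = tsum (coef \<epsilon>) (2 * pi * s)"
  by (simp add: Yp_def profile_of_def coef_def[abs_def])

text \<open>0.1 times 2 + 0.3191 is 0.23191, below 0.25 and so below the bound 1 that
  \<open>G_zero_imp_profile\<close> requires.\<close>

lemma coef_facts:
  assumes \<epsilon>: "\<epsilon> \<in> {0<..0.1}"
  shows "coef \<epsilon> 0 = 0" "K_inv (coef \<epsilon>) \<in> l1" "coef \<epsilon> \<in> l1" "l1_norm (coef \<epsilon>) < 0.25"
    "wright_profile (\<alpha>h \<epsilon>) (\<omega>h \<epsilon>) (Yp \<epsilon>)" "\<bar>Yp \<epsilon> s\<bar> < 0.25" "0 < \<omega>h \<epsilon>" "0 < \<alpha>h \<epsilon>"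
proof -
  note c = ch_facts[OF \<epsilon>]
  have pi: "3.1415 < pi" using pi_approx by simp
  show \<omega>: "0 < \<omega>h \<epsilon>" "0 < \<alpha>h \<epsilon>" using base_bounds(1,3)[OF \<epsilon>] pi by simp_all
  show 0: "coef \<epsilon> 0 = 0" using c by (simp add: coef_def unit_seq_def)
  have "K_inv (coef \<epsilon>) = (\<lambda>k. of_real \<epsilon> * (unit_seq 1 k + K_inv (ch \<epsilon>) k))"
    by (simp add: K_inv_def coef_def fun_eq_iff unit_seq_def ring_distribs)
  then show K: "K_inv (coef \<epsilon>) \<in> l1" using c by (auto intro!: l1_cmult l1_add unit_seq_l1)
  show l: "coef \<epsilon> \<in> l1" using K_inv_l1[OF 0 K] .
  have "l1_norm (coef \<epsilon>) = \<epsilon> * l1_norm (\<lambda>k. unit_seq 1 k + ch \<epsilon> k)"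
    unfolding coef_def[abs_def] using \<epsilon> c by (subst l1_norm_cmult) (auto intro!: l1_add unit_seq_l1)
  also have "\<dots> \<le> 0.1 * (2 + 0.3191)"
    using \<epsilon> c l1_norm_triangle[OF unit_seq_l1[of 1] c(1)] l1_norm_le_K_inv[OF c(2,4)] norm_unit_seq_1
    by (intro mult_mono) (auto intro!: l1_norm_nonneg l1_add unit_seq_l1)
  finally show n: "l1_norm (coef \<epsilon>) < 0.25" by simp
  show "wright_profile (\<alpha>h \<epsilon>) (\<omega>h \<epsilon>) (Yp \<epsilon>)"
    unfolding Yp_tsum[abs_def]
    by (rule G_zero_imp_profile[OF 0 K])
       (use c G_map_F_map[OF c(1)] n \<omega> in \<open>auto simp: coef_def[abs_def]\<close>)
  show "\<bar>Yp \<epsilon> s\<bar> < 0.25" using tsum_bound[OF l] n unfolding Yp_tsum by (meson le_less_trans)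
qed

text \<open>The l1 norm of the coefficients dominates the sup norm of the series, so strong
  continuity of c gives uniform closeness.\<close>

lemma Yp_close:
  assumes \<epsilon>: "\<epsilon> \<in> {0<..0.1}" and e: "e > 0"
  shows "\<forall>\<^sub>F \<eta> in at \<epsilon> within {0<..0.1}. \<forall>s. \<bar>Yp \<eta> s - Yp \<epsilon> s\<bar> < e"
proof -
  let ?F = "at \<epsilon> within {0<..0.1}" and ?I = "{0<..0.1::real}"
  obtain u v w where "w \<in> lK_0" and lim:
    "((\<lambda>\<eta>. l1_norm (K_inv (\<lambda>k. (ch \<eta> k - ch \<epsilon> k) / of_real (\<eta> - \<epsilon>) - w k))) \<longlongrightarrow> 0) ?F"
    using first_derivatives[OF \<epsilon>] .
  have Q: "((\<lambda>\<eta>. l1_norm (K_inv (\<lambda>k. ch \<eta> k - ch \<epsilon> k))) \<longlongrightarrow> 0) ?F"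
    by (rule ch_quotient_l1(3)[OF \<epsilon> \<open>w \<in> lK_0\<close> lim])
  have "((\<lambda>\<eta>. \<bar>\<eta> - \<epsilon>\<bar> * 3 + l1_norm (K_inv (\<lambda>k. ch \<eta> k - ch \<epsilon> k))) \<longlongrightarrow> \<bar>\<epsilon> - \<epsilon>\<bar> * 3 + 0) ?F"
    by (intro tendsto_intros Q)
  then have "\<forall>\<^sub>F \<eta> in ?F. \<bar>\<eta> - \<epsilon>\<bar> * 3 + l1_norm (K_inv (\<lambda>k. ch \<eta> k - ch \<epsilon> k)) < e"
    by (rule order_tendstoD) (use e in simp)
  moreover have "\<forall>\<^sub>F \<eta> in ?F. \<eta> \<in> ?I" by (auto simp: eventually_at intro!: exI[of _ 1])
  ultimately show ?thesis
  proof eventually_elim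
    case (elim \<eta>)
    note c = ch_facts[OF \<epsilon>] and c' = ch_facts[OF elim(2)]
    let ?d = "\<lambda>k. ch \<eta> k - ch \<epsilon> k"
    have d: "?d \<in> l1" by (intro l1_diff c c')
    have Kd: "K_inv ?d \<in> l1"
    proof -
      have "K_inv ?d = (\<lambda>k. K_inv (ch \<eta>) k - K_inv (ch \<epsilon>) k)" by (simp add: K_inv_def fun_eq_iff right_diff_distrib)
      then show ?thesis using l1_diff[OF c'(4) c(4)] by simp
    qed
    have u: "(\<lambda>k. unit_seq 1 k + ch \<eta> k) \<in> l1" "(\<lambda>k. of_real (\<eta> - \<epsilon>) * (unit_seq 1 k + ch \<eta> k)) \<in> l1"
      using c' by (auto intro!: l1_cmult l1_add unit_seq_l1)
    have eq: "(\<lambda>k. coef \<eta> k - coef \<epsilon> k) = (\<lambda>k. of_real (\<eta> - \<epsilon>) * (unit_seq 1 k + ch \<eta> k) + of_real \<epsilon> * ?d k)"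
      by (simp add: coef_def fun_eq_iff algebra_simps)
    have "l1_norm (\<lambda>k. coef \<eta> k - coef \<epsilon> k) \<le> l1_norm (\<lambda>k. of_real (\<eta> - \<epsilon>) * (unit_seq 1 k + ch \<eta> k)) + l1_norm (\<lambda>k. of_real \<epsilon> * ?d k)"
      unfolding eq by (intro l1_norm_triangle u l1_cmult d)
    also have "l1_norm (\<lambda>k. of_real (\<eta> - \<epsilon>) * (unit_seq 1 k + ch \<eta> k)) = \<bar>\<eta> - \<epsilon>\<bar> * l1_norm (\<lambda>k. unit_seq 1 k + ch \<eta> k)"
      using l1_norm_cmult[OF u(1), of "of_real (\<eta> - \<epsilon>)"] by (simp del: of_real_diff)
    also have "\<dots> \<le> \<bar>\<eta> - \<epsilon>\<bar> * 3"
      using l1_norm_triangle[OF unit_seq_l1[of 1] c'(1)] l1_norm_le_K_inv[OF c'(2,4)] c'(6) norm_unit_seq_1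
      by (intro mult_left_mono) auto
    also have "l1_norm (\<lambda>k. of_real \<epsilon> * ?d k) \<le> l1_norm (K_inv ?d)"
    proof -
      have "l1_norm (\<lambda>k. of_real \<epsilon> * ?d k) = \<epsilon> * l1_norm ?d" using l1_norm_cmult[OF d, of "of_real \<epsilon>"] \<epsilon> by simp
      also have "\<dots> \<le> 1 * l1_norm ?d" using \<epsilon> l1_norm_nonneg[OF d] by (intro mult_right_mono) auto
      also have "\<dots> \<le> l1_norm (K_inv ?d)" using l1_norm_le_K_inv[OF _ Kd] c(2) c'(2) by simp
      finally show ?thesis .
    qed
    finally have n: "l1_norm (\<lambda>k. coef \<eta> k - coef \<epsilon> k) < e" using elim(1) by simp
    show ?case
    proof
      fix s
      have "Yp \<eta> s - Yp \<epsilon> s = tsum (\<lambda>k. coef \<eta> k - coef \<epsilon> k) (2 * pi * s)"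
        unfolding Yp_tsum using coef_facts(3)[OF \<epsilon>] coef_facts(3)[OF elim(2)] by (simp add: tsum_diff)
      then show "\<bar>Yp \<eta> s - Yp \<epsilon> s\<bar> < e"
        using tsum_bound[OF l1_diff[OF coef_facts(3)[OF elim(2)] coef_facts(3)[OF \<epsilon>]], of "2 * pi * s"] n by simp
    qed
  qed
qed

text \<open>The translate \<tau> moves the upward zero to 0. Membership in \<open>sops_set\<close>
  is demanded because only its persistence under small changes of \<epsilon> is established. The
  strict bound \<epsilon> < 0.1 makes the set relatively open; closedness recovers it from the bound
  on \<alpha>.\<close>

definition curve :: "orbit set" where
  "curve = {(\<alpha>, L, z). (\<alpha>, L, z) \<in> sops_set \<and> (\<exists>\<epsilon> \<tau>. 0 < \<epsilon> \<and> \<epsilon> < 0.1 \<and> \<alpha> = \<alpha>h \<epsilon> \<and> L = 2 * pi / \<omega>h \<epsilon>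
     \<and> (\<forall>s. apply_bcontfun z s = Yp \<epsilon> (s - \<tau>)))}"

lemma in_curveI:
  assumes p: "(\<alpha>, L, z) \<in> sops_set" and M: "\<And>s. \<bar>apply_bcontfun z s\<bar> \<le> 1" and \<alpha>: "\<alpha> \<noteq> 0"
    and a1: "rfc (apply_bcontfun z) 1 \<noteq> 0" "cmod (rfc (apply_bcontfun z) 1) < 0.1"
    and loc: "is_local_zero (cmod (rfc (apply_bcontfun z) 1)) \<alpha> (2 * pi / L) (norm_coeffs (\<lambda>k. rfc (apply_bcontfun z) (int k)))"
  shows "(\<alpha>, L, z) \<in> curve"
proof -
  let ?z = "apply_bcontfun z"
  let ?e = "cmod (rfc ?z 1)" and ?c = "norm_coeffs (\<lambda>k. rfc ?z (int k))"
  from p have L: "L > 0" and w: "wright_profile \<alpha> (2 * pi / L) ?z" unfolding sops_set_iff by auto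
  have "2 * pi / L > 0" using L by simp
  from profile_normalize(3)[OF w M order_refl \<alpha> this a1(1)]
  obtain \<theta> where \<theta>: "\<forall>s. ?z s = profile_of ?e ?c (s - \<theta>)" by blast
  have e: "0 < ?e" "?e \<le> 0.1" using a1 by auto
  have eq: "\<alpha> = \<alpha>h ?e" "2 * pi / L = \<omega>h ?e" "?c = ch ?e"
    using unique_zero[OF e] loc by blast+
  have "L = 2 * pi / \<omega>h ?e" using L eq(2)[symmetric] by simp
  moreover have "\<forall>s. ?z s = Yp ?e (s - \<theta>)" unfolding Yp_def eq(3)[symmetric] by (rule \<theta>)
  ultimately show ?thesis unfolding curve_def using p e(1) a1(2) eq(1) by blast
qed

text \<open>A translation rotates the k-th coefficient by k times a fixed angle, which
  \<open>norm_coeffs\<close> undoes; so \<epsilon> and \<open>ch \<epsilon>\<close> can be read off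
  from any translate.\<close>

lemma curve_coeffs:
  assumes \<epsilon>: "\<epsilon> \<in> {0<..0.1}" and z: "\<And>s. z s = Yp \<epsilon> (s - \<tau>)"
  shows "cmod (rfc z 1) = \<epsilon>" "rfc z 1 \<noteq> 0" "norm_coeffs (\<lambda>k. rfc z (int k)) = ch \<epsilon>"
proof -
  let ?b = "\<lambda>k. cis (of_nat k * (- (2 * pi * \<tau>))) * coef \<epsilon> k"
  have bl: "?b \<in> l1" using coef_facts(1,3)[OF \<epsilon>] by (simp add: l1_def norm_mult)
  have "z s = tsum ?b (2 * pi * s)" for s
    using tsum_shift[of "coef \<epsilon>" "2 * pi * s" "- (2 * pi * \<tau>)"] by (simp add: z Yp_tsum right_diff_distrib)
  then have r: "rfc z (int k) = ?b k" for k using fc_tsum[OF bl, of k] by simp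
  have c1: "coef \<epsilon> 1 = of_real \<epsilon>" using ch_facts(3)[OF \<epsilon>] by (simp add: coef_def unit_seq_def)
  have r1: "rfc z 1 = cis (- (2 * pi * \<tau>)) * of_real \<epsilon>" using r[of 1] c1 by simp
  then show n: "cmod (rfc z 1) = \<epsilon>" using \<epsilon> by (simp add: norm_mult)
  then show "rfc z 1 \<noteq> 0" using \<epsilon> by auto
  show "norm_coeffs (\<lambda>k. rfc z (int k)) = ch \<epsilon>"
  proof
    fix k
    have rr: "rfc z (int 1) = rfc z 1" by simp
    have u: "cnj (rfc z 1) / of_real \<epsilon> = cis (2 * pi * \<tau>)" using \<epsilon> by (simp add: r1 cis_cnj)
    show "norm_coeffs (\<lambda>k. rfc z (int k)) k = ch \<epsilon> k"
    proof (cases "k \<le> 1")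
      case True
      then have "k = 0 \<or> k = 1" by auto
      then show ?thesis using ch_facts(2,3)[OF \<epsilon>] by (auto simp: norm_coeffs_def)
    next
      case False
      then have "norm_coeffs (\<lambda>k. rfc z (int k)) k = ?b k * cis (2 * pi * \<tau>) ^ k / of_real \<epsilon>"
        unfolding norm_coeffs_def rr n u by (simp add: r)
      also have "\<dots> = coef \<epsilon> k / of_real \<epsilon>"
      proof -
        have "cis (of_nat k * (- (2 * pi * \<tau>))) * cis (2 * pi * \<tau>) ^ k = 1"
          by (simp add: Complex.DeMoivre cis_mult)
        then show ?thesis by (metis mult.assoc mult.commute mult_1)
      qed
      also have "\<dots> = ch \<epsilon> k" using False \<epsilon> by (simp add: coef_def unit_seq_def)
      finally show ?thesis .
    qed
  qed
qed

end

text \<open>A majorant of the form C / k^2 for \<open>tendsto_l1_norm\<close>; only k = 2 counts,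
  where 0.4473 < 2 / 4.\<close>

lemma c_bar_decay: "0 < \<epsilon> \<Longrightarrow> \<epsilon> \<le> 1 \<Longrightarrow> cmod (c_bar \<epsilon> k) \<le> 2 / real k ^ 2"
proof -
  assume e: "0 < \<epsilon>" "\<epsilon> \<le> 1"
  have "cmod ((2 - \<i>) / 5 * of_real \<epsilon>) \<le> 1 / 2 * 1"
    unfolding norm_mult using e cmod_kappa by (intro mult_mono) auto
  then show ?thesis by (cases "k = 2") (auto simp: c_bar_def unit_seq_def norm_mult)
qed

section \<open>Relative openness along the curve and at the Hopf point\<close>

context zero_branch begin

text \<open>Uniform convergence gives convergence of each coefficient, the common decay of order 1 /
  k^3 turns this into convergence of the weighted norms, and the window of
  \<open>is_local_zero\<close> is given by strict inequalities, so it is entered eventually.\<close>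

lemma curve_open:
  assumes p: "p \<in> curve" and X: "\<And>n. X n \<in> sops_set" and lim: "X \<longlonglongrightarrow> p"
  shows "\<forall>\<^sub>F n in sequentially. X n \<in> curve"
proof -
  obtain \<alpha> L z where pe: "p = (\<alpha>, L, z)" by (cases p)
  define a where "a n = fst (X n)" for n
  define l where "l n = fst (snd (X n))" for n
  define y where "y n = snd (snd (X n))" for n
  have Xe: "X n = (a n, l n, y n)" for n by (simp add: a_def l_def y_def)
  have ta: "a \<longlonglongrightarrow> \<alpha>" and tl: "l \<longlonglongrightarrow> L" and ty: "y \<longlonglongrightarrow> z"
    using tendsto_orbit[OF lim[unfolded pe]] by (simp_all add: a_def[abs_def] l_def[abs_def] y_def[abs_def])
  from p obtain \<epsilon> \<tau> where e: "0 < \<epsilon>" "\<epsilon> < 0.1" and \<alpha>: "\<alpha> = \<alpha>h \<epsilon>" and L: "L = 2 * pi / \<omega>h \<epsilon>"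
    and zY: "\<And>s. apply_bcontfun z s = Yp \<epsilon> (s - \<tau>)" unfolding curve_def pe by blast
  have \<epsilon>: "\<epsilon> \<in> {0<..0.1}" using e by simp
  note cf = coef_facts[OF \<epsilon>] and cc = curve_coeffs[OF \<epsilon>, of "apply_bcontfun z", OF zY]
  have \<alpha>0: "\<alpha> > 0" and L0: "L > 0" using cf(7,8) by (simp_all add: \<alpha> L)
  have \<omega>L: "2 * pi / L = \<omega>h \<epsilon>" using cf(7) by (simp add: L)
  define r where "r n k = rfc (apply_bcontfun (y n)) (int k)" for n k
  have rn: "(\<lambda>k. rfc (apply_bcontfun (y n)) (int k)) = r n" for n by (simp add: r_def fun_eq_iff)
  define r0 where "r0 k = rfc (apply_bcontfun z) (int k)" for k
  have tr: "(\<lambda>n. r n k) \<longlonglongrightarrow> r0 k" for k unfolding r_def r0_def by (rule rfc_tendsto[OF ty])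
  have r01: "cmod (r0 1) = \<epsilon>" "r0 1 \<noteq> 0" "norm_coeffs r0 = ch \<epsilon>" using cc by (simp_all add: r0_def[abs_def])
  define \<epsilon>' where "\<epsilon>' n = cmod (r n 1)" for n
  have te: "\<epsilon>' \<longlonglongrightarrow> \<epsilon>" unfolding \<epsilon>'_def[abs_def] r01(1)[symmetric] by (intro tendsto_norm tr)
  define c where "c n = norm_coeffs (r n)" for n
  have tc: "(\<lambda>n. c n k) \<longlonglongrightarrow> ch \<epsilon> k" for k
  proof (cases "k \<le> 1")
    case True
    then show ?thesis unfolding c_def r01(3)[symmetric] norm_coeffs_def by simp
  next
    case False
    have "(\<lambda>n. r n k * (cnj (r n 1) / of_real (cmod (r n 1))) ^ k / of_real (cmod (r n 1))) \<longlonglongrightarrow>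
       r0 k * (cnj (r0 1) / of_real (cmod (r0 1))) ^ k / of_real (cmod (r0 1))"
      using r01(2) by (intro tendsto_intros tr) auto
    then show ?thesis using False unfolding c_def r01(3)[symmetric] norm_coeffs_def by simp
  qed
  \<comment> \<open>With \<omega> = 2 pi / L the factor in the decay bound is \<alpha> L; the added
    1 leaves room for nearby solutions and ensures 1 \<le> B.\<close>
  define B where "B = \<alpha> * L + 1"
  have B: "1 \<le> B" using \<alpha>0 L0 by (simp add: B_def)
  have dy: "(\<lambda>n. dist (y n) z) \<longlonglongrightarrow> 0" using ty tendsto_dist_iff by blast
  have tw: "(\<lambda>n. 2 * pi / l n) \<longlonglongrightarrow> \<omega>h \<epsilon>" unfolding \<omega>L[symmetric] using L0 by (intro tendsto_intros tl) auto
  have tal: "(\<lambda>n. \<bar>a n * l n\<bar>) \<longlonglongrightarrow> \<bar>\<alpha> * L\<bar>" by (intro tendsto_intros ta tl)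
  have ev1: "\<forall>\<^sub>F n in sequentially. \<epsilon> / 2 < \<epsilon>' n \<and> \<epsilon>' n < 0.1 \<and> 0 < a n \<and> 0 < l n \<and> dist (y n) z < 1/2 \<and> \<bar>a n * l n\<bar> < B"
    by (intro eventually_conj order_tendstoD[OF te] order_tendstoD[OF ta] order_tendstoD[OF tl] order_tendstoD[OF dy] order_tendstoD[OF tal])
       (use e \<alpha>0 L0 in \<open>auto simp: B_def\<close>)
  have good: "\<forall>\<^sub>F n in sequentially. (\<forall>s. \<bar>apply_bcontfun (y n) s\<bar> \<le> 1) \<and>
      (\<forall>k>0. cmod (r n k) \<le> B ^ 3 / real k ^ 3) \<and> c n \<in> lK_0 \<and> (\<forall>k. F_map (\<epsilon>' n) (a n) (2 * pi / l n) (c n) k = 0)"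
    using ev1
  proof eventually_elim
    case (elim n)
    have M: "\<bar>apply_bcontfun (y n) s\<bar> \<le> 1" for s
    proof -
      have "\<bar>apply_bcontfun (y n) s - apply_bcontfun z s\<bar> < 1/2"
        using dist_bounded[of "y n" s z] elim by (simp add: dist_real_def)
      moreover have "\<bar>apply_bcontfun z s\<bar> < 1/4" unfolding zY using cf(6)[of "s - \<tau>"] by simp
      ultimately show ?thesis by linarith
    qed
    have w: "wright_profile (a n) (2 * pi / l n) (apply_bcontfun (y n))"
      using X[of n] unfolding Xe sops_set_iff by blast
    have p: "2 * pi / l n > 0" "a n \<noteq> 0" using elim by auto
    have b: "\<bar>a n * (2 * pi / (2 * pi / l n))\<bar> \<le> B"
    proof -
      have "\<bar>a n * l n\<bar> < B" using elim by blast
      moreover have "a n * (2 * pi / (2 * pi / l n)) = a n * l n" by simp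
      ultimately show ?thesis by (simp only: less_imp_le)
    qed
    have "cmod (r n k) \<le> B ^ 3 / real k ^ 3" if "0 < k" for k
      using profile_coeff_decay[OF w M order_refl b B that] by (simp add: r_def)
    moreover have r1: "rfc (apply_bcontfun (y n)) 1 = r n 1" by (simp add: r_def)
    then have "rfc (apply_bcontfun (y n)) 1 \<noteq> 0" using elim e by (auto simp: \<epsilon>'_def)
    note pn = profile_normalize[OF w M order_refl p(2,1) this, unfolded r1 rn, folded \<epsilon>'_def c_def]
    ultimately show ?case using M pn(1,2) by blast
  qed
  \<comment> \<open>The first coefficient exceeds \<epsilon> / 2, so normalizing multiplies the
    decay bound by at most 2 / \<epsilon>; the summand 2 is for \<open>c_bar\<close>.\<close>
  define C where "C = 2 * B ^ 3 / \<epsilon> + 2"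
  have bound: "\<forall>\<^sub>F n in sequentially. \<forall>k. cmod (K_inv (c n) k) \<le> C / real k ^ 2 \<and> cmod (c n k - c_bar (\<epsilon>' n) k) \<le> C / real k ^ 2"
    using ev1 good
  proof eventually_elim
    case (elim n)
    show ?case
    proof
      fix k
      have c0: "cmod (K_inv (c n) k) \<le> (2 * B ^ 3 / \<epsilon>) / real k ^ 2 \<and> cmod (c n k) \<le> (2 * B ^ 3 / \<epsilon>) / real k ^ 2"
      proof (cases "k \<le> 1")
        case True
        then show ?thesis using B e by (simp add: c_def norm_coeffs_def K_inv_def)
      next
        case False
        then have k: "real k > 0" "k \<ge> 1" by auto
        have "cmod (cnj (r n 1) / of_real (cmod (r n 1))) = 1" using elim(1) e by (auto simp: norm_divide \<epsilon>'_def)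
        then have "cmod (c n k) = cmod (r n k) / \<epsilon>' n"
          using False by (simp add: c_def norm_coeffs_def norm_divide norm_mult norm_power \<epsilon>'_def)
        also have "\<dots> \<le> (B ^ 3 / real k ^ 3) / (\<epsilon> / 2)"
          using elim e k B by (intro frac_le) auto
        finally have 1: "cmod (c n k) \<le> (2 * B ^ 3 / \<epsilon>) / real k ^ 3" by (simp add: mult_ac)
        have "cmod (K_inv (c n) k) = real k * cmod (c n k)" by (simp add: K_inv_def norm_mult)
        also have "\<dots> \<le> real k * ((2 * B ^ 3 / \<epsilon>) / real k ^ 3)" using 1 k by (intro mult_left_mono) auto
        also have "\<dots> = (2 * B ^ 3 / \<epsilon>) / real k ^ 2" using k by (simp add: power2_eq_square power3_eq_cube)
        finally have 2: "cmod (K_inv (c n) k) \<le> (2 * B ^ 3 / \<epsilon>) / real k ^ 2" .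
        have "cmod (c n k) \<le> cmod (K_inv (c n) k)"
          using mult_right_mono[of 1 "real k" "cmod (c n k)"] k by (simp add: K_inv_def norm_mult)
        then show ?thesis using 2 by linarith
      qed
      moreover have "cmod (c_bar (\<epsilon>' n) k) \<le> 2 / real k ^ 2" using elim(1) e by (intro c_bar_decay) auto
      moreover have "cmod (c n k - c_bar (\<epsilon>' n) k) \<le> cmod (c n k) + cmod (c_bar (\<epsilon>' n) k)" by (rule norm_triangle_ineq4)
      moreover have "C / real k ^ 2 = (2 * B ^ 3 / \<epsilon>) / real k ^ 2 + 2 / real k ^ 2" by (simp add: C_def add_divide_distrib)
      moreover have "0 \<le> 2 / real k ^ 2" by simp
      ultimately show "cmod (K_inv (c n) k) \<le> C / real k ^ 2 \<and> cmod (c n k - c_bar (\<epsilon>' n) k) \<le> C / real k ^ 2"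
        by linarith
    qed
  qed
  have tK: "(\<lambda>n. l1_norm (K_inv (c n))) \<longlonglongrightarrow> l1_norm (K_inv (ch \<epsilon>))"
  proof (rule tendsto_l1_norm)
    show "(\<lambda>n. K_inv (c n) k) \<longlonglongrightarrow> K_inv (ch \<epsilon>) k" for k unfolding K_inv_def by (intro tendsto_intros tc)
    show "\<forall>\<^sub>F n in sequentially. \<forall>k. cmod (K_inv (c n) k) \<le> C / real k ^ 2" using bound by eventually_elim blast
  qed
  have td: "(\<lambda>n. l1_norm (\<lambda>k. c n k - c_bar (\<epsilon>' n) k)) \<longlonglongrightarrow> l1_norm (\<lambda>k. ch \<epsilon> k - c_bar \<epsilon> k)"
  proof (rule tendsto_l1_norm)
    show "(\<lambda>n. c n k - c_bar (\<epsilon>' n) k) \<longlonglongrightarrow> ch \<epsilon> k - c_bar \<epsilon> k" for k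
      unfolding c_bar_def by (intro tendsto_intros tc te)
    show "\<forall>\<^sub>F n in sequentially. \<forall>k. cmod (c n k - c_bar (\<epsilon>' n) k) \<le> C / real k ^ 2" using bound by eventually_elim blast
  qed
  note lz = local_zero[OF \<epsilon>, unfolded is_local_zero_def]
  have less: "\<forall>\<^sub>F n in sequentially. f n < g n" if "f \<longlonglongrightarrow> lf" "g \<longlonglongrightarrow> lg" "lf < lg" for f g :: "nat \<Rightarrow> real" and lf lg
    using order_tendstoD(1)[OF tendsto_diff[OF that(2,1)], of 0] that(3) by (auto elim: eventually_mono)
  have tsq: "(\<lambda>n. x * (\<epsilon>' n)\<^sup>2) \<longlonglongrightarrow> x * \<epsilon>\<^sup>2" for x by (intro tendsto_intros te)
  have tA: "(\<lambda>n. \<bar>a n - alpha_bar (\<epsilon>' n)\<bar>) \<longlonglongrightarrow> \<bar>\<alpha> - alpha_bar \<epsilon>\<bar>"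
    unfolding alpha_bar_def by (intro tendsto_intros ta te) auto
  have tO: "(\<lambda>n. \<bar>2 * pi / l n - omega_bar (\<epsilon>' n)\<bar>) \<longlonglongrightarrow> \<bar>\<omega>h \<epsilon> - omega_bar \<epsilon>\<bar>"
    unfolding omega_bar_def by (intro tendsto_intros tw te) auto
  have evA: "\<forall>\<^sub>F n in sequentially. \<bar>a n - alpha_bar (\<epsilon>' n)\<bar> < 0.0594 * (\<epsilon>' n)\<^sup>2"
    by (rule less[OF tA tsq]) (use lz \<alpha> in blast)
  have evO: "\<forall>\<^sub>F n in sequentially. \<bar>2 * pi / l n - omega_bar (\<epsilon>' n)\<bar> < 0.0260 * (\<epsilon>' n)\<^sup>2"
    by (rule less[OF tO tsq]) (use lz in blast)
  have evC: "\<forall>\<^sub>F n in sequentially. l1_norm (\<lambda>k. c n k - c_bar (\<epsilon>' n) k) < 0.4929 * (\<epsilon>' n)\<^sup>2"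
    by (rule less[OF td tsq]) (use lz in blast)
  have evK: "\<forall>\<^sub>F n in sequentially. l1_norm (K_inv (c n)) < 0.3191"
    by (rule order_tendstoD(2)[OF tK]) (use lz in simp)
  show ?thesis using ev1 good evA evO evC evK
  proof eventually_elim
    case (elim n)
    have r1: "rfc (apply_bcontfun (y n)) 1 = r n 1" by (simp add: r_def)
    have loc: "is_local_zero (\<epsilon>' n) (a n) (2 * pi / l n) (c n)"
      unfolding is_local_zero_def using elim by blast
    show ?case unfolding Xe
    proof (rule in_curveI)
      show "(a n, l n, y n) \<in> sops_set" using X[of n] unfolding Xe .
      show "is_local_zero (cmod (rfc (apply_bcontfun (y n)) 1)) (a n) (2 * pi / l n) (norm_coeffs (\<lambda>k. rfc (apply_bcontfun (y n)) (int k)))"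
        using loc unfolding r1 rn \<epsilon>'_def c_def .
      show "rfc (apply_bcontfun (y n)) 1 \<noteq> 0" "cmod (rfc (apply_bcontfun (y n)) 1) < 0.1"
        unfolding r1 using elim(1) e by (auto simp: \<epsilon>'_def)
      show "a n \<noteq> 0" "\<bar>apply_bcontfun (y n) s\<bar> \<le> 1" for s using elim by auto
    qed
  qed
qed

text \<open>Here \<epsilon> tends to 0 and the window shrinks with it, so convergence of norms is
  not enough. \<open>hopf_apriori\<close> bounds the higher modes by a multiple of \<epsilon>^2,
  which after normalization is the linear bound on c that \<open>hopf_local_zero\<close>
  expects.\<close>

lemma hopf_open:
  assumes X: "\<And>n. X n \<in> sops_set" and lim: "X \<longlonglongrightarrow> hopf_point"
  shows "\<forall>\<^sub>F n in sequentially. X n \<in> curve"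
proof -
  define a where "a n = fst (X n)" for n
  define l where "l n = fst (snd (X n))" for n
  define y where "y n = snd (snd (X n))" for n
  have Xe: "X n = (a n, l n, y n)" for n by (simp add: a_def l_def y_def)
  have ta: "a \<longlonglongrightarrow> pi / 2" and tl: "l \<longlonglongrightarrow> 4" and ty: "y \<longlonglongrightarrow> 0"
    using tendsto_orbit[OF lim[unfolded hopf_point_def]] by (simp_all add: a_def[abs_def] l_def[abs_def] y_def[abs_def])
  define M where "M n = dist (y n) 0" for n
  have tM: "M \<longlonglongrightarrow> 0" unfolding M_def[abs_def] using ty tendsto_dist_iff by blast
  have yM: "\<bar>apply_bcontfun (y n) s\<bar> \<le> M n" for n s
    using dist_bounded[of "y n" s 0] by (simp add: M_def dist_real_def)
  define \<omega> where "\<omega> n = 2 * pi / l n" for n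
  have tw: "\<omega> \<longlonglongrightarrow> pi / 2"
  proof -
    have "\<omega> \<longlonglongrightarrow> 2 * pi / 4" unfolding \<omega>_def[abs_def] by (intro tendsto_intros tl) auto
    then show ?thesis by simp
  qed
  define r where "r n k = rfc (apply_bcontfun (y n)) (int k)" for n k
  have rn: "(\<lambda>k. rfc (apply_bcontfun (y n)) (int k)) = r n" for n by (simp add: r_def fun_eq_iff)
  define Z where "Z = (\<Sum>k. 1 / real k ^ 2)"
  have tal: "(\<lambda>n. \<bar>a n * l n\<bar>) \<longlonglongrightarrow> \<bar>pi / 2 * 4\<bar>" by (intro tendsto_intros ta tl)
  have tMZ: "(\<lambda>n. 512 * M n * Z) \<longlonglongrightarrow> 512 * 0 * Z" by (intro tendsto_intros tM)
  have pi: "3.1415 < pi" "pi < 3.1416" using pi_approx by simp_all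
  have "\<forall>\<^sub>F n in sequentially. M n < 0.1 \<and> 0 < l n \<and> \<bar>a n * l n\<bar> < 8 \<and> \<bar>a n - pi / 2\<bar> < 0.1 \<and> \<bar>\<omega> n - pi / 2\<bar> < 0.1 \<and> 512 * M n * Z < 0.08"
    by (intro eventually_conj order_tendstoD[OF tM] order_tendstoD[OF tl] order_tendstoD[OF tal] order_tendstoD[OF tMZ]
        order_tendstoD(2)[OF tendsto_rabs[OF LIM_zero[OF ta]]] order_tendstoD(2)[OF tendsto_rabs[OF LIM_zero[OF tw]]])
       (use pi in auto)
  then obtain N where N: "\<And>n. n \<ge> N \<Longrightarrow> M n < 0.1 \<and> 0 < l n \<and> \<bar>a n * l n\<bar> < 8 \<and> \<bar>a n - pi / 2\<bar> < 0.1 \<and> \<bar>\<omega> n - pi / 2\<bar> < 0.1 \<and> 512 * M n * Z < 0.08"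
    unfolding eventually_sequentially by blast
  define \<epsilon> where "\<epsilon> n = cmod (r n 1)" for n
  define c where "c n = norm_coeffs (r n)" for n
  have r1: "rfc (apply_bcontfun (y n)) 1 = r n 1" for n by (simp add: r_def)
  have eM: "\<epsilon> n \<le> M n" for n
    unfolding \<epsilon>_def r_def by (rule fc_bound) (use yM in \<open>auto intro!: continuous_intros\<close>)
  have main: "a n > 0 \<and> \<epsilon> n > 0 \<and> c n \<in> lK_0 \<and> (\<forall>k. F_map (\<epsilon> n) (a n) (\<omega> n) (c n) k = 0) \<and> l1_norm (K_inv (c n)) \<le> 48 * \<epsilon> n"
    if n: "n \<ge> N" for n
  proof -
    note Nn = N[OF n]
    have "- (a n - pi / 2) < 0.1" using Nn abs_less_iff[of "a n - pi / 2" "0.1"] by blast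
    then have a0: "a n > 0" using pi by simp
    have w: "wright_profile (a n) (\<omega> n) (apply_bcontfun (y n))" and sp: "sign_pattern (l n) (apply_bcontfun (y n))"
      using X[of n] unfolding Xe sops_set_iff \<omega>_def by blast+
    have \<omega>0: "\<omega> n > 0" using Nn by (simp add: \<omega>_def)
    have M1: "M n \<le> 1" using Nn by simp
    have b: "\<bar>a n * (2 * pi / \<omega> n)\<bar> \<le> 8" using Nn by (simp add: \<omega>_def)
    \<comment> \<open>512 = 8^3, as \<alpha> L tends to 2 pi < 8.\<close>
    have dec: "cmod (r n k) \<le> 512 * M n / real k ^ 3" if "0 < k" for k
      using profile_coeff_decay[OF w yM M1 b _ that] by (simp add: r_def)
    have an: "a n \<noteq> 0" using a0 by simp
    note ps = profile_series[OF w yM M1 an \<omega>0, unfolded rn]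
    have r0: "r n 0 = 0" using ps(1) by (simp add: r_def)
    have t0: "tail (K_inv (r n)) 0 \<le> 0.08"
    proof -
      have "tail (K_inv (r n)) 0 = (\<Sum>k. cmod (K_inv (r n) k))" by (simp add: tail_def)
      also have "\<dots> \<le> (\<Sum>k. 512 * M n * (1 / real k ^ 2))"
      proof (rule suminf_le)
        show "cmod (K_inv (r n) k) \<le> 512 * M n * (1 / real k ^ 2)" for k
          using dec[of k] by (cases "k = 0") (auto simp: K_inv_def norm_mult field_simps power2_eq_square power3_eq_cube)
        show "summable (\<lambda>k. cmod (K_inv (r n) k))" using ps(2) by (simp add: l1_def)
        show "summable (\<lambda>k. 512 * M n * (1 / real k ^ 2))" by (intro summable_mult summable_inverse_squares)
      qed
      also have "\<dots> = 512 * M n * Z" unfolding Z_def by (rule suminf_mult[OF summable_inverse_squares])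
      also have "\<dots> < 0.08" using Nn by blast
      finally show ?thesis by (rule less_imp_le)
    qed
    have t2: "tail (K_inv (r n)) 2 \<le> 24 * (\<epsilon> n)\<^sup>2"
      unfolding \<epsilon>_def by (rule hopf_apriori[OF r0 ps(2,5)]) (use Nn t0 in auto)
    \<comment> \<open>By the quadratic bound a vanishing first coefficient would annihilate all
      coefficients and hence the solution, which has a positive phase.\<close>
    have e0: "\<epsilon> n > 0"
    proof (rule ccontr)
      assume "\<not> \<epsilon> n > 0"
      then have z: "\<epsilon> n = 0" "r n 1 = 0" by (auto simp: \<epsilon>_def)
      have rk: "r n k = 0" for k
      proof -
        consider "k = 0" | "k = 1" | "k \<ge> 2" by linarith
        then show ?thesis
        proof cases
          case 3
          have "cmod (K_inv (r n) k) \<le> tail (K_inv (r n)) k" by (rule cmod_le_tail[OF ps(2)])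
          also have "\<dots> \<le> tail (K_inv (r n)) 2" by (rule tail_antimono[OF ps(2) 3])
          also have "\<dots> \<le> 0" using t2 z by simp
          finally have "K_inv (r n) k = 0" by simp
          then show ?thesis using 3 by (simp add: K_inv_def)
        qed (use z r0 in auto)
      qed
      have "apply_bcontfun (y n) s = 0" for s using ps(4)[of s] by (simp add: tsum_def rk)
      then show False using sops_nonzero[OF sp] Nn by auto
    qed
    then have r10: "rfc (apply_bcontfun (y n)) 1 \<noteq> 0" unfolding r1 by (auto simp: \<epsilon>_def)
    note pn = profile_normalize[OF w yM M1 an \<omega>0 r10, unfolded r1 rn, folded \<epsilon>_def c_def]
    have cf: "c n 0 = 0" "c n 1 = 0" "K_inv (c n) \<in> l1" using pn(1) by (auto simp: lK_0_def l1_0_def l1_def)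
    have "tail (K_inv (c n)) 0 = tail (K_inv (c n)) 2"
      using tail_Suc[OF cf(3), of 0] tail_Suc[OF cf(3), of 1] cf by (simp add: K_inv_def numeral_2_eq_2)
    also have "\<dots> = tail (K_inv (r n)) 2 / \<epsilon> n"
    proof -
      have u: "cmod (cnj (r n 1) / of_real (cmod (r n 1))) = 1" using e0 by (auto simp: norm_divide \<epsilon>_def)
      have "cmod (K_inv (c n) (k + 2)) = cmod (K_inv (r n) (k + 2)) / \<epsilon> n" for k
      proof -
        have "cmod (c n (k + 2)) = cmod (r n (k + 2)) / \<epsilon> n"
          using u by (simp add: c_def norm_coeffs_def norm_divide norm_mult norm_power \<epsilon>_def)
        then show ?thesis unfolding K_inv_def norm_mult by simp
      qed
      then show ?thesis unfolding tail_def by (simp only: suminf_divide[OF tail_summable[OF ps(2)]])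
    qed
    also have "\<dots> \<le> 24 * (\<epsilon> n)\<^sup>2 / \<epsilon> n" using t2 e0 by (intro divide_right_mono) auto
    also have "\<dots> = 24 * \<epsilon> n" using e0 by (simp add: power2_eq_square)
    finally have "l1_norm (K_inv (c n)) \<le> 48 * \<epsilon> n" by (simp add: l1_norm_tail)
    then show ?thesis using a0 e0 pn(1,2) by blast
  qed
  have te: "\<epsilon> \<longlonglongrightarrow> 0"
    by (rule Lim_null_comparison[OF _ tM]) (use eM in \<open>auto simp: \<epsilon>_def\<close>)
  have "\<forall>\<^sub>F n in sequentially. is_local_zero (\<epsilon> (n + N)) (a (n + N)) (\<omega> (n + N)) (c (n + N))"
    by (rule hopf_local_zero) (use main LIMSEQ_ignore_initial_segment[OF te, of N] LIMSEQ_ignore_initial_segment[OF ta, of N]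
      LIMSEQ_ignore_initial_segment[OF tw, of N] in auto)
  then have "\<forall>\<^sub>F n in sequentially. is_local_zero (\<epsilon> n) (a n) (\<omega> n) (c n)"
    by (rule eventually_sequentially_seg[THEN iffD1])
  then show ?thesis using eventually_ge_at_top[of N]
  proof eventually_elim
    case (elim n)
    note Nn = N[OF elim(2)] and mn = main[OF elim(2)]
    show ?case unfolding Xe
    proof (rule in_curveI)
      show "(a n, l n, y n) \<in> sops_set" using X[of n] unfolding Xe .
      show "is_local_zero (cmod (rfc (apply_bcontfun (y n)) 1)) (a n) (2 * pi / l n) (norm_coeffs (\<lambda>k. rfc (apply_bcontfun (y n)) (int k)))"
        using elim(1) unfolding r1 rn \<epsilon>_def c_def \<omega>_def .
      show "rfc (apply_bcontfun (y n)) 1 \<noteq> 0" unfolding r1 using mn by (auto simp: \<epsilon>_def)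
      show "cmod (rfc (apply_bcontfun (y n)) 1) < 0.1" unfolding r1 using eM[of n] Nn by (simp add: \<epsilon>_def)
      show "a n \<noteq> 0" using mn by auto
      show "\<bar>apply_bcontfun (y n) s\<bar> \<le> 1" for s using yM[of n s] Nn by simp
    qed
  qed
qed

end

lemma closedinI_sequential:
  fixes S :: "'a :: first_countable_topology set"
  assumes "S \<subseteq> T" "\<And>X p. (\<forall>n. X n \<in> S) \<and> p \<in> T \<and> X \<longlonglongrightarrow> p \<Longrightarrow> p \<in> S"
  shows "closedin (top_of_set T) S"
  unfolding closedin_limpt islimpt_sequential using assms by blast

section \<open>Monotonicity, closedness and the graph over \<alpha>\<close>

context zero_branch begin

abbreviation Amax :: real where "Amax \<equiv> pi / 2 + 6.830 * 10 powi (-3)"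

text \<open>The origin of the constant 0.00683: 0.01 (3 pi / 2 - 1) / 5 - 0.01 * 0.0594 is about
  0.0068308, the infimum of \<alpha> - pi / 2 over the window at \<epsilon> = 0.1.\<close>

lemma Amax_less: "Amax < \<alpha>h 0.1"
proof -
  have pi: "3.1415 < pi" "pi < 3.1416" using pi_approx by simp_all
  have e: "(0.1::real) \<in> {0<..0.1}" by simp
  have "\<bar>\<alpha>h 0.1 - alpha_bar 0.1\<bar> < 0.0594 * 0.1\<^sup>2" using local_zero[OF e] unfolding is_local_zero_def by blast
  from abs_less_iff[THEN iffD1, OF this] have "alpha_bar 0.1 - 0.0594 * 0.1\<^sup>2 < \<alpha>h 0.1" by linarith
  moreover have "Amax < alpha_bar 0.1 - 0.0594 * 0.1\<^sup>2"
    using pi by (simp add: alpha_bar_def power2_eq_square power_int_minus field_simps)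
  ultimately show ?thesis by (rule less_trans[rotated])
qed

lemma alpha_continuous: "continuous_on {0<..0.1} \<alpha>h" and omega_continuous: "continuous_on {0<..0.1} \<omega>h"
  using first_derivatives DERIV_continuous unfolding continuous_on_eq_continuous_within by metis+

lemma alpha_strict_mono:
  assumes "\<epsilon>1 \<in> {0<..0.1}" "\<epsilon>2 \<in> {0<..0.1}" "\<epsilon>1 < \<epsilon>2" shows "\<alpha>h \<epsilon>1 < \<alpha>h \<epsilon>2"
proof (rule DERIV_pos_imp_increasing_open[OF assms(3)])
  show "continuous_on {\<epsilon>1..\<epsilon>2} \<alpha>h"
    by (rule continuous_on_subset[OF alpha_continuous]) (use assms in auto)
  fix x assume x: "\<epsilon>1 < x" "x < \<epsilon>2"
  then have "x \<in> {0<..0.1}" using assms by auto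
  then obtain d where d: "d > 0" "(\<alpha>h has_real_derivative d) (at x within {0<..0.1})"
    using alpha_derivative_positive by blast
  have "(\<alpha>h has_real_derivative d) (at x within {\<epsilon>1<..<\<epsilon>2})"
    by (rule has_field_derivative_subset[OF d(2)]) (use assms in auto)
  then have "(\<alpha>h has_real_derivative d) (at x)"
    using x at_within_open[of x "{\<epsilon>1<..<\<epsilon>2}"] by simp
  then show "\<exists>y. DERIV \<alpha>h x :> y \<and> y > 0" using d(1) by blast
qed

lemma alpha_inj: "\<epsilon>1 \<in> {0<..0.1} \<Longrightarrow> \<epsilon>2 \<in> {0<..0.1} \<Longrightarrow> \<alpha>h \<epsilon>1 = \<alpha>h \<epsilon>2 \<Longrightarrow> \<epsilon>1 = \<epsilon>2"
  using alpha_strict_mono[of \<epsilon>1 \<epsilon>2] alpha_strict_mono[of \<epsilon>2 \<epsilon>1] by (metis less_irrefl linorder_neqE_linordered_idom)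

lemma Yp_periodic: "\<epsilon> \<in> {0<..0.1} \<Longrightarrow> Yp \<epsilon> (s + of_int n) = Yp \<epsilon> s"
  using coef_facts(5)[of \<epsilon>] by (intro periodic_int) (simp add: wright_profile_def)

text \<open>Strict monotonicity identifies \<epsilon>, so both profiles are translates of the same
  one, and the sign pattern leaves a single translate.\<close>

lemma curve_unique:
  assumes "(\<alpha>, L, z) \<in> curve" "(\<alpha>, L', z') \<in> curve"
  shows "L = L'" "z = z'"
proof -
  from assms(1) obtain \<epsilon> \<tau> where s: "(\<alpha>, L, z) \<in> sops_set" and e: "0 < \<epsilon>" "\<epsilon> < 0.1" "\<alpha> = \<alpha>h \<epsilon>" "L = 2 * pi / \<omega>h \<epsilon>"
    and z: "\<And>s. apply_bcontfun z s = Yp \<epsilon> (s - \<tau>)" unfolding curve_def by blast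
  from assms(2) obtain \<epsilon>' \<tau>' where s': "(\<alpha>, L', z') \<in> sops_set" and e': "0 < \<epsilon>'" "\<epsilon>' < 0.1" "\<alpha> = \<alpha>h \<epsilon>'" "L' = 2 * pi / \<omega>h \<epsilon>'"
    and z': "\<And>s. apply_bcontfun z' s = Yp \<epsilon>' (s - \<tau>')" unfolding curve_def by blast
  have ee: "\<epsilon> = \<epsilon>'"
  proof (rule alpha_inj)
    show "\<epsilon> \<in> {0<..0.1}" "\<epsilon>' \<in> {0<..0.1}" using e(1,2) e'(1,2) by simp_all
    show "\<alpha>h \<epsilon> = \<alpha>h \<epsilon>'" using e(3) e'(3) by (rule trans[OF sym])
  qed
  show L: "L = L'" unfolding e(4) e'(4) ee by (rule refl)
  have zz: "apply_bcontfun z' s = apply_bcontfun z (s - (\<tau>' - \<tau>))" for s using z[of "s - (\<tau>' - \<tau>)"] z' ee by simp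
  have "apply_bcontfun z (s - (\<tau>' - \<tau>)) = apply_bcontfun z s" for s
  proof (rule sign_pattern_shift_unique)
    show "continuous_on UNIV (apply_bcontfun z)" by simp
    show "apply_bcontfun z (s + 1) = apply_bcontfun z s" for s using s unfolding sops_set_iff wright_profile_def by blast
    show "L > 0" "sign_pattern L (apply_bcontfun z)" using s unfolding sops_set_iff by blast+
    show "sign_pattern L (\<lambda>s. apply_bcontfun z (s - (\<tau>' - \<tau>)))" using s' L unfolding sops_set_iff zz[symmetric] by simp
  qed
  then show "z = z'" by (intro bcontfun_eqI) (simp add: zz)
qed

text \<open>Compactness of the parameters, \<epsilon> in [0, 0.1] and the translation modulo the
  period. The limit of \<epsilon> is not 0, since \<alpha> would be at most pi / 2, and not 0.1, by
  \<open>Amax_less\<close>.\<close>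

lemma curve_closed:
  assumes X: "\<And>n. X n \<in> curve" and lim: "X \<longlonglongrightarrow> p" and p: "p \<in> sops_set" "pi / 2 < fst p" "fst p \<le> Amax"
  shows "p \<in> curve"
proof -
  obtain \<alpha> L z where pe: "p = (\<alpha>, L, z)" by (cases p)
  have "\<forall>n. \<exists>\<epsilon> \<tau>. 0 < \<epsilon> \<and> \<epsilon> < 0.1 \<and> fst (X n) = \<alpha>h \<epsilon> \<and> fst (snd (X n)) = 2 * pi / \<omega>h \<epsilon>
     \<and> (\<forall>s. apply_bcontfun (snd (snd (X n))) s = Yp \<epsilon> (s - \<tau>))"
  proof
    fix n show "\<exists>\<epsilon> \<tau>. 0 < \<epsilon> \<and> \<epsilon> < 0.1 \<and> fst (X n) = \<alpha>h \<epsilon> \<and> fst (snd (X n)) = 2 * pi / \<omega>h \<epsilon>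
     \<and> (\<forall>s. apply_bcontfun (snd (snd (X n))) s = Yp \<epsilon> (s - \<tau>))"
    proof -
      obtain a l y where x: "X n = (a, l, y)" by (cases "X n")
      show ?thesis using X[of n] unfolding x curve_def mem_Collect_eq case_prod_conv fst_conv snd_conv by blast
    qed
  qed
  then obtain e t where e: "\<And>n. 0 < e n" "\<And>n. e n < 0.1" and Xa: "\<And>n. fst (X n) = \<alpha>h (e n)" and Xl: "\<And>n. fst (snd (X n)) = 2 * pi / \<omega>h (e n)"
    and Xz: "\<And>n s. apply_bcontfun (snd (snd (X n))) s = Yp (e n) (s - t n)" by metis
  have eI: "e n \<in> {0<..0.1}" for n using e[of n] by simp
  have comp: "compact ({0..0.1::real} \<times> {0..1::real})" by (intro compact_Times compact_Icc)
  have "(e n, frac (t n)) \<in> {0..0.1} \<times> {0..1}" for n using e[of n] frac_lt_1[of "t n"] by (simp add: less_imp_le)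
  then obtain l \<phi> where l: "l \<in> {0..0.1} \<times> {0..1}" and \<phi>: "strict_mono \<phi>" and tl: "((\<lambda>n. (e n, frac (t n))) \<circ> \<phi>) \<longlonglongrightarrow> l"
    using comp[unfolded compact_def, rule_format, of "\<lambda>n. (e n, frac (t n))"] by blast
  obtain \<epsilon> \<tau> where le: "l = (\<epsilon>, \<tau>)" by (cases l)
  have te: "(\<lambda>n. e (\<phi> n)) \<longlonglongrightarrow> \<epsilon>" and tt: "(\<lambda>n. frac (t (\<phi> n))) \<longlonglongrightarrow> \<tau>"
    using tendsto_fst[OF tl] tendsto_snd[OF tl] by (simp_all add: le o_def)
  have limX: "(\<lambda>n. X (\<phi> n)) \<longlonglongrightarrow> (\<alpha>, L, z)" using LIMSEQ_subseq_LIMSEQ[OF lim \<phi>] by (simp add: o_def pe)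
  note tX = tendsto_orbit[OF limX]
  have ta: "(\<lambda>n. \<alpha>h (e (\<phi> n))) \<longlonglongrightarrow> \<alpha>" and tL: "(\<lambda>n. 2 * pi / \<omega>h (e (\<phi> n))) \<longlonglongrightarrow> L" using tX by (simp_all add: Xa Xl)
  have \<epsilon>01: "0 \<le> \<epsilon>" "\<epsilon> \<le> 0.1" using l by (auto simp: le)
  have "\<epsilon> \<noteq> 0"
  proof
    assume "\<epsilon> = 0"
    then have te0: "(\<lambda>n. e (\<phi> n)) \<longlonglongrightarrow> 0" using te by simp
    have "(\<lambda>n. alpha_bar (e (\<phi> n)) + 0.0594 * (e (\<phi> n))\<^sup>2) \<longlonglongrightarrow> (pi / 2 + 0\<^sup>2 / 5 * (3 * pi / 2 - 1)) + 0.0594 * 0\<^sup>2"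
      unfolding alpha_bar_def by (intro tendsto_intros te0) auto
    moreover have "\<alpha>h (e (\<phi> n)) \<le> alpha_bar (e (\<phi> n)) + 0.0594 * (e (\<phi> n))\<^sup>2" for n
    proof -
      have "\<bar>\<alpha>h (e (\<phi> n)) - alpha_bar (e (\<phi> n))\<bar> < 0.0594 * (e (\<phi> n))\<^sup>2"
        using local_zero[OF eI] unfolding is_local_zero_def by blast
      then show ?thesis by linarith
    qed
    ultimately have "\<alpha> \<le> (pi / 2 + 0\<^sup>2 / 5 * (3 * pi / 2 - 1)) + 0.0594 * 0\<^sup>2"
      using LIMSEQ_le[OF ta] by blast
    then show False using p(2) by (simp add: pe)
  qed
  then have \<epsilon>I: "\<epsilon> \<in> {0<..0.1}" using \<epsilon>01 by simp
  have seq: "(\<lambda>n. f (e (\<phi> n))) \<longlonglongrightarrow> f \<epsilon>" if "continuous_on {0<..0.1} f" for f :: "real \<Rightarrow> real"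
    by (rule continuous_on_tendsto_compose[OF that te \<epsilon>I]) (use eI in auto)
  have \<alpha>: "\<alpha> = \<alpha>h \<epsilon>" using LIMSEQ_unique[OF ta seq[OF alpha_continuous]] .
  have "\<epsilon> \<noteq> 0.1"
  proof
    assume e: "\<epsilon> = 0.1"
    have "Amax < \<alpha>" unfolding \<alpha> e by (rule Amax_less)
    then show False using p(3) by (simp add: pe)
  qed
  then have \<epsilon>1: "0 < \<epsilon>" "\<epsilon> < 0.1" using \<epsilon>I by auto
  have "(\<lambda>n. 2 * pi / \<omega>h (e (\<phi> n))) \<longlonglongrightarrow> 2 * pi / \<omega>h \<epsilon>"
    using coef_facts(7)[OF \<epsilon>I] by (intro tendsto_intros seq[OF omega_continuous]) auto
  then have L: "L = 2 * pi / \<omega>h \<epsilon>" using LIMSEQ_unique[OF tL] by blast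
  have "apply_bcontfun z s = Yp \<epsilon> (s - \<tau>)" for s
  proof (rule LIMSEQ_unique)
    show "(\<lambda>n. Yp (e (\<phi> n)) (s - frac (t (\<phi> n)))) \<longlonglongrightarrow> apply_bcontfun z s"
    proof -
      have "(\<lambda>n. apply_bcontfun (snd (snd (X (\<phi> n)))) s) \<longlonglongrightarrow> apply_bcontfun z s"
      proof (rule LIM_zero_cancel, rule Lim_null_comparison[rotated])
        show "(\<lambda>n. dist (snd (snd (X (\<phi> n)))) z) \<longlonglongrightarrow> 0" by (rule iffD1[OF tendsto_dist_iff tX(3)])
        show "\<forall>\<^sub>F n in sequentially. norm (apply_bcontfun (snd (snd (X (\<phi> n)))) s - apply_bcontfun z s) \<le> dist (snd (snd (X (\<phi> n)))) z"
        proof (rule always_eventually, rule allI)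
          fix n show "norm (apply_bcontfun (snd (snd (X (\<phi> n)))) s - apply_bcontfun z s) \<le> dist (snd (snd (X (\<phi> n)))) z"
            using dist_bounded[of "snd (snd (X (\<phi> n)))" s z] unfolding dist_norm[where 'a=real] .
        qed
      qed
      moreover have "apply_bcontfun (snd (snd (X n))) s = Yp (e n) (s - frac (t n))" for n
      proof -
        have eq: "s - frac (t n) = s - t n + of_int \<lfloor>t n\<rfloor>" by (simp add: frac_def)
        show ?thesis unfolding Xz eq by (rule Yp_periodic[OF eI, symmetric])
      qed
      ultimately show ?thesis by (simp only:)
    qed
    have "continuous_on UNIV (Yp \<epsilon>)" by (rule profile_continuous[OF coef_facts(5)[OF \<epsilon>I]])
    then have c: "(\<lambda>n. Yp \<epsilon> (s - frac (t (\<phi> n)))) \<longlonglongrightarrow> Yp \<epsilon> (s - \<tau>)"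
      by (rule continuous_on_tendsto_compose) (auto intro!: tendsto_intros tt)
    have "(\<lambda>n. Yp (e (\<phi> n)) (s - frac (t (\<phi> n))) - Yp \<epsilon> (s - frac (t (\<phi> n)))) \<longlonglongrightarrow> 0"
    proof (rule tendstoI)
      fix r :: real assume "r > 0"
      from Yp_close[OF \<epsilon>I this] obtain d where d: "d > 0" "\<And>\<eta>. \<eta> \<in> {0<..0.1} \<Longrightarrow> \<eta> \<noteq> \<epsilon> \<Longrightarrow> dist \<eta> \<epsilon> < d \<Longrightarrow> \<forall>s. \<bar>Yp \<eta> s - Yp \<epsilon> s\<bar> < r"
        unfolding eventually_at by auto
      have "\<forall>\<^sub>F n in sequentially. dist (e (\<phi> n)) \<epsilon> < d" using te d(1) unfolding tendsto_iff by blast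
      then show "\<forall>\<^sub>F n in sequentially. dist (Yp (e (\<phi> n)) (s - frac (t (\<phi> n))) - Yp \<epsilon> (s - frac (t (\<phi> n)))) 0 < r"
      proof eventually_elim
        case (elim n)
        show ?case
          using d(2)[OF eI[of "\<phi> n"] _ elim] \<open>r > 0\<close> by (cases "e (\<phi> n) = \<epsilon>") (auto simp: dist_real_def)
      qed
    qed
    from tendsto_add[OF this c] show "(\<lambda>n. Yp (e (\<phi> n)) (s - frac (t (\<phi> n)))) \<longlonglongrightarrow> Yp \<epsilon> (s - \<tau>)" by simp
  qed
  moreover have "(\<alpha>, L, z) \<in> sops_set" using p(1) unfolding pe .
  ultimately show ?thesis unfolding pe curve_def mem_Collect_eq case_prod_conv using \<epsilon>1 \<alpha> L by blast
qed

text \<open>Branch profiles near that of p are slowly oscillating after a further small translation,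
  whose effect the Lipschitz bound controls. The intermediate value theorem for \<alpha> then
  reaches every nearby parameter value.\<close>

lemma curve_persist:
  assumes p: "p \<in> curve" and e: "e > 0"
  shows "\<exists>\<delta>>0. \<forall>\<alpha>. \<bar>\<alpha> - fst p\<bar> < \<delta> \<longrightarrow> (\<exists>q\<in>curve. fst q = \<alpha> \<and> dist q p < e)"
proof -
  obtain \<alpha>0 L0 z0 where pe: "p = (\<alpha>0, L0, z0)" by (cases p)
  from p obtain \<epsilon> \<tau> where ps: "(\<alpha>0, L0, z0) \<in> sops_set" and \<epsilon>1: "0 < \<epsilon>" "\<epsilon> < 0.1" and \<alpha>0: "\<alpha>0 = \<alpha>h \<epsilon>" and L0: "L0 = 2 * pi / \<omega>h \<epsilon>"
    and zY: "\<And>s. apply_bcontfun z0 s = Yp \<epsilon> (s - \<tau>)" unfolding curve_def pe by blast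
  have \<epsilon>I: "\<epsilon> \<in> {0<..0.1}" using \<epsilon>1 by simp
  note cf = coef_facts[OF \<epsilon>I]
  have w0: "wright_profile \<alpha>0 (2 * pi / L0) (apply_bcontfun z0)" and sp0: "sign_pattern L0 (apply_bcontfun z0)" and L0p: "L0 > 0"
    using ps unfolding sops_set_iff by blast+
  have \<alpha>0p: "\<alpha>0 > 0" using cf(8) by (simp add: \<alpha>0)
  define K where "K = 2 * \<bar>\<alpha>0 * (2 * pi / (2 * pi / L0))\<bar>"
  have M: "\<bar>apply_bcontfun z0 s\<bar> \<le> 1" for s using cf(6)[of "s - \<tau>"] by (simp add: zY)
  have lip: "\<bar>apply_bcontfun z0 x - apply_bcontfun z0 y\<bar> \<le> K * \<bar>x - y\<bar>" for x y
    unfolding K_def by (rule profile_lipschitz[OF w0 M])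
  have K0: "K \<ge> 0" by (simp add: K_def)
  \<comment> \<open>Bounds the admissible translation so that its effect, at most K e1, is at most e
    / 8; K + 1 avoids division by 0.\<close>
  define e1 where "e1 = e / (8 * (K + 1))"
  have e1: "e1 > 0" "K * e1 \<le> e / 8"
  proof -
    show "e1 > 0" using e K0 by (simp add: e1_def)
    then have "K * e1 \<le> (K + 1) * e1" by (intro mult_right_mono) auto
    also have "(K + 1) * e1 = e / 8" using K0 by (simp add: e1_def field_simps)
    finally show "K * e1 \<le> e / 8" .
  qed
  obtain d where d: "d > 0"
    and persist: "\<And>\<alpha> L w. \<bar>\<alpha> - \<alpha>0\<bar> < d \<Longrightarrow> \<bar>L - L0\<bar> < d \<Longrightarrow> (\<And>s. \<bar>w s - apply_bcontfun z0 s\<bar> < d) \<Longrightarrow> wright_profile \<alpha> (2 * pi / L) w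
      \<Longrightarrow> L > 0 \<and> (\<exists>\<sigma>. \<bar>\<sigma>\<bar> < e1 \<and> sign_pattern L (\<lambda>s. w (s + \<sigma>)))"
    using sops_persist[OF w0 L0p \<alpha>0p sp0 e1(1)] by blast
  define d' where "d' = min d (e / 8)"
  have d': "d' > 0" "d' \<le> d" "d' \<le> e / 8" using d e by (auto simp: d'_def)
  let ?F = "at \<epsilon> within {0<..0.1}"
  have "(\<alpha>h \<longlongrightarrow> \<alpha>0) ?F" "(\<omega>h \<longlongrightarrow> \<omega>h \<epsilon>) ?F"
    using alpha_continuous omega_continuous \<epsilon>I by (simp_all add: continuous_on_def \<alpha>0)
  then have tl: "(\<alpha>h \<longlongrightarrow> \<alpha>0) ?F" "((\<lambda>\<eta>. 2 * pi / \<omega>h \<eta>) \<longlongrightarrow> L0) ?F"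
    using cf(7) by (auto simp: L0 intro!: tendsto_intros)
  have "\<forall>\<^sub>F \<eta> in ?F. dist (\<alpha>h \<eta>) \<alpha>0 < d' \<and> dist (2 * pi / \<omega>h \<eta>) L0 < d' \<and> (\<forall>s. \<bar>Yp \<eta> s - Yp \<epsilon> s\<bar> < d')"
    by (intro eventually_conj tendstoD[OF tl(1) d'(1)] tendstoD[OF tl(2) d'(1)] Yp_close[OF \<epsilon>I d'(1)])
  then obtain r where r: "r > 0" "\<And>\<eta>. \<eta> \<in> {0<..0.1} \<Longrightarrow> \<eta> \<noteq> \<epsilon> \<Longrightarrow> dist \<eta> \<epsilon> < r \<Longrightarrow>
      dist (\<alpha>h \<eta>) \<alpha>0 < d' \<and> dist (2 * pi / \<omega>h \<eta>) L0 < d' \<and> (\<forall>s. \<bar>Yp \<eta> s - Yp \<epsilon> s\<bar> < d')"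
    unfolding eventually_at by auto
  have near: "\<exists>q\<in>curve. fst q = \<alpha>h \<eta> \<and> dist q p < e" if \<eta>: "0 < \<eta>" "\<eta> < 0.1" "dist \<eta> \<epsilon> < r" for \<eta>
  proof -
    have \<eta>I: "\<eta> \<in> {0<..0.1}" using \<eta> by simp
    have cl: "dist (\<alpha>h \<eta>) \<alpha>0 < d'" "dist (2 * pi / \<omega>h \<eta>) L0 < d'" "\<And>s. \<bar>Yp \<eta> s - Yp \<epsilon> s\<bar> < d'"
      using r(2)[OF \<eta>I _ \<eta>(3)] d' by (cases "\<eta> = \<epsilon>"; auto simp: \<alpha>0 L0)+
    note cn = coef_facts[OF \<eta>I]
    let ?L = "2 * pi / \<omega>h \<eta>" and ?w = "\<lambda>s. Yp \<eta> (s + - \<tau>)"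
    have wL: "2 * pi / ?L = \<omega>h \<eta>" using cn(7) by simp
    have wp: "wright_profile (\<alpha>h \<eta>) (2 * pi / ?L) ?w" unfolding wL by (rule wright_profile_shift[OF cn(5)])
    have wn: "\<bar>?w s - apply_bcontfun z0 s\<bar> < d'" for s using cl(3)[of "s - \<tau>"] by (simp add: zY)
    have "?L > 0 \<and> (\<exists>\<sigma>. \<bar>\<sigma>\<bar> < e1 \<and> sign_pattern ?L (\<lambda>s. ?w (s + \<sigma>)))"
    proof (rule persist)
      show "\<bar>\<alpha>h \<eta> - \<alpha>0\<bar> < d" "\<bar>?L - L0\<bar> < d"
        using cl(1,2) d'(2) unfolding dist_real_def by linarith+
      show "\<bar>?w s - apply_bcontfun z0 s\<bar> < d" for s by (rule order.strict_trans2[OF wn d'(2)])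
      show "wright_profile (\<alpha>h \<eta>) (2 * pi / ?L) ?w" by (rule wp)
    qed
    then obtain \<sigma> where \<sigma>: "?L > 0" "\<bar>\<sigma>\<bar> < e1" "sign_pattern ?L (\<lambda>s. ?w (s + \<sigma>))" by blast
    let ?f = "\<lambda>s. ?w (s + \<sigma>)"
    have wf: "wright_profile (\<alpha>h \<eta>) (2 * pi / ?L) ?f" by (rule wright_profile_shift[OF wp])
    have fb: "?f \<in> bcontfun"
    proof (rule bcontfun_normI[of _ "0.25"])
      show "continuous_on UNIV ?f" by (rule profile_continuous[OF wf])
      show "norm (?f s) \<le> 0.25" for s unfolding real_norm_def by (rule less_imp_le[OF cn(6)])
    qed
    define y where "y = Bcontfun ?f"
    have y: "apply_bcontfun y = ?f" unfolding y_def by (rule Bcontfun_inverse[OF fb])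
    have q: "(\<alpha>h \<eta>, ?L, y) \<in> curve"
      unfolding curve_def
    proof (clarsimp simp only: mem_Collect_eq case_prod_conv, intro conjI exI)
      show "(\<alpha>h \<eta>, ?L, y) \<in> sops_set" unfolding sops_set_iff y using \<sigma> wf by blast
      show "0 < \<eta>" "\<eta> < 0.1" "\<alpha>h \<eta> = \<alpha>h \<eta>" "?L = ?L" using \<eta> by simp_all
      show "\<forall>s. apply_bcontfun y s = Yp \<eta> (s - (\<tau> - \<sigma>))" unfolding y by (simp add: algebra_simps)
    qed
    have "dist y z0 \<le> e / 4"
    proof (rule dist_bound)
      fix s
      have "\<bar>?f s - apply_bcontfun z0 (s + \<sigma>)\<bar> < d'" by (rule wn)
      moreover have "\<bar>apply_bcontfun z0 (s + \<sigma>) - apply_bcontfun z0 s\<bar> \<le> K * \<bar>s + \<sigma> - s\<bar>" by (rule lip)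
      moreover have "K * \<bar>s + \<sigma> - s\<bar> \<le> K * e1" using \<sigma> K0 by (intro mult_left_mono) auto
      ultimately have "\<bar>?f s - apply_bcontfun z0 s\<bar> \<le> e / 4" using d' e1 by linarith
      then show "dist (apply_bcontfun y s) (apply_bcontfun z0 s) \<le> e / 4" unfolding y by (simp add: dist_real_def)
    qed
    moreover have "dist (\<alpha>h \<eta>, ?L, y) p \<le> dist (\<alpha>h \<eta>) \<alpha>0 + (dist ?L L0 + dist y z0)"
    proof -
      have "dist (\<alpha>h \<eta>, ?L, y) p \<le> dist (\<alpha>h \<eta>) \<alpha>0 + dist (?L, y) (L0, z0)"
        unfolding pe dist_Pair_Pair[of "\<alpha>h \<eta>"] by (rule sqrt_sum_squares_le_sum[OF zero_le_dist zero_le_dist])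
      moreover have "dist (?L, y) (L0, z0) \<le> dist ?L L0 + dist y z0"
        unfolding dist_Pair_Pair by (rule sqrt_sum_squares_le_sum[OF zero_le_dist zero_le_dist])
      ultimately show ?thesis by linarith
    qed
    ultimately have "dist (\<alpha>h \<eta>, ?L, y) p < e" using cl(1,2) d' e by linarith
    then show ?thesis using q by force
  qed
  \<comment> \<open>Keeps \<epsilon> - h and \<epsilon> + h inside (0, 0.1) and within r of
    \<epsilon>.\<close>
  define h where "h = min (r / 2) (min (\<epsilon> / 2) ((0.1 - \<epsilon>) / 2))"
  have h: "h > 0" "h \<le> r / 2" "h \<le> \<epsilon> / 2" "h \<le> (0.1 - \<epsilon>) / 2"
  proof -
    show "h > 0" unfolding h_def using r(1) \<epsilon>1 by simp
    show "h \<le> r / 2" unfolding h_def by (rule min.cobounded1)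
    show "h \<le> \<epsilon> / 2" unfolding h_def by (rule min.coboundedI2[OF min.cobounded1])
    show "h \<le> (0.1 - \<epsilon>) / 2" unfolding h_def by (rule min.coboundedI2[OF min.cobounded2])
  qed
  have I: "\<epsilon> - h \<in> {0<..0.1}" "\<epsilon> + h \<in> {0<..0.1}" using h \<epsilon>1 by auto
  have m: "\<alpha>h (\<epsilon> - h) < \<alpha>0" "\<alpha>0 < \<alpha>h (\<epsilon> + h)"
    using alpha_strict_mono[OF I(1) \<epsilon>I] alpha_strict_mono[OF \<epsilon>I I(2)] h(1) by (simp_all add: \<alpha>0)
  show ?thesis
  proof (intro exI[of _ "min (\<alpha>0 - \<alpha>h (\<epsilon> - h)) (\<alpha>h (\<epsilon> + h) - \<alpha>0)"] conjI allI impI)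
    show "0 < min (\<alpha>0 - \<alpha>h (\<epsilon> - h)) (\<alpha>h (\<epsilon> + h) - \<alpha>0)" using m by simp
    fix \<alpha> assume "\<bar>\<alpha> - fst p\<bar> < min (\<alpha>0 - \<alpha>h (\<epsilon> - h)) (\<alpha>h (\<epsilon> + h) - \<alpha>0)"
    then have "\<alpha>h (\<epsilon> - h) \<le> \<alpha>" "\<alpha> \<le> \<alpha>h (\<epsilon> + h)" by (auto simp: pe)
    moreover have "continuous_on {\<epsilon> - h..\<epsilon> + h} \<alpha>h"
      by (rule continuous_on_subset[OF alpha_continuous]) (use I in auto)
    ultimately obtain \<eta> where \<eta>: "\<epsilon> - h \<le> \<eta>" "\<eta> \<le> \<epsilon> + h" "\<alpha>h \<eta> = \<alpha>"
      using IVT'[of \<alpha>h "\<epsilon> - h" \<alpha> "\<epsilon> + h"] h(1) by auto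
    have "0 < \<eta>" "\<eta> < 0.1" "dist \<eta> \<epsilon> < r" using \<eta> h \<epsilon>1 by (auto simp: dist_real_def)
    from near[OF this] show "\<exists>q\<in>curve. fst q = \<alpha> \<and> dist q p < e" using \<eta>(3) by simp
  qed
qed

text \<open>The Hopf point together with the curve is clopen in the component. Openness is phrased
  as sequential closedness of the complement, where \<open>curve_open\<close> and
  \<open>hopf_open\<close> are spent.\<close>

lemma hopf_branch_subset: "hopf_branch Amax \<subseteq> curve"
proof -
  let ?S = "insert hopf_point {p \<in> sops_set. pi / 2 < fst p \<and> fst p \<le> Amax}"
  let ?Z = "connected_component_set ?S hopf_point"
  let ?T = "?Z \<inter> insert hopf_point curve"
  have sub: "?Z \<subseteq> ?S" by (rule connected_component_subset)
  have hZ: "hopf_point \<in> ?Z" by (simp add: connected_component_refl)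
  have cl: "closedin (top_of_set ?Z) ?T"
  proof (rule closedinI_sequential)
    show "?T \<subseteq> ?Z" by blast
    fix X p assume A: "(\<forall>n. X n \<in> ?T) \<and> p \<in> ?Z \<and> X \<longlonglongrightarrow> p"
    show "p \<in> ?T"
    proof (cases "p = hopf_point")
      case True then show ?thesis using hZ by simp
    next
      case False
      then have "\<forall>\<^sub>F n in sequentially. X n \<noteq> hopf_point" using A tendsto_imp_eventually_ne by blast
      then obtain N where N: "\<And>n. n \<ge> N \<Longrightarrow> X n \<noteq> hopf_point" unfolding eventually_sequentially by blast
      have "p \<in> curve"
      proof (rule curve_closed)
        show "X (n + N) \<in> curve" for n using A N[of "n + N"] by auto
        show "(\<lambda>n. X (n + N)) \<longlonglongrightarrow> p" using A LIMSEQ_ignore_initial_segment by blast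
        show "p \<in> sops_set" "pi / 2 < fst p" "fst p \<le> Amax" using A sub False by blast+
      qed
      then show ?thesis using A by blast
    qed
  qed
  have op: "closedin (top_of_set ?Z) (?Z - ?T)"
  proof (rule closedinI_sequential)
    show "?Z - ?T \<subseteq> ?Z" by blast
    fix X p assume A: "(\<forall>n. X n \<in> ?Z - ?T) \<and> p \<in> ?Z \<and> X \<longlonglongrightarrow> p"
    then have Xs: "X n \<in> sops_set" "X n \<notin> curve" for n using sub by blast+
    have no: "\<not> (\<forall>\<^sub>F n in sequentially. X n \<in> curve)" using Xs(2) by simp
    have lim: "X \<longlonglongrightarrow> p" using A by blast
    have "p \<notin> insert hopf_point curve"
      using hopf_open[of X, OF Xs(1)] curve_open[of p X, OF _ Xs(1) lim] lim no by blast
    then show "p \<in> ?Z - ?T" using A by blast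
  qed
  have "openin (top_of_set ?Z) ?T"
    using op by (simp add: closedin_def Diff_Diff_Int Int_absorb1 Int_assoc)
  then have "?T = {} \<or> ?T = ?Z"
    using cl connected_connected_component[of ?S hopf_point] unfolding connected_clopen by blast
  then have "?T = ?Z" using hZ by blast
  then show ?thesis unfolding hopf_branch_def by blast
qed

text \<open>Turns the sequential openness of the curve among all slowly oscillating solutions into a
  ball.\<close>

lemma curve_isolated:
  assumes p: "p \<in> curve"
  obtains r where "r > 0" "\<And>x. x \<in> sops_set \<Longrightarrow> dist x p < r \<Longrightarrow> x \<in> curve"
proof (rule ccontr)
  assume "\<not> thesis"
  then have "\<exists>x. x \<in> sops_set \<and> dist x p < inverse (real (Suc n)) \<and> x \<notin> curve" for n
    using that[of "inverse (real (Suc n))"] by auto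
  then obtain X where X: "\<And>n. X n \<in> sops_set" "\<And>n. dist (X n) p < inverse (real (Suc n))" "\<And>n. X n \<notin> curve" by metis
  have "X \<longlonglongrightarrow> p"
  proof (rule iffD2[OF tendsto_dist_iff], rule Lim_null_comparison[OF always_eventually LIMSEQ_inverse_real_of_nat], rule allI)
    show "norm (dist (X n) p) \<le> inverse (real (Suc n))" for n
      unfolding real_norm_def abs_of_nonneg[OF zero_le_dist] by (rule less_imp_le[OF X(2)])
  qed
  from curve_open[OF p X(1) this] show False using X(3) by simp
qed

text \<open>\<open>curve_unique\<close> makes the curve a graph, \<open>curve_persist\<close>
  provides an interval around \<open>fst p\<close> as domain and continuity of the graph function,
  and \<open>curve_isolated\<close> excludes other solutions nearby.\<close>

lemma curve_not_bifurcation: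
  assumes p: "p \<in> curve"
  shows "\<not> bifurcation_point p"
proof -
  obtain r where r: "r > 0" "\<And>x. x \<in> sops_set \<Longrightarrow> dist x p < r \<Longrightarrow> x \<in> curve" using curve_isolated[OF p] by blast
  obtain \<delta> where \<delta>: "\<delta> > 0" "\<And>\<alpha>. \<bar>\<alpha> - fst p\<bar> < \<delta> \<Longrightarrow> \<exists>q\<in>curve. fst q = \<alpha> \<and> dist q p < r"
    using curve_persist[OF p r(1)] by blast
  let ?I = "{fst p - \<delta> <..< fst p + \<delta>}"
  define g where "g \<alpha> = (THE v. (\<alpha>, v) \<in> curve)" for \<alpha>
  have g: "snd q = g (fst q)" if "q \<in> curve" for q
  proof -
    have "(THE v. (fst q, v) \<in> curve) = snd q"
    proof (rule the_equality)
      show "(fst q, snd q) \<in> curve" using that by simp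
      fix v assume v: "(fst q, v) \<in> curve"
      obtain L z L' z' where "v = (L, z)" "snd q = (L', z')" by (cases v; cases "snd q") auto
      then show "v = snd q" using curve_unique[of "fst q" L z L' z'] v that by (metis prod.collapse)
    qed
    then show ?thesis by (simp add: g_def)
  qed
  have gc: "(\<alpha>, g \<alpha>) \<in> curve \<and> dist (\<alpha>, g \<alpha>) p < r" if "\<alpha> \<in> ?I" for \<alpha>
  proof -
    have "\<bar>\<alpha> - fst p\<bar> < \<delta>" using that by auto
    from \<delta>(2)[OF this] obtain q where q: "q \<in> curve" "fst q = \<alpha>" "dist q p < r" by blast
    have "q = (\<alpha>, g \<alpha>)" using g[OF q(1)] q(2) by (metis prod.collapse)
    then show ?thesis using q by simp
  qed
  have cont: "continuous_on ?I g"
    unfolding continuous_on_iff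
  proof (intro ballI allI impI)
    fix \<alpha>1 e assume \<alpha>1: "\<alpha>1 \<in> ?I" and e: "(e::real) > 0"
    have "(\<alpha>1, g \<alpha>1) \<in> curve" using gc[OF \<alpha>1] by blast
    from curve_persist[OF this e] obtain d where d: "d > 0"
      "\<And>\<alpha>. \<bar>\<alpha> - \<alpha>1\<bar> < d \<Longrightarrow> \<exists>q\<in>curve. fst q = \<alpha> \<and> dist q (\<alpha>1, g \<alpha>1) < e" by auto
    show "\<exists>d>0. \<forall>x'\<in>?I. dist x' \<alpha>1 < d \<longrightarrow> dist (g x') (g \<alpha>1) < e"
    proof (intro exI[of _ d] conjI ballI impI d(1))
      fix x' assume "dist x' \<alpha>1 < d"
      then obtain q where q: "q \<in> curve" "fst q = x'" "dist q (\<alpha>1, g \<alpha>1) < e" using d(2)[of x'] by (auto simp: dist_real_def)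
      have "dist (g x') (g \<alpha>1) = dist (snd q) (snd (\<alpha>1, g \<alpha>1))" using g[OF q(1)] q(2) by simp
      also have "\<dots> \<le> dist q (\<alpha>1, g \<alpha>1)" by (rule dist_snd_le)
      finally show "dist (g x') (g \<alpha>1) < e" using q(3) by simp
    qed
  qed
  \<comment> \<open>The strip removes solutions of the ball whose parameter lies outside the domain
    of g; conversely the graph stays in the ball because \<open>curve_persist\<close> was applied
    with the same radius r.\<close>
  let ?N = "ball p r \<inter> {x. fst x \<in> ?I}"
  have oN: "open ?N"
    using open_vimage_fst[of ?I] by (intro open_Int open_ball) (simp add: vimage_def)
  have cs: "curve \<subseteq> sops_set" unfolding curve_def by auto
  have "sops_set \<inter> ?N = (\<lambda>\<alpha>. (\<alpha>, g \<alpha>)) ` ?I"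
  proof (intro equalityI subsetI)
    fix x assume x: "x \<in> sops_set \<inter> ?N"
    then have "x \<in> curve" using r(2)[of x] by (simp add: dist_commute)
    then have "x = (fst x, g (fst x))" using g[of x] by (metis prod.collapse)
    then show "x \<in> (\<lambda>\<alpha>. (\<alpha>, g \<alpha>)) ` ?I" using x by blast
  next
    fix x assume "x \<in> (\<lambda>\<alpha>. (\<alpha>, g \<alpha>)) ` ?I"
    then show "x \<in> sops_set \<inter> ?N" using gc cs by (auto simp: dist_commute)
  qed
  moreover have "p \<in> ?N" using r(1) \<delta>(1) by simp
  ultimately show ?thesis unfolding bifurcation_point_def using oN cont \<delta>(1) by blast
qed

end

theorem theorem4p7:
  fixes \<alpha>h \<omega>h :: "real \<Rightarrow> real" and ch :: "real \<Rightarrow> cseq"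
  assumes unique_zero:
      "\<And>\<epsilon> \<alpha> \<omega> c. 0 < \<epsilon> \<Longrightarrow> \<epsilon> \<le> 0.1 \<Longrightarrow>
         is_local_zero \<epsilon> \<alpha> \<omega> c \<longleftrightarrow> \<alpha> = \<alpha>h \<epsilon> \<and> \<omega> = \<omega>h \<epsilon> \<and> c = ch \<epsilon>"
    and smooth: "smooth_family_on {0<..0.1} \<alpha>h \<omega>h ch"
  shows "(\<forall>\<epsilon>\<in>{0<..0.1}. \<exists>d>0. (\<alpha>h has_real_derivative d) (at \<epsilon> within {0<..0.1})) \<and>
         (\<forall>p\<in>hopf_branch (pi / 2 + 6.830 * 10 powi (-3)).
            \<not> bifurcation_point p)"
proof -
  interpret zero_branch \<alpha>h \<omega>h ch by unfold_locales (use unique_zero smooth in blast)+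
  show ?thesis using alpha_derivative_positive hopf_branch_subset curve_not_bifurcation by blast
qed

end
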